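(* Every $U_q(\mathfrak g)$-module $V$ in the category $\mathcal O_q^{\ge0}$ is completely reducible.
   Context: Modules are $\mathbb Z_2$-graded. Let $n$ be a positive integer, $\mathfrak g=\mathfrak q(n)$, $P=\bigoplus_{i=1}^n\mathbb Z\epsilon_i$, $P^\vee=\bigoplus_{i=1}^n\mathbb Zk_i$, $\langle k_j,\epsilon_i\rangle=\epsilon_i(k_j)=\delta_{ij}$, $P_{\ge0}=\{\sum\lambda_i\epsilon_i\in P\mid\lambda_i\ge0\ \forall i\}$. $U_q(\mathfrak g)$ is the unital associative superalgebra over $\mathbb C(q)$ generated by $L_{ij}$, for $i\le j$ with $i,j\in\{\pm1,\dots,\pm n\}$ ($L_{ij}$ of parity $p(i,j)$), with defining relations $L_{ii}L_{-i,-i}=L_{-i,-i}L_{ii}=1$ and, for all $i\le j$, $k\le l$, $$\begin{aligned}&(-1)^{p(i,j)p(k,l)}q^{\varphi(j,l)}L_{ij}L_{kl}+\{k\le j<l\}\theta(i,j,k)(q-q^{-1})L_{il}L_{kj}\\&\quad+\{i\le -l<j\le -k\}\theta(-i,-j,k)(q-q^{-1})L_{i,-l}L_{k,-j}\\&=q^{\varphi(i,k)}L_{kl}L_{ij}+\{k<i\le l\}\theta(i,j,k)(q-q^{-1})L_{il}L_{kj}\\&\quad+\{-l\le i<-k\le j\}\theta(-i,-j,k)(q-q^{-1})L_{-i,l}L_{-k,j},\end{aligned}$$ where $\varphi(i,j)=\delta_{|i|,|j|}\,\mathrm{sgn}(j)$, $\theta(i,j,k)=\mathrm{sgn}(\mathrm{sgn}(i)+\mathrm{sgn}(j)+\mathrm{sgn}(k))$,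 $p(i,j)=0$ if $ij>0$ and $1$ if $ij<0$, and $\{\cdots\}$ is $1$ if all inequalities inside hold and $0$ otherwise. Put $q^{\pm k_i}:=L_{\pm i,\pm i}$, $q^h:=\prod_i(q^{k_i})^{a_i}$ for $h=\sum a_ik_i\in P^\vee$, and $k_{\bar i}:=-\frac1{q-q^{-1}}L_{-i,i}$. For a $U_q(\mathfrak g)$-module $M$ and $\mu\in P$, $M_\mu=\{v\in M\mid q^hv=q^{\mu(h)}v\ \forall h\in P^\vee\}$ and $\mathrm{wt}(M)=\{\mu\mid M_\mu\ne0\}$. The category $\mathcal O_q^{\ge0}$ consists of finite dimensional $U_q(\mathfrak g)$-modules $M$ with $M=\bigoplus_{\mu\in P}M_\mu$ such that (i) $\mathrm{wt}(M)\subset P_{\ge0}$, and (ii) $k_{\bar i}|_{M_\mu}=0$ for all $\mu\in P_{\ge0}$ and $i\in\{1,\dots,n\}$ with $\langle k_i,\mu\rangle=0$. Completely reducible means a direct sum of irreducible submodules. *)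

theory Defs
  imports
    Complex_Main
    "HOL-Library.Poly_Mapping"
    "HOL-Library.Z2"
    "HOL-Computational_Algebra.Fraction_Field"
    "HOL-Computational_Algebra.Polynomial"
    "HOL-Algebra.QuotRing"
begin

section \<open>The base field\<close>

type_synonym Cq = "complex poly fract"

definition qq :: Cq where
  "qq = Fraction_Field.Fract [:0, 1:] 1"


section \<open>Free associative algebras on indexed generators\<close>

text \<open>The pair \<open>(i, j)\<close> is the letter for the generator \<open>L\<^sub>i\<^sub>j\<close>. Since the words form a monoid
  under concatenation, the product of \<open>word \<Rightarrow>\<^sub>0 Cq\<close> is the product of the free algebra.\<close>

datatype word = Word (letters: "(int \<times> int) list")

instantiation word :: monoid_add
begin

definition zero_word :: word where
  "0 = Word []"

definition plus_word :: "word \<Rightarrow> word \<Rightarrow> word" where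
  "u + v = Word (letters u @ letters v)"

instance
  by standard (simp_all add: zero_word_def plus_word_def)

end

type_synonym free = "word \<Rightarrow>\<^sub>0 Cq"

definition scalar :: "Cq \<Rightarrow> free" where
  "scalar c = Poly_Mapping.single 0 c"

definition gen :: "int \<Rightarrow> int \<Rightarrow> free" where
  "gen i j = Poly_Mapping.single (Word [(i, j)]) 1"

definition indices :: "nat \<Rightarrow> int set" where
  "indices n = {- int n..int n} - {0}"

definition generators :: "nat \<Rightarrow> (int \<times> int) set" where
  "generators n = {(i, j). i \<in> indices n \<and> j \<in> indices n \<and> i \<le> j}"

definition free_algebra :: "nat \<Rightarrow> free ring" where
  "free_algebra n =
    \<lparr>carrier = {x. \<forall>w \<in> Poly_Mapping.keys x. set (letters w) \<subseteq> generators n},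
     monoid.mult = (*), one = 1, ring.zero = 0, add = (+)\<rparr>"


section \<open>The quantum queer superalgebra\<close>

definition \<phi> :: "int \<Rightarrow> int \<Rightarrow> int" where
  "\<phi> i j = (if \<bar>i\<bar> = \<bar>j\<bar> then sgn j else 0)"

definition \<theta> :: "int \<Rightarrow> int \<Rightarrow> int \<Rightarrow> int" where
  "\<theta> i j k = sgn (sgn i + sgn j + sgn k)"

definition par :: "int \<Rightarrow> int \<Rightarrow> nat" where
  "par i j = (if i * j > 0 then 0 else 1)"

text \<open>In the definition below a factor \<open>gen a b\<close> may have \<open>a > b\<close>, but only in a term
  whose coefficient is zero.\<close>

definition relator :: "int \<Rightarrow> int \<Rightarrow> int \<Rightarrow> int \<Rightarrow> free" where
  "relator i j k l =
    (scalar ((-1) ^ (par i j * par k l) * qq powi \<phi> j l) * gen i j * gen k l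
     + scalar (of_bool (k \<le> j \<and> j < l) * of_int (\<theta> i j k) * (qq - inverse qq)) * gen i l * gen k j
     + scalar (of_bool (i \<le> - l \<and> - l < j \<and> j \<le> - k) * of_int (\<theta> (- i) (- j) k) * (qq - inverse qq))
         * gen i (- l) * gen k (- j))
    - (scalar (qq powi \<phi> i k) * gen k l * gen i j
       + scalar (of_bool (k < i \<and> i \<le> l) * of_int (\<theta> i j k) * (qq - inverse qq)) * gen i l * gen k j
       + scalar (of_bool (- l \<le> i \<and> i < - k \<and> - k \<le> j) * of_int (\<theta> (- i) (- j) k) * (qq - inverse qq))
           * gen (- i) l * gen (- k) j)"

definition relators :: "nat \<Rightarrow> free set" where
  "relators n =
    {gen i i * gen (- i) (- i) - 1 | i. i \<in> indices n}
    \<union> {relator i j k l | i j k l. (i, j) \<in> generators n \<and> (k, l) \<in> generators n}"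

definition rel_ideal :: "nat \<Rightarrow> free set" where
  "rel_ideal n = genideal (free_algebra n) (relators n)"

definition Uq :: "nat \<Rightarrow> free set ring" where
  "Uq n = free_algebra n Quot rel_ideal n"

definition proj :: "nat \<Rightarrow> free \<Rightarrow> free set" where
  "proj n x = rel_ideal n +>\<^bsub>free_algebra n\<^esub> x"

definition word_parity :: "word \<Rightarrow> bit" where
  "word_parity w = (\<Sum>(i, j) \<leftarrow> letters w. of_nat (par i j))"

definition Uq_part :: "nat \<Rightarrow> bit \<Rightarrow> free set set" where
  "Uq_part n a =
    proj n ` {x \<in> carrier (free_algebra n). \<forall>w \<in> Poly_Mapping.keys x. word_parity w = a}"

definition L_gen :: "nat \<Rightarrow> int \<Rightarrow> int \<Rightarrow> free set" where
  "L_gen n i j = proj n (gen i j)"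

definition k_bar :: "nat \<Rightarrow> int \<Rightarrow> free set" where
  "k_bar n i = proj n (scalar (- (1 / (qq - inverse qq)))) \<otimes>\<^bsub>Uq n\<^esub> L_gen n (- i) i"


section \<open>Weights\<close>

text \<open>The lattice \<open>P\<close> is represented by coordinates with respect to the \<open>\<epsilon>\<^sub>i\<close>, and its dual by
  coordinates with respect to the \<open>k\<^sub>i\<close>, both extended by zero outside \<open>{1..n}\<close>.\<close>

definition lattice_P :: "nat \<Rightarrow> (int \<Rightarrow> int) set" where
  "lattice_P n = {\<mu>. \<forall>i. i \<notin> {1..int n} \<longrightarrow> \<mu> i = 0}"

definition colattice_P :: "nat \<Rightarrow> (int \<Rightarrow> int) set" where
  "colattice_P n = {h. \<forall>i. i \<notin> {1..int n} \<longrightarrow> h i = 0}"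

definition lattice_P_ge0 :: "nat \<Rightarrow> (int \<Rightarrow> int) set" where
  "lattice_P_ge0 n = {\<mu> \<in> lattice_P n. \<forall>i \<in> {1..int n}. \<mu> i \<ge> 0}"

definition pairing :: "nat \<Rightarrow> (int \<Rightarrow> int) \<Rightarrow> (int \<Rightarrow> int) \<Rightarrow> int" where
  "pairing n h \<mu> = (\<Sum>i = 1..int n. h i * \<mu> i)"

definition k_basis :: "int \<Rightarrow> int \<Rightarrow> int" where
  "k_basis i = (\<lambda>j. if j = i then 1 else 0)"

definition q_ki_pow :: "nat \<Rightarrow> int \<Rightarrow> int \<Rightarrow> free set" where
  "q_ki_pow n i a =
    (if a \<ge> 0 then L_gen n i i [^]\<^bsub>Uq n\<^esub> nat a else L_gen n (- i) (- i) [^]\<^bsub>Uq n\<^esub> nat (- a))"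

definition q_pow :: "nat \<Rightarrow> (int \<Rightarrow> int) \<Rightarrow> free set" where
  "q_pow n h = foldr (\<lambda>i x. q_ki_pow n i (h i) \<otimes>\<^bsub>Uq n\<^esub> x) [1..int n] \<one>\<^bsub>Uq n\<^esub>"


section \<open>Modules\<close>

text \<open>\<open>internal_direct_sum I W X\<close> says that \<open>X\<close> is the internal direct sum of the \<open>W i\<close>
  with \<open>i \<in> I\<close>; the set \<open>I\<close> may be infinite.\<close>

definition internal_direct_sum :: "'i set \<Rightarrow> ('i \<Rightarrow> 'v::comm_monoid_add set) \<Rightarrow> 'v set \<Rightarrow> bool" where
  "internal_direct_sum I W X \<longleftrightarrow>
    (\<forall>i \<in> I. W i \<subseteq> X) \<and>
    (\<forall>v \<in> X. \<exists>!f. (\<forall>i \<in> I. f i \<in> W i) \<and> (\<forall>i. i \<notin> I \<longrightarrow> f i = 0) \<and>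
       finite {i. f i \<noteq> 0} \<and> v = (\<Sum>i | f i \<noteq> 0. f i))"

text \<open>A left supermodule over \<open>Uq n\<close>: the underlying space is the whole type \<open>'v\<close>, the action is
  \<open>act\<close>, and \<open>part 0\<close> and \<open>part 1\<close> are the even and the odd part.\<close>

locale Uq_module = vector_space scale
  for scale :: "Cq \<Rightarrow> 'v::ab_group_add \<Rightarrow> 'v" (infixr \<open>*s\<close> 75) +
  fixes n :: nat
    and act :: "free set \<Rightarrow> 'v \<Rightarrow> 'v"
    and part :: "bit \<Rightarrow> 'v set"
  assumes act_add_right: "x \<in> carrier (Uq n) \<Longrightarrow> act x (v + w) = act x v + act x w"
    and act_add_left: "x \<in> carrier (Uq n) \<Longrightarrow> y \<in> carrier (Uq n) \<Longrightarrow>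
           act (x \<oplus>\<^bsub>Uq n\<^esub> y) v = act x v + act y v"
    and act_mult: "x \<in> carrier (Uq n) \<Longrightarrow> y \<in> carrier (Uq n) \<Longrightarrow>
           act (x \<otimes>\<^bsub>Uq n\<^esub> y) v = act x (act y v)"
    and act_one: "act \<one>\<^bsub>Uq n\<^esub> v = v"
    and act_scalar: "act (proj n (scalar c)) v = c *s v"
    and subspace_part: "subspace (part a)"
    and direct_sum_part: "internal_direct_sum UNIV part UNIV"
    and act_part: "x \<in> Uq_part n a \<Longrightarrow> v \<in> part b \<Longrightarrow> act x v \<in> part (a + b)"
begin

definition weight_space :: "(int \<Rightarrow> int) \<Rightarrow> 'v set" where
  "weight_space \<mu> = {v. \<forall>h \<in> colattice_P n. act (q_pow n h) v = (qq powi pairing n h \<mu>) *s v}"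

definition wt :: "(int \<Rightarrow> int) set" where
  "wt = {\<mu> \<in> lattice_P n. weight_space \<mu> \<noteq> {0}}"

definition category_O_ge0 :: bool where
  "category_O_ge0 \<longleftrightarrow>
    (\<exists>B. finite B \<and> span B = UNIV) \<and>
    internal_direct_sum (lattice_P n) weight_space UNIV \<and>
    wt \<subseteq> lattice_P_ge0 n \<and>
    (\<forall>\<mu> \<in> lattice_P_ge0 n. \<forall>i \<in> {1..int n}. pairing n (k_basis i) \<mu> = 0 \<longrightarrow>
       (\<forall>v \<in> weight_space \<mu>. act (k_bar n i) v = 0))"

definition submodule :: "'v set \<Rightarrow> bool" where
  "submodule W \<longleftrightarrow>
    subspace W \<and> (\<forall>x \<in> carrier (Uq n). \<forall>v \<in> W. act x v \<in> W) \<and>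
    internal_direct_sum UNIV (\<lambda>a. W \<inter> part a) W"

definition irreducible_submodule :: "'v set \<Rightarrow> bool" where
  "irreducible_submodule W \<longleftrightarrow>
    submodule W \<and> W \<noteq> {0} \<and> (\<forall>W'. submodule W' \<and> W' \<subseteq> W \<longrightarrow> W' = {0} \<or> W' = W)"

definition completely_reducible :: bool where
  "completely_reducible \<longleftrightarrow>
    (\<exists>S. (\<forall>W \<in> S. irreducible_submodule W) \<and> internal_direct_sum S (\<lambda>W. W) UNIV)"

end


section \<open>Well-definedness of the algebra\<close>

lemma keys_scalar: "Poly_Mapping.keys (scalar c) \<subseteq> {Word []}"
  by (simp add: scalar_def zero_word_def)

lemma free_algebra_sel:
  "x \<otimes>\<^bsub>free_algebra n\<^esub> y = x * y" "x \<oplus>\<^bsub>free_algebra n\<^esub> y = x + y"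
  "\<one>\<^bsub>free_algebra n\<^esub> = 1" "\<zero>\<^bsub>free_algebra n\<^esub> = 0"
  by (simp_all add: free_algebra_def)

lemma free_algebra_closed:
  "0 \<in> carrier (free_algebra n)"
  "scalar c \<in> carrier (free_algebra n)"
  "x \<in> carrier (free_algebra n) \<Longrightarrow> - x \<in> carrier (free_algebra n)"
  "x \<in> carrier (free_algebra n) \<Longrightarrow> y \<in> carrier (free_algebra n) \<Longrightarrow>
     x + y \<in> carrier (free_algebra n)"
  "x \<in> carrier (free_algebra n) \<Longrightarrow> y \<in> carrier (free_algebra n) \<Longrightarrow>
     x - y \<in> carrier (free_algebra n)"
  "x \<in> carrier (free_algebra n) \<Longrightarrow> y \<in> carrier (free_algebra n) \<Longrightarrow>
     x * y \<in> carrier (free_algebra n)"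
  "(i, j) \<in> generators n \<Longrightarrow> gen i j \<in> carrier (free_algebra n)"
  using keys_scalar[of c] keys_add[of x y] keys_diff[of x y] keys_mult[of x y]
  by (fastforce simp: free_algebra_def plus_word_def gen_def)+

lemma one_free_algebra_closed: "1 \<in> carrier (free_algebra n)"
  using free_algebra_closed(2)[of 1 n] by (simp add: scalar_def)

lemma ring_free_algebra: "ring (free_algebra n)"
proof (rule ringI)
  show "abelian_group (free_algebra n)"
  proof (rule abelian_groupI, unfold free_algebra_sel)
    fix x assume "x \<in> carrier (free_algebra n)"
    then show "\<exists>y \<in> carrier (free_algebra n). y + x = 0"
      using free_algebra_closed(3) by (intro bexI[of _ "- x"]) auto
  qed (simp_all add: free_algebra_closed add.assoc add.commute)
  show "Group.monoid (free_algebra n)"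
    by (rule monoidI, unfold free_algebra_sel)
      (simp_all add: free_algebra_closed one_free_algebra_closed mult.assoc)
qed (unfold free_algebra_sel, simp_all only: distrib_left distrib_right)

lemma relators_subset: "relators n \<subseteq> carrier (free_algebra n)"
proof -
  let ?C = "carrier (free_algebra n)"
  have summand: "scalar (of_bool P * c * d) * gen i j * gen k l \<in> ?C"
    if "P \<Longrightarrow> (i, j) \<in> generators n \<and> (k, l) \<in> generators n" for P c d i j k l
  proof (cases P)
    case True
    then show ?thesis using that by (intro free_algebra_closed) auto
  next
    case False
    then show ?thesis by (simp add: scalar_def free_algebra_closed)
  qed
  have inv: "gen i i * gen (- i) (- i) - 1 \<in> ?C" if "i \<in> indices n" for i
    using that by (intro free_algebra_closed one_free_algebra_closed)
      (auto simp: generators_def indices_def)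
  have rel: "relator i j k l \<in> ?C" if "(i, j) \<in> generators n" "(k, l) \<in> generators n" for i j k l
    unfolding relator_def
    by (intro free_algebra_closed(4,5) summand)
      (use that in \<open>auto simp: generators_def indices_def intro!: free_algebra_closed(2,6,7)\<close>)
  show ?thesis
    unfolding relators_def using inv rel by blast
qed

lemma ideal_rel_ideal: "ideal (rel_ideal n) (free_algebra n)"
  unfolding rel_ideal_def
  by (rule ring.genideal_ideal[OF ring_free_algebra relators_subset])

lemma ring_Uq: "ring (Uq n)"
  unfolding Uq_def by (rule ideal.quotient_is_ring[OF ideal_rel_ideal])

end

theory Submission imports Defs begin

text \<open>
  Write \<open>N\<close> for the inverse of the triangular matrix with entries \<open>(-1)\<^bsup>p(i,j)\<^esup> L\<^sub>-\<^sub>i\<^sub>,\<^sub>-\<^sub>j\<close> and \<open>M = N L\<close>. In matrix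
  form the defining relations are \<open>L\<^sub>1\<^sub>2 L\<^sub>1\<^sub>3 S\<^sub>2\<^sub>3 = S\<^sub>2\<^sub>3 L\<^sub>1\<^sub>3 L\<^sub>1\<^sub>2\<close>, and a quantum supertrace of \<open>M\<close> is a
  central element \<open>C\<close>. On a highest weight vector of weight \<open>\<mu>\<close> it acts by a constant times
  \<open>\<Sum>\<^sub>j (q\<^bsup>2\<mu>\<^sub>j\<^esup> - q\<^bsup>-2\<mu>\<^sub>j\<^esup>)\<close>. Highest weights are decreasing sequences of nonnegative integers, and such a
  sequence can be recovered from this value since \<open>q\<close> is transcendental; so \<open>C\<close> separates the highest weights
  of all subquotients, and the module is the sum of the submodules generated by the spaces \<open>hw \<kappa>\<close> of highest
  weight vectors. On \<open>hw \<kappa>\<close> the odd Cartan generators anticommute and their squares are scalars; a scalar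
  vanishes only if \<open>\<kappa>\<^sub>i = 0\<close>, and then condition (ii) kills the generator itself. Averaging over these
  operators, as in Maschke's theorem, yields invariant complements in every \<open>hw \<kappa>\<close>, and these generate a
  complement of a given submodule.
\<close>

section \<open>Matrices with entries in a ring\<close>

text \<open>The generators form only one triangular half, while a Casimir element needs a lower and
  an upper triangular factor. The second factor comes from the odd symmetry: \<open>S\<close>
  commutes with the odd involution in one leg, so the conjugate of \<open>L\<close> by it satisfies
  the same relation as \<open>L\<close>, but is lower triangular. Its inverse \<open>N\<close> has
  no convenient closed form and is never expanded. Weights and linearity of its entries follow from
  the recursion for the inverse, and the eigenvalue of \<open>C\<close> from exchange relations
  between \<open>N\<close> and \<open>L\<close>. These couple partial sums of the diagonal entries
  of \<open>N L\<close> to the diagonal of \<open>L N\<close>; closed recursions arise only for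
  differences between the indices \<open>i\<close> and \<open>- i\<close>, which is what a
  supertrace asks for. A second obstacle is that \<open>C\<close> is not known to be diagonalizable,
  and that the field of rational functions is not algebraically closed, so eigenspace decompositions
  cannot be presupposed. Therefore the value of \<open>C\<close> is computed on top vectors of a
  quotient \<open>V / W\<close>, and a vector that is highest only modulo \<open>W\<close> is
  corrected explicitly, allowing for a remainder on which \<open>C - C_value \<mu>\<close> cannot be
  inverted.\<close>

definition mmul :: "'i set \<Rightarrow> ('i \<Rightarrow> 'i \<Rightarrow> 'r::{ring,monoid_mult}) \<Rightarrow> ('i \<Rightarrow> 'i \<Rightarrow> 'r) \<Rightarrow> 'i \<Rightarrow> 'i \<Rightarrow> 'r" where
  "mmul A X Y i j = (\<Sum>k\<in>A. X i k * Y k j)"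

definition idm :: "'i set \<Rightarrow> 'i \<Rightarrow> 'i \<Rightarrow> 'r::{ring,monoid_mult}" where
  "idm A i j = (if i = j \<and> i \<in> A then 1 else 0)"

text \<open>Forcing the entries outside \<open>A\<close> to be zero turns matrix identities into
  plain equalities of functions and makes \<open>idm A\<close> a unit.\<close>

definition supported :: "'i set \<Rightarrow> ('i \<Rightarrow> 'i \<Rightarrow> 'r::{ring,monoid_mult}) \<Rightarrow> bool" where
  "supported A X \<longleftrightarrow> (\<forall>i j. i \<notin> A \<or> j \<notin> A \<longrightarrow> X i j = 0)"

lemma mmul_assoc: "mmul A (mmul A X Y) Z = mmul A X (mmul A Y Z)"
proof (intro ext)
  fix i j
  have "mmul A (mmul A X Y) Z i j = (\<Sum>k\<in>A. \<Sum>l\<in>A. X i l * Y l k * Z k j)"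
    by (simp add: mmul_def sum_distrib_right)
  also have "\<dots> = (\<Sum>l\<in>A. \<Sum>k\<in>A. X i l * Y l k * Z k j)"
    by (rule sum.swap)
  finally show "mmul A (mmul A X Y) Z i j = mmul A X (mmul A Y Z) i j"
    by (simp add: mmul_def sum_distrib_left mult.assoc)
qed

lemma mmul_idm_left: "finite A \<Longrightarrow> supported A X \<Longrightarrow> mmul A (idm A) X = X"
proof (intro ext)
  fix i j assume "finite A" "supported A X"
  have "mmul A (idm A) X i j = (\<Sum>k\<in>A. if k = i then X k j else 0)"
    by (auto simp: mmul_def idm_def intro!: sum.cong)
  then show "mmul A (idm A) X i j = X i j"
    using \<open>finite A\<close> \<open>supported A X\<close> by (auto simp: supported_def)
qed

lemma mmul_idm_right: "finite A \<Longrightarrow> supported A X \<Longrightarrow> mmul A X (idm A) = X"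
proof (intro ext)
  fix i j assume "finite A" "supported A X"
  have "mmul A X (idm A) i j = (\<Sum>k\<in>A. if k = j then X i k else 0)"
    by (auto simp: mmul_def idm_def intro!: sum.cong)
  then show "mmul A X (idm A) i j = X i j"
    using \<open>finite A\<close> \<open>supported A X\<close> by (auto simp: supported_def)
qed

lemma supported_mmul: "supported A X \<Longrightarrow> supported A Y \<Longrightarrow> supported A (mmul A X Y)"
  by (auto simp: supported_def mmul_def)


section \<open>The R-matrix\<close>

text \<open>Coefficients live in \<open>{ring, monoid_mult}\<close> rather than
  \<open>ring_1\<close>, because the operators on the zero module form a ring with
  \<open>0 = 1\<close>. For the same reason \<open>of_bool\<close>, which needs
  \<open>zero_neq_one\<close>, is replaced by \<open>ob\<close>.\<close>

definition ob :: "bool \<Rightarrow> 'r::{ring,monoid_mult}" where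
  "ob b = (if b then 1 else 0)"

lemma ob_simps [simp]: "ob True = 1" "ob False = 0"
  by (simp_all add: ob_def)

definition pm :: "bool \<Rightarrow> 'r::{ring,monoid_mult}" where
  "pm b = (if b then -1 else 1)"

lemma pm_simps [simp]: "pm True = -1" "pm False = 1"
  by (simp_all add: pm_def)

definition odd_pair :: "int \<Rightarrow> int \<Rightarrow> bool" where
  "odd_pair i j \<longleftrightarrow> (i < 0) \<noteq> (j < 0)"

text \<open>Powers of \<open>q\<close> with exponent -1, 0 or 1, the only ones occurring in
  \<open>S\<close>. The inverse \<open>q'\<close> is passed along since the ring has no division;
  exchanging \<open>q\<close> and \<open>q'\<close> inverts each power.\<close>

definition qe :: "'r::{ring,monoid_mult} \<Rightarrow> 'r \<Rightarrow> int \<Rightarrow> 'r" where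
  "qe q q' k = (if k = 0 then 1 else if 0 < k then q else q')"

definition al :: "int \<Rightarrow> int \<Rightarrow> 'r::{ring,monoid_mult}" where
  "al j l = pm (j < 0 \<and> l < 0)"

definition be :: "int \<Rightarrow> int \<Rightarrow> 'r::{ring,monoid_mult}" where
  "be j l = - pm (j < 0 \<and> 0 < l)"

text \<open>Column \<open>(j, l)\<close> holds the image of \<open>e\<^sub>j \<otimes> e\<^sub>l\<close> under Olshanski's \<open>S\<close>. The signs \<open>al\<close> and \<open>be\<close>
  turn the super tensor product into an ordinary one.\<close>

definition smat :: "int set \<Rightarrow> 'r::{ring,monoid_mult} \<Rightarrow> 'r \<Rightarrow> int \<times> int \<Rightarrow> int \<times> int \<Rightarrow> 'r" where
  "smat I q q' p c = (let (j, l) = c in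
     if j \<in> I \<and> l \<in> I then
       (if p = (j, l) then qe q q' (\<phi> j l) else 0)
       + (if p = (l, j) then ob (j < l) * ((q - q') * al j l) else 0)
       + (if p = (- l, - j) then ob (- j < l) * ((q - q') * be j l) else 0)
     else 0)"

text \<open>The sign is that of an odd matrix unit in the second leg passing an odd basis vector of
  the third. All of it is placed here, so \<open>emb13\<close> carries no sign and both are ordinary
  matrices.\<close>

definition emb12 :: "int set \<Rightarrow> (int \<Rightarrow> int \<Rightarrow> 'r::{ring,monoid_mult}) \<Rightarrow> int \<times> int \<Rightarrow> int \<times> int \<Rightarrow> 'r" where
  "emb12 I X p c = (let (i, k) = p; (j, l) = c in
     if k = l \<and> k \<in> I then pm (odd_pair i j \<and> k < 0) * X i j else 0)"

definition emb13 :: "int set \<Rightarrow> (int \<Rightarrow> int \<Rightarrow> 'r::{ring,monoid_mult}) \<Rightarrow> int \<times> int \<Rightarrow> int \<times> int \<Rightarrow> 'r" where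
  "emb13 I X p c = (let (i, k) = p; (j, l) = c in if i = j \<and> i \<in> I then X k l else 0)"

locale index_set =
  fixes I :: "int set"
  assumes finite_I: "finite I" and zero_I: "0 \<notin> I" and uminus_I: "i \<in> I \<Longrightarrow> - i \<in> I"
begin

lemma uminus_I_iff: "- i \<in> I \<longleftrightarrow> i \<in> I"
  using uminus_I[of i] uminus_I[of "- i"] by (metis minus_minus)

lemma finite_II: "finite (I \<times> I)"
  using finite_I by simp

lemma I_nonzero: "i \<in> I \<Longrightarrow> i < 0 \<or> 0 < i"
  using zero_I by (metis linorder_neqE_linordered_idom)

lemma supported_emb12: "supported I X \<Longrightarrow> supported (I \<times> I) (emb12 I X)"
  by (auto simp: supported_def emb12_def)

lemma supported_emb13: "supported I X \<Longrightarrow> supported (I \<times> I) (emb13 I X)"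
  by (auto simp: supported_def emb13_def)

text \<open>\<open>odd_pair i j\<close> is the exclusive or of \<open>odd_pair i a\<close> and
  \<open>odd_pair a j\<close>, so the signs multiply. Hence \<open>emb12\<close> carries inverse
  matrices to inverse matrices.\<close>

lemma emb12_mult: "mmul (I \<times> I) (emb12 I X) (emb12 I Y) = emb12 I (mmul I X Y)"
proof (intro ext)
  fix p c :: "int \<times> int"
  obtain i k j l where pc: "p = (i, k)" "c = (j, l)" by (metis surj_pair)
  have "mmul (I \<times> I) (emb12 I X) (emb12 I Y) p c
      = (\<Sum>a\<in>I. \<Sum>b\<in>I. emb12 I X (i, k) (a, b) * emb12 I Y (a, b) (j, l))"
    by (simp add: mmul_def pc sum.cartesian_product case_prod_beta)
  also have "\<dots> = (\<Sum>a\<in>I. \<Sum>b\<in>I. if b = k then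
      (if k = l then pm (odd_pair i j \<and> k < 0) * (X i a * Y a j) else 0) else 0)"
    by (intro sum.cong refl) (auto simp: emb12_def pm_def odd_pair_def mmul_def)
  also have "\<dots> = emb12 I (mmul I X Y) p c"
    using finite_I by (cases "k = l"; cases "k \<in> I") (simp_all add: pc emb12_def mmul_def sum_distrib_left)
  finally show "mmul (I \<times> I) (emb12 I X) (emb12 I Y) p c = emb12 I (mmul I X Y) p c" .
qed

lemma emb12_idm: "emb12 I (idm I) = idm (I \<times> I)"
  by (auto simp: emb12_def idm_def fun_eq_iff odd_pair_def)

lemma smat_col:
  "smat I q q' p (j, l) = (if j \<in> I \<and> l \<in> I then
       (if p = (j, l) then qe q q' (\<phi> j l) else 0)
       + (if p = (l, j) then ob (j < l) * ((q - q') * al j l) else 0)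
       + (if p = (- l, - j) then ob (- j < l) * ((q - q') * be j l) else 0) else 0)"
  by (simp add: smat_def)

lemma supported_smat: "supported (I \<times> I) (smat I q q')"
  unfolding supported_def
proof (intro allI impI)
  fix p c :: "int \<times> int" assume pc: "p \<notin> I \<times> I \<or> c \<notin> I \<times> I"
  obtain j l where c: "c = (j, l)" by (metis surj_pair)
  show "smat I q q' p c = 0"
  proof (cases "j \<in> I \<and> l \<in> I")
    case False
    then have f: "(j \<in> I \<and> l \<in> I) = False" by simp
    show ?thesis unfolding c smat_col f by simp
  next
    case True
    then have "p \<noteq> (j, l)" "p \<noteq> (l, j)" "p \<noteq> (- l, - j)"
      using pc uminus_I[of j] uminus_I[of l] unfolding c by blast+
    then show ?thesis unfolding c smat_col by simp
  qed
qed

lemma mmul_smat_right: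
  assumes "j \<in> I" "l \<in> I"
  shows "mmul (I \<times> I) X (smat I q q') r (j, l) =
    X r (j, l) * qe q q' (\<phi> j l) + X r (l, j) * (ob (j < l) * ((q - q') * al j l))
    + X r (- l, - j) * (ob (- j < l) * ((q - q') * be j l))"
proof -
  have "mmul (I \<times> I) X (smat I q q') r (j, l) =
    (\<Sum>p\<in>I \<times> I. (if p = (j, l) then X r p * qe q q' (\<phi> j l) else 0))
    + (\<Sum>p\<in>I \<times> I. (if p = (l, j) then X r p * (ob (j < l) * ((q - q') * al j l)) else 0))
    + (\<Sum>p\<in>I \<times> I. (if p = (- l, - j) then X r p * (ob (- j < l) * ((q - q') * be j l)) else 0))"
    unfolding mmul_def sum.distrib[symmetric]
    using assms by (intro sum.cong refl) (simp only: smat_col if_True simp_thms distrib_left if_distrib[of "(*) _"] mult_zero_right)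
  then show ?thesis
    using assms finite_II uminus_I[OF assms(1)] uminus_I[OF assms(2)] by simp
qed

lemma smat_row:
  assumes "i \<in> I" "k \<in> I"
  shows "smat I q q' (i, k) p =
    (if p = (i, k) then qe q q' (\<phi> i k) else 0)
    + (if p = (k, i) then ob (k < i) * ((q - q') * al k i) else 0)
    + (if p = (- k, - i) then ob (k < - i) * ((q - q') * be (- k) (- i)) else 0)"
proof -
  obtain j l where p: "p = (j, l)" by (metis surj_pair)
  have e: "(i, k) = (j, l) \<longleftrightarrow> p = (i, k)" "(i, k) = (l, j) \<longleftrightarrow> p = (k, i)"
    "(i, k) = (- l, - j) \<longleftrightarrow> p = (- k, - i)" by (auto simp: p)
  show ?thesis
  proof (cases "j \<in> I \<and> l \<in> I")
    case True
    have t: "(j \<in> I \<and> l \<in> I) = True" using True by simp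
    show ?thesis
      unfolding p smat_col e[unfolded p] t if_True
      by (intro arg_cong2[of _ _ _ _ "(+)"] if_cong refl) simp_all
  next
    case False
    moreover have "(j, l) \<noteq> (i, k)" "(j, l) \<noteq> (k, i)" "(j, l) \<noteq> (- k, - i)"
      using False assms uminus_I[OF assms(1)] uminus_I[OF assms(2)] by blast+
    ultimately show ?thesis unfolding p smat_col by (simp only: if_False) simp
  qed
qed

lemma mmul_smat_left:
  assumes "i \<in> I" "k \<in> I"
  shows "mmul (I \<times> I) (smat I q q') X (i, k) c =
    qe q q' (\<phi> i k) * X (i, k) c + ob (k < i) * ((q - q') * al k i) * X (k, i) c
    + ob (k < - i) * ((q - q') * be (- k) (- i)) * X (- k, - i) c"
proof -
  have "mmul (I \<times> I) (smat I q q') X (i, k) c =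
    (\<Sum>p\<in>I \<times> I. (if p = (i, k) then qe q q' (\<phi> i k) * X p c else 0))
    + (\<Sum>p\<in>I \<times> I. (if p = (k, i) then ob (k < i) * ((q - q') * al k i) * X p c else 0))
    + (\<Sum>p\<in>I \<times> I. (if p = (- k, - i) then ob (k < - i) * ((q - q') * be (- k) (- i)) * X p c else 0))"
    unfolding mmul_def sum.distrib[symmetric]
    using assms by (intro sum.cong refl) (simp only: smat_row distrib_right if_distrib[of "\<lambda>x. x * _"] mult_zero_left)
  then show ?thesis
    using assms finite_II uminus_I[OF assms(1)] uminus_I[OF assms(2)] by simp
qed

lemma qe_swap: "qe q' q k = qe q q' (- k)"
  by (simp add: qe_def)

text \<open>A column of \<open>S\<close> has a diagonal entry and at most two others. Products of a
  diagonal and an off-diagonal entry cancel in pairs because \<open>\<phi>\<close> changes sign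
  under both swaps (\<open>f2\<close>, \<open>f3\<close>). Of the products of two off-diagonal
  entries, those leading back to \<open>(j, l)\<close> require opposite inequalities
  (\<open>nlt\<close>), and the two ending at \<open>(- j, - l)\<close> cancel by
  \<open>f4\<close>.\<close>

lemma smat_inverse:
  fixes q q' :: "'r::{ring,monoid_mult}"
  assumes qq': "q * q' = 1" "q' * q = 1"
  shows "mmul (I \<times> I) (smat I q q') (smat I q' q) = idm (I \<times> I)"
proof (intro ext)
  fix r c :: "int \<times> int"
  obtain j l where c: "c = (j, l)" by (metis surj_pair)
  show "mmul (I \<times> I) (smat I q q') (smat I q' q) r c = idm (I \<times> I) r c"
  proof (cases "j \<in> I \<and> l \<in> I")
    case False
    then have f: "(j \<in> I \<and> l \<in> I) = False" by simp
    then show ?thesis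
      unfolding c mmul_def idm_def smat_col f if_False using False by auto
  next
    case True
    then have nz: "j < 0 \<or> 0 < j" "l < 0 \<or> 0 < l" using I_nonzero by auto
    define z where "z = q - q'"
    have z': "q' - q = - z" by (simp add: z_def)
    have comm: "qe q q' k * z = z * qe q q' k" for k
      using qq' by (simp add: qe_def z_def algebra_simps)
    have f1: "qe q q' k * qe q q' (- k) = 1" for k
      using qq' by (simp add: qe_def)
    have f2: "\<phi> l j = - \<phi> j l" if "j < l"
      using nz that by (auto simp: \<phi>_def)
    have f3: "\<phi> (- l) (- j) = - \<phi> j l" if "- j < l"
      using nz that by (auto simp: \<phi>_def)
    have f4: "z * be l j * (z * al j l) = - (z * al (- l) (- j) * (z * be j l))" if "j < l" "- j < l"
      using nz that by (auto simp: al_def be_def pm_def)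
    have f5: "z * al j l * qe q q' k = qe q q' k * (z * al j l)"
      "z * be j l * qe q q' k = qe q q' k * (z * be j l)" for k
      using comm[of k] by (auto simp: al_def be_def pm_def)
    have S: "smat I q q' r (j, l) = (if r = (j, l) then qe q q' (\<phi> j l) else 0)
         + (if r = (l, j) then ob (j < l) * (z * al j l) else 0)
         + (if r = (- l, - j) then ob (- j < l) * (z * be j l) else 0)"
       "smat I q q' r (l, j) = (if r = (l, j) then qe q q' (\<phi> l j) else 0)
         + (if r = (j, l) then ob (l < j) * (z * al l j) else 0)
         + (if r = (- j, - l) then ob (- l < j) * (z * be l j) else 0)"
       "smat I q q' r (- l, - j) = (if r = (- l, - j) then qe q q' (\<phi> (- l) (- j)) else 0)
         + (if r = (- j, - l) then ob (j < l) * (z * al (- l) (- j)) else 0)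
         + (if r = (j, l) then ob (l < - j) * (z * be (- l) (- j)) else 0)"
      using True uminus_I[of j] uminus_I[of l] by (simp_all add: smat_col z_def)
    have u1: "ob (j < l) * (z * al j l) * qe q q' (- \<phi> j l)
        = ob (j < l) * (qe q q' (\<phi> l j) * (z * al j l))"
      by (cases "j < l") (simp_all only: ob_simps mult_1_left mult_zero_left f2 f5)
    have u2: "ob (- j < l) * (z * be j l) * qe q q' (- \<phi> j l)
        = ob (- j < l) * (qe q q' (\<phi> (- l) (- j)) * (z * be j l))"
      by (cases "- j < l") (simp_all only: ob_simps mult_1_left mult_zero_left f3 f5)
    have t1: "smat I q q' r (j, l) * qe q' q (\<phi> j l) = (if r = (j, l) then 1 else 0)
         + (if r = (l, j) then ob (j < l) * (qe q q' (\<phi> l j) * (z * al j l)) else 0)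
         + (if r = (- l, - j) then ob (- j < l) * (qe q q' (\<phi> (- l) (- j)) * (z * be j l)) else 0)"
      unfolding S qe_swap[of q' q]
      by (simp only: distrib_right if_distrib[of "\<lambda>x. x * _"] mult_zero_left f1 u1 u2)
    have nlt: "ob (l < j) * ob (j < l) = (0::'r)" "ob (l < - j) * ob (- j < l) = (0::'r)"
      by (auto simp: ob_def)
    have v: "ob P * x * (ob Q * y) = ob P * ob Q * (x * y)" for P Q and x y :: 'r
      by (cases P; cases Q) simp_all
    have t2: "smat I q q' r (l, j) * (ob (j < l) * ((q' - q) * al j l)) =
         (if r = (l, j) then - (ob (j < l) * (qe q q' (\<phi> l j) * (z * al j l))) else 0)
         + (if r = (- j, - l) then - (ob (- l < j) * ob (j < l) * (z * be l j * (z * al j l))) else 0)"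
    proof -
      have "ob (j < l) * ((q' - q) * al j l) = - (ob (j < l) * (z * al j l))"
        by (simp add: z')
      moreover have "qe q q' (\<phi> l j) * (ob (j < l) * (z * al j l)) = ob (j < l) * (qe q q' (\<phi> l j) * (z * al j l))"
        by (simp add: ob_def)
      ultimately show ?thesis
        unfolding S by (simp only: distrib_right if_distrib[of "\<lambda>x. x * _"] if_distrib[of uminus] mult_zero_left v nlt
            mult_minus_right minus_add_distrib if_cancel add_0_left add_0_right minus_zero)
    qed
    have w: "ob (j < l) * ob (- j < l) * (z * al (- l) (- j) * (z * be j l))
        = - (ob (- l < j) * ob (j < l) * (z * be l j * (z * al j l)))"
      by (cases "j < l"; cases "- j < l") (simp_all add: f4)
    have t3: "smat I q q' r (- l, - j) * (ob (- j < l) * ((q' - q) * be j l)) =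
         (if r = (- l, - j) then - (ob (- j < l) * (qe q q' (\<phi> (- l) (- j)) * (z * be j l))) else 0)
         + (if r = (- j, - l) then ob (- l < j) * ob (j < l) * (z * be l j * (z * al j l)) else 0)"
    proof -
      have "ob (- j < l) * ((q' - q) * be j l) = - (ob (- j < l) * (z * be j l))"
        by (simp add: z')
      moreover have "qe q q' (\<phi> (- l) (- j)) * (ob (- j < l) * (z * be j l)) = ob (- j < l) * (qe q q' (\<phi> (- l) (- j)) * (z * be j l))"
        by (simp add: ob_def)
      ultimately show ?thesis
        unfolding S by (simp only: distrib_right if_distrib[of "\<lambda>x. x * _"] if_distrib[of uminus] mult_zero_left v nlt w
            mult_minus_right minus_add_distrib minus_minus if_cancel add_0_left add_0_right minus_zero)
    qed
    have "x + (if P then a else 0) + (if Q then b else 0)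
       + ((if P then - a else 0) + (if R then - c else 0)) + ((if Q then - b else 0) + (if R then c else 0)) = x"
      for x a b c :: 'r and P Q R
      by simp
    then have "mmul (I \<times> I) (smat I q q') (smat I q' q) r (j, l) = (if r = (j, l) then 1 else 0)"
      using True by (subst mmul_smat_right) (simp_all only: t1 t2 t3)
    then show ?thesis using True unfolding c idm_def by simp
  qed
qed

lemma mmul_emb12_emb13:
  assumes "i \<in> I" "j \<in> I" "k \<in> I" "l \<in> I"
  shows "mmul (I \<times> I) (emb12 I X) (emb13 I Y) (i, k) (j, l) = pm (odd_pair i j \<and> k < 0) * X i j * Y k l"
proof -
  have "mmul (I \<times> I) (emb12 I X) (emb13 I Y) (i, k) (j, l)
      = (\<Sum>p\<in>I \<times> I. if p = (j, k) then pm (odd_pair i j \<and> k < 0) * X i j * Y k l else 0)"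
    unfolding mmul_def using assms
    by (intro sum.cong refl) (simp add: emb12_def emb13_def split: prod.split)
  then show ?thesis using assms finite_II by simp
qed

lemma mmul_emb13_emb12:
  assumes "i \<in> I" "j \<in> I" "k \<in> I" "l \<in> I"
  shows "mmul (I \<times> I) (emb13 I Y) (emb12 I X) (i, k) (j, l) = pm (odd_pair i j \<and> l < 0) * Y k l * X i j"
proof -
  have "mmul (I \<times> I) (emb13 I Y) (emb12 I X) (i, k) (j, l)
      = (\<Sum>p\<in>I \<times> I. if p = (i, l) then pm (odd_pair i j \<and> l < 0) * Y k l * X i j else 0)"
    unfolding mmul_def using assms
    by (intro sum.cong refl) (simp add: emb12_def emb13_def pm_def split: prod.split)
  then show ?thesis using assms finite_II by simp
qed

end

section \<open>Inverses of triangular matrices\<close>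

text \<open>Back substitution for a lower triangular \<open>X\<close> with \<open>D\<close> the
  inverses of its diagonal entries. Column \<open>j\<close> uses only columns \<open>m > j\<close>,
  whence termination.\<close>

function linv :: "int set \<Rightarrow> (int \<Rightarrow> int \<Rightarrow> 'r::{ring,monoid_mult}) \<Rightarrow> (int \<Rightarrow> 'r) \<Rightarrow> int \<Rightarrow> int \<Rightarrow> 'r" where
  "linv A X D i j = (if i \<notin> A \<or> j \<notin> A \<or> i < j then 0 else if i = j then D i
     else - (\<Sum>m\<in>A \<inter> {j<..i}. linv A X D i m * X m j) * D j)"
  by auto
termination by (relation "measure (\<lambda>(A, X, D, i, j). nat (i - j))") auto

function rinv :: "int set \<Rightarrow> (int \<Rightarrow> int \<Rightarrow> 'r::{ring,monoid_mult}) \<Rightarrow> (int \<Rightarrow> 'r) \<Rightarrow> int \<Rightarrow> int \<Rightarrow> 'r" where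
  "rinv A X D i j = (if i \<notin> A \<or> j \<notin> A \<or> i < j then 0 else if i = j then D i
     else - D i * (\<Sum>m\<in>A \<inter> {j..<i}. X i m * rinv A X D m j))"
  by auto
termination by (relation "measure (\<lambda>(A, X, D, i, j). nat (i - j))") auto

declare linv.simps [simp del] rinv.simps [simp del]

lemma linv_left:
  assumes "finite A" "supported A X" "\<And>i j. i < j \<Longrightarrow> X i j = 0" "\<And>i. i \<in> A \<Longrightarrow> D i * X i i = 1"
  shows "mmul A (linv A X D) X = idm A"
proof (intro ext)
  fix i j
  show "mmul A (linv A X D) X i j = idm A i j"
  proof (cases "i \<in> A \<and> j \<in> A")
    case False
    then show ?thesis
      using assms(2) by (auto simp: mmul_def idm_def linv.simps[of A X D i] supported_def)
  next
    case True
    have split: "mmul A (linv A X D) X i j = (\<Sum>m\<in>A \<inter> {j..i}. linv A X D i m * X m j)"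
      unfolding mmul_def using assms(1,3) by (intro sum.mono_neutral_right) (auto simp: linv.simps[of A X D i])
    consider "i < j" | "i = j" | "j < i" by linarith
    then show ?thesis
    proof cases
      case 1
      then show ?thesis by (simp add: split idm_def)
    next
      case 2
      then have "A \<inter> {j..i} = {i}" using True by auto
      then show ?thesis using 2 True assms(4) unfolding split by (simp add: idm_def linv.simps[of A X D])
    next
      case 3
      then have "A \<inter> {j..i} = insert j (A \<inter> {j<..i})" using True by auto
      then have "mmul A (linv A X D) X i j = linv A X D i j * X j j + (\<Sum>m\<in>A \<inter> {j<..i}. linv A X D i m * X m j)"
        using assms(1) by (simp add: split)
      also have "linv A X D i j * X j j = - (\<Sum>m\<in>A \<inter> {j<..i}. linv A X D i m * X m j)"
        using 3 True assms(4) by (simp add: linv.simps[of A X D i j] mult.assoc)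
      finally show ?thesis using 3 by (simp add: idm_def)
    qed
  qed
qed

lemma rinv_right:
  assumes "finite A" "supported A X" "\<And>i j. i < j \<Longrightarrow> X i j = 0" "\<And>i. i \<in> A \<Longrightarrow> X i i * D i = 1"
  shows "mmul A X (rinv A X D) = idm A"
proof (intro ext)
  fix i j
  show "mmul A X (rinv A X D) i j = idm A i j"
  proof (cases "i \<in> A \<and> j \<in> A")
    case False
    then show ?thesis
      using assms(2) by (auto simp: mmul_def idm_def rinv.simps[of A X D _ j] supported_def)
  next
    case True
    have split: "mmul A X (rinv A X D) i j = (\<Sum>m\<in>A \<inter> {j..i}. X i m * rinv A X D m j)"
      unfolding mmul_def using assms(1,3) by (intro sum.mono_neutral_right) (auto simp: rinv.simps[of A X D _ j])
    consider "i < j" | "i = j" | "j < i" by linarith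
    then show ?thesis
    proof cases
      case 1
      then show ?thesis by (simp add: split idm_def)
    next
      case 2
      then have "A \<inter> {j..i} = {i}" using True by auto
      then show ?thesis using 2 True assms(4) unfolding split by (simp add: idm_def rinv.simps[of A X D])
    next
      case 3
      then have "A \<inter> {j..i} = insert i (A \<inter> {j..<i})" using True by auto
      then have "mmul A X (rinv A X D) i j = X i i * rinv A X D i j + (\<Sum>m\<in>A \<inter> {j..<i}. X i m * rinv A X D m j)"
        using assms(1) by (simp add: split)
      also have "X i i * rinv A X D i j = - (\<Sum>m\<in>A \<inter> {j..<i}. X i m * rinv A X D m j)"
        using 3 True assms(4) by (simp add: rinv.simps[of A X D i j] mult.assoc[symmetric])
      finally show ?thesis using 3 by (simp add: idm_def)
    qed
  qed
qed

lemma supported_linv: "supported A (linv A X D)"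
  by (auto simp: supported_def linv.simps[of A X D])

lemma supported_rinv: "supported A (rinv A X D)"
  by (auto simp: supported_def rinv.simps[of A X D])

text \<open>The left and the right inverse solve different recursions over a noncommutative ring,
  but associativity forces them to coincide.\<close>

lemma linv_right:
  assumes "finite A" "supported A X" "\<And>i j. i < j \<Longrightarrow> X i j = 0"
    "\<And>i. i \<in> A \<Longrightarrow> D i * X i i = 1" "\<And>i. i \<in> A \<Longrightarrow> X i i * D i = 1"
  shows "mmul A X (linv A X D) = idm A"
proof -
  have "linv A X D = mmul A (linv A X D) (mmul A X (rinv A X D))"
    using assms supported_linv[of A X D] by (simp add: rinv_right mmul_idm_right)
  also have "\<dots> = rinv A X D"
    using assms supported_rinv[of A X D] by (simp add: mmul_assoc[symmetric] linv_left mmul_idm_left)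
  finally have "linv A X D = rinv A X D" .
  then show ?thesis using rinv_right[OF assms(1-3,5)] by metis
qed

text \<open>Replaces an explicit formula for the inverse: a property indexed by row and column that
  is compatible with matrix multiplication passes from \<open>X\<close> and \<open>D\<close> to the
  inverse.\<close>

lemma linv_induct:
  assumes "\<And>i j. Q i j 0" "\<And>i j x y. Q i j x \<Longrightarrow> Q i j y \<Longrightarrow> Q i j (x + y)" "\<And>i j x. Q i j x \<Longrightarrow> Q i j (- x)"
    and "\<And>i j m x y. i \<in> A \<Longrightarrow> m \<in> A \<Longrightarrow> j \<in> A \<Longrightarrow> Q i m x \<Longrightarrow> Q m j y \<Longrightarrow> Q i j (x * y)"
    and "\<And>i. i \<in> A \<Longrightarrow> Q i i (D i)" "\<And>i j. i \<in> A \<Longrightarrow> j \<in> A \<Longrightarrow> Q i j (X i j)"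
  shows "Q i j (linv A X D i j)"
proof (induction "nat (i - j)" arbitrary: j rule: less_induct)
  case less
  consider "i \<notin> A \<or> j \<notin> A \<or> i < j" | "i = j" "i \<in> A" | "i \<in> A" "j \<in> A" "j < i" by linarith
  then show ?case
  proof cases
    case 1
    then show ?thesis using assms(1) by (simp add: linv.simps[of A X D i j])
  next
    case 2
    then show ?thesis using assms(5) by (simp add: linv.simps[of A X D])
  next
    case 3
    have Qm: "Q i m (linv A X D i m)" if "m \<in> A \<inter> {j<..i}" for m
      using that less by auto
    have "Q i j (\<Sum>m\<in>S. linv A X D i m * X m j)" if "S \<subseteq> A \<inter> {j<..i}" for S
      using that
    proof (induction S rule: infinite_finite_induct)
      case (insert m S)
      have m: "m \<in> A" "m \<in> A \<inter> {j<..i}" using insert.prems by auto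
      have "Q i j (linv A X D i m * X m j)"
        by (rule assms(4)[OF 3(1) m(1) 3(2) Qm[OF m(2)] assms(6)[OF m(1) 3(2)]])
      then show ?case
        using insert assms(2) by simp
    qed (simp_all add: assms(1))
    then have "Q i j (- (\<Sum>m\<in>A \<inter> {j<..i}. linv A X D i m * X m j) * D j)"
      using assms(4)[OF 3(1) 3(2) 3(2) _ assms(5)[OF 3(2)]] assms(3) by blast
    then show ?thesis using 3 by (simp add: linv.simps[of A X D i j])
  qed
qed


section \<open>The central element\<close>

text \<open>The weights of the supertrace are made for this: \<open>q - q'\<close> times each of
  them is a difference of consecutive values of one function \<open>E\<close>. The boundary values
  cancel other contributions in \<open>trace_conj\<close>.\<close>

lemma sum_indices_telescope:
  fixes q q' :: "'r::{ring,monoid_mult}"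
  assumes "q * q' = 1" "q' * q = 1" "k \<in> indices n" "l \<in> indices n" "k < l"
  shows "(q - q') * (\<Sum>i | i \<in> indices n \<and> k < i \<and> i < l. pm (i < 0) * q ^ (2 * nat \<bar>i\<bar>))
    = q ^ (2 * nat \<bar>l\<bar>) * qe q' q (sgn l) - q ^ (2 * nat \<bar>k\<bar>) * qe q q' (sgn k)"
proof -
  \<comment> \<open>The exponents are the odd numbers \<open>2m - 1\<close> for positive
    \<open>m\<close> and \<open>1 - 2m\<close> otherwise. Both \<open>E 0\<close> and
    \<open>E 1\<close> equal \<open>q\<close>, so the missing index 0 contributes nothing.\<close>
  define E where "E m = (if 0 < m then q ^ nat (2 * m - 1) else q ^ nat (1 - 2 * m))" for m :: int
  have P': "q' * (q * q ^ m) = q ^ m" for m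
    using assms(2) by (simp flip: mult.assoc)
  have P: "q ^ Suc m * q' = q ^ m" for m
    by (simp only: power_Suc2 mult.assoc assms(1) mult_1_right)
  have e: "(if i = 0 then 0 else (q - q') * (pm (i < 0) * q ^ (2 * nat \<bar>i\<bar>))) = E (i + 1) - E i" for i
  proof -
    consider "i = 0" | "0 < i" | "i < 0" by linarith
    then show ?thesis
    proof cases
      case 1
      then show ?thesis by (simp add: E_def)
    next
      case 2
      then have "2 * nat \<bar>i\<bar> = Suc (nat (2 * i - 1))" "nat (2 * (i + 1) - 1) = Suc (2 * nat \<bar>i\<bar>)" by simp_all
      then show ?thesis
        using 2 by (simp add: E_def left_diff_distrib P')
    next
      case 3
      then have "2 * nat \<bar>i\<bar> = Suc (nat (1 - 2 * (i + 1)))" "nat (1 - 2 * i) = Suc (2 * nat \<bar>i\<bar>)" by simp_all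
      then show ?thesis
        using 3 by (simp add: E_def left_diff_distrib P')
    qed
  qed
  have "(q - q') * (\<Sum>i | i \<in> indices n \<and> k < i \<and> i < l. pm (i < 0) * q ^ (2 * nat \<bar>i\<bar>))
      = (\<Sum>i | i \<in> indices n \<and> k < i \<and> i < l. if i = 0 then 0 else (q - q') * (pm (i < 0) * q ^ (2 * nat \<bar>i\<bar>)))"
    unfolding sum_distrib_left by (intro sum.cong) (auto simp: indices_def)
  also have "\<dots> = (\<Sum>i\<in>{k + 1..<l}. if i = 0 then 0 else (q - q') * (pm (i < 0) * q ^ (2 * nat \<bar>i\<bar>)))"
    using assms(3,4) by (intro sum.mono_neutral_left) (auto simp: indices_def)
  also have "\<dots> = E l - E (k + 1)"
  proof -
    have "(\<Sum>i\<in>{a..<b}. E (i + 1) - E i) = E b - E a" if "a \<le> b" for a b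
      using that
    proof (induction b rule: int_ge_induct)
      case (step b)
      then have "{a..<b + 1} = insert b {a..<b}" by auto
      then show ?case using step by simp
    qed simp
    then show ?thesis unfolding e using assms(5) by simp
  qed
  also have "E l = q ^ (2 * nat \<bar>l\<bar>) * qe q' q (sgn l)"
  proof (cases "0 < l")
    case True
    then have "2 * nat \<bar>l\<bar> = Suc (nat (2 * l - 1))" by simp
    then show ?thesis using True P[of "nat (2 * l - 1)"] by (simp add: E_def qe_def)
  next
    case False
    then have "nat (1 - 2 * l) = Suc (2 * nat \<bar>l\<bar>)" "l < 0" using assms(4) by (auto simp: indices_def)
    then show ?thesis by (simp add: E_def qe_def power_commutes)
  qed
  also have "E (k + 1) = q ^ (2 * nat \<bar>k\<bar>) * qe q q' (sgn k)"
  proof (cases "0 < k")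
    case True
    then have "nat (2 * (k + 1) - 1) = Suc (2 * nat \<bar>k\<bar>)" by simp
    then show ?thesis using True by (simp add: E_def qe_def power_commutes)
  next
    case False
    then have k: "k < 0" using assms(3) by (auto simp: indices_def)
    then have "2 * nat \<bar>k\<bar> = Suc (nat (1 - 2 * (k + 1)))" by simp
    then show ?thesis using k P[of "nat (1 - 2 * (k + 1))"] by (simp add: E_def qe_def)
  qed
  finally show ?thesis .
qed

text \<open>Stands in for linearity: in a ring of additive operators the scalars \<open>q\<close>
  and \<open>q'\<close> need not be central.\<close>

definition qcomm :: "'r::{ring,monoid_mult} \<Rightarrow> 'r \<Rightarrow> 'r \<Rightarrow> bool" where
  "qcomm q q' x \<longleftrightarrow> q * x = x * q \<and> q' * x = x * q'"

lemma qcomm_simps: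
  "qcomm q q' 0" "qcomm q q' 1"
  "qcomm q q' x \<Longrightarrow> qcomm q q' y \<Longrightarrow> qcomm q q' (x + y)"
  "qcomm q q' x \<Longrightarrow> qcomm q q' (- x)"
  "qcomm q q' x \<Longrightarrow> qcomm q q' y \<Longrightarrow> qcomm q q' (x * y)"
  "qcomm q q' (pm b)"
proof -
  show "qcomm q q' (x * y)" if "qcomm q q' x" "qcomm q q' y"
    using that unfolding qcomm_def by (metis mult.assoc)
qed (simp_all add: qcomm_def algebra_simps pm_def)

lemma qcomm_sum: "(\<And>i. i \<in> A \<Longrightarrow> qcomm q q' (f i)) \<Longrightarrow> qcomm q q' (sum f A)"
  by (induction A rule: infinite_finite_induct) (simp_all add: qcomm_simps)

lemma qcomm_coeff:
  assumes "qcomm q q' x"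
  shows "x * qe q q' k = qe q q' k * x" "x * qe q' q k = qe q' q k * x"
    "x * (ob P * ((q - q') * al a b)) = ob P * ((q - q') * al a b) * x"
    "x * (ob P * ((q - q') * be a b)) = ob P * ((q - q') * be a b) * x"
    "x * (ob P * ((q' - q) * al a b)) = ob P * ((q' - q) * al a b) * x"
    "x * (ob P * ((q' - q) * be a b)) = ob P * ((q' - q) * be a b) * x"
  using assms by (auto simp: qcomm_def qe_def al_def be_def pm_def ob_def algebra_simps)

text \<open>The relation \<open>L\<^sub>1\<^sub>2 L\<^sub>1\<^sub>3 S\<^sub>2\<^sub>3 = S\<^sub>2\<^sub>3 L\<^sub>1\<^sub>3 L\<^sub>1\<^sub>2\<close> in coordinates, with \<open>X\<close> in the second leg and
  \<open>Y\<close> in the third. The signs \<open>pm\<close> come from moving odd matrix units past odd basis vectors,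
  so that the super tensor product is turned into an ordinary one.\<close>

definition rll_entry ::
  "'r::{ring,monoid_mult} \<Rightarrow> 'r \<Rightarrow> (int \<Rightarrow> int \<Rightarrow> 'r) \<Rightarrow> (int \<Rightarrow> int \<Rightarrow> 'r) \<Rightarrow> int \<Rightarrow> int \<Rightarrow> int \<Rightarrow> int \<Rightarrow> bool" where
  "rll_entry q q' X Y i j k l \<longleftrightarrow>
    qe q q' (\<phi> j l) * (pm (odd_pair i j \<and> k < 0) * X i j * Y k l)
    + ob (j < l) * ((q - q') * al j l) * (pm (odd_pair i l \<and> k < 0) * X i l * Y k j)
    + ob (- j < l) * ((q - q') * be j l) * (pm (odd_pair i (- l) \<and> k < 0) * X i (- l) * Y k (- j))
    = qe q q' (\<phi> i k) * (pm (odd_pair i j \<and> l < 0) * Y k l * X i j)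
    + ob (k < i) * ((q - q') * al k i) * (pm (odd_pair k j \<and> l < 0) * Y i l * X k j)
    + ob (k < - i) * ((q - q') * be (- k) (- i)) * (pm (odd_pair (- k) j \<and> l < 0) * Y (- i) l * X (- k) j)"

context index_set
begin

lemma supp_eqI:
  assumes "supported (I \<times> I) X" "supported (I \<times> I) Y"
    and "\<And>i j k l. i \<in> I \<Longrightarrow> j \<in> I \<Longrightarrow> k \<in> I \<Longrightarrow> l \<in> I \<Longrightarrow> X (i, k) (j, l) = Y (i, k) (j, l)"
  shows "X = Y"
proof (intro ext)
  fix p c
  show "X p c = Y p c"
  proof (cases "p \<in> I \<times> I \<and> c \<in> I \<times> I")
    case True
    then show ?thesis using assms(3) by (metis mem_Sigma_iff surj_pair)
  next
    case False
    then show ?thesis using assms(1,2) unfolding supported_def by metis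
  qed
qed

lemma rll_matrix:
  assumes "\<And>i j. qcomm q q' (X i j)" "\<And>i j. qcomm q q' (Y i j)" "supported I X" "supported I Y"
    and "\<And>i j k l. i \<in> I \<Longrightarrow> j \<in> I \<Longrightarrow> k \<in> I \<Longrightarrow> l \<in> I \<Longrightarrow> rll_entry q q' X Y i j k l"
  shows "mmul (I \<times> I) (mmul (I \<times> I) (emb12 I X) (emb13 I Y)) (smat I q q')
    = mmul (I \<times> I) (smat I q q') (mmul (I \<times> I) (emb13 I Y) (emb12 I X))"
proof (rule supp_eqI)
  fix i j k l assume *: "i \<in> I" "j \<in> I" "k \<in> I" "l \<in> I"
  note u = *[THEN uminus_I]
  have c: "qcomm q q' (pm b * X i' j' * Y k' l')" for b i' j' k' l'
    using assms(1,2) by (intro qcomm_simps)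
  show "mmul (I \<times> I) (mmul (I \<times> I) (emb12 I X) (emb13 I Y)) (smat I q q') (i, k) (j, l)
    = mmul (I \<times> I) (smat I q q') (mmul (I \<times> I) (emb13 I Y) (emb12 I X)) (i, k) (j, l)"
    using assms(5)[OF *] unfolding rll_entry_def
    by (simp only: mmul_smat_right[OF *(2,4)] mmul_smat_left[OF *(1,3)] mmul_emb12_emb13 mmul_emb13_emb12 * u
        qcomm_coeff[OF c])
qed (intro supported_mmul supported_emb12 supported_emb13 supported_smat assms)+

end

section \<open>The triangular matrices attached to a solution of the exchange relation\<close>

locale rll = index_set +
  fixes n :: nat and q q' :: "'r::{ring,monoid_mult}" and L :: "int \<Rightarrow> int \<Rightarrow> 'r"
  assumes I_eq: "I = indices n"
    and qq': "q * q' = 1" and q'q: "q' * q = 1"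
    and qcomm_L: "qcomm q q' (L i j)"
    and supported_L: "supported I L"
    and L_upper: "j < i \<Longrightarrow> L i j = 0"
    and L_diag: "i \<in> I \<Longrightarrow> L i i * L (- i) (- i) = 1"
    and rll_L: "i \<in> I \<Longrightarrow> j \<in> I \<Longrightarrow> k \<in> I \<Longrightarrow> l \<in> I \<Longrightarrow> rll_entry q q' L L i j k l"
begin

definition z :: 'r where "z = q - q'"

text \<open>\<open>LJ\<close> is the conjugate of \<open>L\<close> by the odd involution \<open>J\<close>. It is lower triangular, which makes \<open>N\<close> its
  inverse.\<close>

definition LJ :: "int \<Rightarrow> int \<Rightarrow> 'r" where
  "LJ i j = pm (odd_pair i j) * L (- i) (- j)"

text \<open>The diagonal entry \<open>LJ i i\<close> is \<open>L (- i) (- i)\<close>, whose inverse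
  is \<open>L i i\<close>; this explains the diagonal handed to \<open>linv\<close>.\<close>

definition N :: "int \<Rightarrow> int \<Rightarrow> 'r" where
  "N = linv I LJ (\<lambda>i. L i i)"

text \<open>A lower triangular factor times an upper triangular one, as in the construction of
  quantum Casimir elements by Faddeev, Reshetikhin and Takhtajan.\<close>

definition M :: "int \<Rightarrow> int \<Rightarrow> 'r" where
  "M = mmul I N L"

lemma supported_LJ: "supported I LJ"
  using supported_L unfolding supported_def LJ_def by (metis mult_zero_right uminus_I_iff)

lemma LJ_lower: "i < j \<Longrightarrow> LJ i j = 0"
  by (simp add: LJ_def L_upper)

lemma LJ_diag: "LJ i i = L (- i) (- i)"
  by (simp add: LJ_def odd_pair_def)

lemma qcomm_LJ: "qcomm q q' (LJ i j)"
  unfolding LJ_def by (intro qcomm_simps qcomm_L)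

lemma L_diag': "i \<in> I \<Longrightarrow> L (- i) (- i) * L i i = 1"
  using L_diag[of "- i"] uminus_I by simp

lemma N_LJ: "mmul I N LJ = idm I"
  unfolding N_def by (intro linv_left finite_I supported_LJ LJ_lower) (simp_all add: LJ_diag L_diag)

lemma LJ_N: "mmul I LJ N = idm I"
  unfolding N_def by (intro linv_right finite_I supported_LJ LJ_lower) (simp_all add: LJ_diag L_diag L_diag')

lemma supported_N: "supported I N"
  unfolding N_def by (rule supported_linv)

lemma N_lower: "i < j \<Longrightarrow> N i j = 0"
  by (simp add: N_def linv.simps[of I LJ])

lemma N_diag: "N i i = L i i"
proof (cases "i \<in> I")
  case False
  then show ?thesis using supported_L supported_N unfolding supported_def by metis
qed (simp add: N_def linv.simps[of I LJ])

lemma N_induct: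
  assumes "\<And>i j. Q i j 0" "\<And>i j x y. Q i j x \<Longrightarrow> Q i j y \<Longrightarrow> Q i j (x + y)" "\<And>i j x. Q i j x \<Longrightarrow> Q i j (- x)"
    and "\<And>i j m x y. i \<in> I \<Longrightarrow> m \<in> I \<Longrightarrow> j \<in> I \<Longrightarrow> Q i m x \<Longrightarrow> Q m j y \<Longrightarrow> Q i j (x * y)"
    and "\<And>i j. i \<in> I \<Longrightarrow> j \<in> I \<Longrightarrow> Q i j (L i j)" "\<And>i j. i \<in> I \<Longrightarrow> j \<in> I \<Longrightarrow> Q i j (L (- i) (- j))"
  shows "Q i j (N i j)"
  unfolding N_def
proof (rule linv_induct[OF assms(1-4)])
  fix i j assume "i \<in> I" "j \<in> I"
  then show "Q i j (LJ i j)"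
    using assms(3,6) by (auto simp: LJ_def pm_def)
qed (use assms in auto)

lemma qcomm_N: "qcomm q q' (N i j)"
  by (rule N_induct[where Q = "\<lambda>i j. qcomm q q'"]) (simp_all add: qcomm_simps qcomm_L)

lemma qcomm_M: "qcomm q q' (M i j)"
  unfolding M_def mmul_def by (intro qcomm_sum qcomm_simps qcomm_N qcomm_L)

lemma supported_M: "supported I M"
  unfolding M_def by (intro supported_mmul supported_N supported_L)

text \<open>\<open>S\<close> commutes with the odd involution \<open>J\<close> in its first leg.\<close>

lemma rll_LJ:
  assumes "i \<in> I" "j \<in> I" "k \<in> I" "l \<in> I"
  shows "rll_entry q q' LJ L i j k l"
proof -
  have \<phi>: "\<phi> (- j) l = \<phi> j l" "\<phi> (- i) k = \<phi> i k"
    by (simp_all add: \<phi>_def)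
  note nz = assms[THEN I_nonzero]
  have odd: "odd_pair (- i) (- j) = odd_pair i j" "odd_pair (- i) (- l) = odd_pair i l" "odd_pair (- i) l = odd_pair i (- l)"
    "odd_pair (- k) (- j) = odd_pair k j" "odd_pair k (- j) = odd_pair (- k) j"
    using nz by (auto simp: odd_pair_def)
  \<comment> \<open>The relation for \<open>L\<close> at \<open>- i\<close> and \<open>- j\<close>.
    Conjugation by \<open>J\<close> interchanges the two off-diagonal terms of \<open>S\<close>, so
    every \<open>al\<close> has to match a \<open>be\<close> up to sign; \<open>c1\<close> to
    \<open>c4\<close> are these matches.\<close>
  have src: "qe q q' (\<phi> j l) * (pm (odd_pair i j \<and> k < 0) * L (- i) (- j) * L k l)
    + ob (- j < l) * ((q - q') * al (- j) l) * (pm (odd_pair i (- l) \<and> k < 0) * L (- i) l * L k (- j))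
    + ob (j < l) * ((q - q') * be (- j) l) * (pm (odd_pair i l \<and> k < 0) * L (- i) (- l) * L k j)
    = qe q q' (\<phi> i k) * (pm (odd_pair i j \<and> l < 0) * L k l * L (- i) (- j))
    + ob (k < - i) * ((q - q') * al k (- i)) * (pm (odd_pair (- k) j \<and> l < 0) * L (- i) l * L k (- j))
    + ob (k < i) * ((q - q') * be (- k) i) * (pm (odd_pair k j \<and> l < 0) * L i l * L (- k) (- j))"
    using rll_L[OF assms(1,2)[THEN uminus_I] assms(3,4)]
    unfolding rll_entry_def \<phi> minus_minus odd .
  have c1: "(pm (odd_pair i l \<and> k < 0) * pm (odd_pair i l) * al j l :: 'r) = pm (odd_pair i j) * (be (- j) l * pm (odd_pair i l \<and> k < 0))"
    and c2: "(pm (odd_pair i (- l) \<and> k < 0) * pm (odd_pair i (- l)) * be j l :: 'r) = pm (odd_pair i j) * (al (- j) l * pm (odd_pair i (- l) \<and> k < 0))"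
    and c3: "(pm (odd_pair k j \<and> l < 0) * pm (odd_pair k j) * al k i :: 'r) = pm (odd_pair i j) * (be (- k) i * pm (odd_pair k j \<and> l < 0))"
    and c4: "(pm (odd_pair (- k) j \<and> l < 0) * pm (odd_pair (- k) j) * be (- k) (- i) :: 'r) = pm (odd_pair i j) * (al k (- i) * pm (odd_pair (- k) j \<and> l < 0))"
    using nz by (auto simp: al_def be_def odd_pair_def)
  have p: "pm b * x = x * pm b" "al a' b' * x = x * al a' b'" "be a' b' * x = x * be a' b'" for b a' b' and x :: 'r
    by (auto simp: pm_def al_def be_def)
  have e: "ob b * ((q - q') * s') * (P * (P' * X) * Y) = pm c * (ob b * ((q - q') * t') * (P * X * Y))"
    if "P * P' * s' = pm c * (t' * P)" "\<And>x. P * x = x * P" "\<And>x. P' * x = x * P'" "\<And>x. s' * x = x * s'" for b c and s' t' P P' X Y :: 'r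
  proof -
    have "(q - q') * s' * (P * (P' * X) * Y) = (q - q') * (P * P' * s') * X * Y"
      using that(2-4) by (metis mult.assoc)
    also have "\<dots> = pm c * ((q - q') * t' * (P * X * Y))"
      unfolding that(1) by (auto simp: pm_def mult.assoc)
    finally show ?thesis by (cases b) (simp_all add: mult.assoc)
  qed
  note e' = e[OF _ p(1) p(1)]
  have f: "c' * (pm P * (pm c * X) * Y) = pm c * (c' * (pm P * X * Y))" "c' * (pm P * Y * (pm c * X)) = pm c * (c' * (pm P * Y * X))"
    for c' X Y :: 'r and P c by (auto simp: pm_def)
  have g: "ob b * ((q - q') * s') * (P * Y * (P' * X)) = pm c * (ob b * ((q - q') * t') * (P * Y * X))"
    if "P * P' * s' = pm c * (t' * P)" "\<And>x. P * x = x * P" "\<And>x. P' * x = x * P'" "\<And>x. s' * x = x * s'" for b c and s' t' P P' X Y :: 'r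
  proof -
    have "P * Y * (P' * X) = P * (P' * Y) * X" using that(3) by (metis mult.assoc)
    then show ?thesis using e[OF that, of b Y X] by simp
  qed
  have "qe q q' (\<phi> j l) * (pm (odd_pair i j \<and> k < 0) * LJ i j * L k l)
    + ob (j < l) * ((q - q') * al j l) * (pm (odd_pair i l \<and> k < 0) * LJ i l * L k j)
    + ob (- j < l) * ((q - q') * be j l) * (pm (odd_pair i (- l) \<and> k < 0) * LJ i (- l) * L k (- j))
    = pm (odd_pair i j) * (qe q q' (\<phi> j l) * (pm (odd_pair i j \<and> k < 0) * L (- i) (- j) * L k l)
    + ob (- j < l) * ((q - q') * al (- j) l) * (pm (odd_pair i (- l) \<and> k < 0) * L (- i) l * L k (- j))
    + ob (j < l) * ((q - q') * be (- j) l) * (pm (odd_pair i l \<and> k < 0) * L (- i) (- l) * L k j))"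
    unfolding LJ_def f(1)[of "qe q q' (\<phi> j l)"] e'[OF c1 p(2)] e'[OF c2 p(3)] by (simp add: distrib_left add.assoc add.commute)
  also note src
  also have "pm (odd_pair i j) * (qe q q' (\<phi> i k) * (pm (odd_pair i j \<and> l < 0) * L k l * L (- i) (- j))
    + ob (k < - i) * ((q - q') * al k (- i)) * (pm (odd_pair (- k) j \<and> l < 0) * L (- i) l * L k (- j))
    + ob (k < i) * ((q - q') * be (- k) i) * (pm (odd_pair k j \<and> l < 0) * L i l * L (- k) (- j)))
    = qe q q' (\<phi> i k) * (pm (odd_pair i j \<and> l < 0) * L k l * LJ i j)
    + ob (k < i) * ((q - q') * al k i) * (pm (odd_pair k j \<and> l < 0) * L i l * LJ k j)
    + ob (k < - i) * ((q - q') * be (- k) (- i)) * (pm (odd_pair (- k) j \<and> l < 0) * L (- i) l * LJ (- k) j)"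
    unfolding LJ_def f(2)[of "qe q q' (\<phi> i k)"] g[OF c3 p(1) p(1) p(2)] g[OF c4 p(1) p(1) p(3)] minus_minus
    by (simp add: distrib_left add.assoc add.commute)
  finally show ?thesis unfolding rll_entry_def .
qed

abbreviation "S \<equiv> smat I q q'"
abbreviation "E12 \<equiv> emb12 I"
abbreviation "E13 \<equiv> emb13 I"
abbreviation mm (infixl "\<odot>" 70) where "X \<odot> Y \<equiv> mmul (I \<times> I) X Y"

text \<open>Multiplying the relation of \<open>LJ\<close> on both sides by its inverse in the second
  leg lets \<open>N\<close> pass \<open>S\<close> and \<open>L\<close>.\<close>

lemma N_rel: "E12 N \<odot> (S \<odot> E13 L) = E13 L \<odot> S \<odot> E12 N"
proof -
  have H: "E12 LJ \<odot> E13 L \<odot> S = S \<odot> (E13 L \<odot> E12 LJ)"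
    by (rule rll_matrix[OF qcomm_LJ qcomm_L supported_LJ supported_L rll_LJ])
  have inv: "E12 LJ \<odot> E12 N = idm (I \<times> I)" "E12 N \<odot> E12 LJ = idm (I \<times> I)"
    by (simp_all add: emb12_mult LJ_N N_LJ emb12_idm)
  have supp: "supported (I \<times> I) (E12 N \<odot> (S \<odot> E13 L))" "supported (I \<times> I) (E13 L \<odot> S \<odot> E12 N)"
    by (intro supported_mmul supported_emb12 supported_emb13 supported_smat supported_N supported_L)+
  have "E12 N \<odot> (S \<odot> E13 L) = E12 N \<odot> (S \<odot> E13 L) \<odot> (E12 LJ \<odot> E12 N)"
    unfolding inv by (simp add: mmul_idm_right finite_II supp)
  also have "\<dots> = E12 N \<odot> (S \<odot> (E13 L \<odot> E12 LJ)) \<odot> E12 N"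
    by (simp add: mmul_assoc)
  also have "\<dots> = (E12 N \<odot> E12 LJ) \<odot> (E13 L \<odot> S \<odot> E12 N)"
    unfolding H[symmetric] by (simp add: mmul_assoc)
  also have "\<dots> = E13 L \<odot> S \<odot> E12 N"
    unfolding inv by (simp add: mmul_idm_left finite_II supp)
  finally show ?thesis .
qed

text \<open>Equivalently, \<open>E13 L\<close> times the conjugate of \<open>E12 M\<close> by
  \<open>S\<close> is \<open>E12 M\<close> times \<open>E13 L\<close>. A trace over the second leg
  that is blind to this conjugation then commutes with every \<open>L k l\<close>.\<close>

lemma M_rel: "E13 L \<odot> S \<odot> E12 M = E12 M \<odot> E13 L \<odot> S"
proof -
  have A: "E12 L \<odot> E13 L \<odot> S = S \<odot> (E13 L \<odot> E12 L)"
    by (rule rll_matrix[OF qcomm_L qcomm_L supported_L supported_L rll_L])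
  have B: "E12 M \<odot> X = E12 N \<odot> (E12 L \<odot> X)" for X
    by (simp add: M_def emb12_mult[symmetric] mmul_assoc)
  have "E12 M \<odot> E13 L \<odot> S = E12 N \<odot> (E12 L \<odot> E13 L \<odot> S)"
    by (simp add: B mmul_assoc)
  also have "\<dots> = E12 N \<odot> (S \<odot> E13 L) \<odot> E12 L"
    unfolding A by (simp add: mmul_assoc)
  also have "\<dots> = E13 L \<odot> S \<odot> E12 M"
    unfolding N_rel by (simp add: M_def emb12_mult[symmetric] mmul_assoc)
  finally show ?thesis ..
qed

text \<open>The weights of the quantum supertrace: with them the partial trace over the second tensor
  factor does not see conjugation by \<open>S\<close>, see \<open>trace_conj\<close>.\<close>

definition wgt :: "int \<Rightarrow> 'r" where
  "wgt i = pm (i < 0) * q ^ (2 * nat \<bar>i\<bar>)"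

definition C :: 'r where
  "C = (\<Sum>i\<in>I. wgt i * M i i)"

lemma qcomm_q: "qcomm q q' q" "qcomm q q' q'"
  by (simp_all add: qcomm_def qq' q'q)

lemma qcomm_z: "qcomm q q' z"
  by (simp add: z_def qcomm_def algebra_simps qq' q'q)

lemma qcomm_power: "qcomm q q' x \<Longrightarrow> qcomm q q' (x ^ m)"
  by (induction m) (simp_all add: qcomm_simps)

lemma z_comm: "qcomm q q' x \<Longrightarrow> x * z = z * x"
  by (simp add: z_def qcomm_def algebra_simps)

lemma qcomm_wgt: "qcomm q q' (wgt i)"
  unfolding wgt_def by (intro qcomm_simps qcomm_power qcomm_q)

text \<open>The three terms in a row of \<open>S\<close> and the three in a column of its inverse
  give nine sums. The first, \<open>s11\<close>, is the right-hand side; \<open>s23\<close> and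
  \<open>s32\<close> would need \<open>i = - i\<close>. The sums \<open>s12\<close>,
  \<open>s21\<close>, \<open>s22\<close> all carry \<open>X k l\<close> and cancel by the
  telescoping sum \<open>tele\<close>, and so do \<open>s13\<close>, \<open>s31\<close>,
  \<open>s33\<close>, which carry \<open>X (- k) (- l)\<close>.\<close>

lemma trace_conj:
  assumes X: "\<And>i j. qcomm q q' (X i j)" and k: "k \<in> I" and l: "l \<in> I"
  shows "(\<Sum>i\<in>I. wgt i * (S \<odot> E12 X \<odot> smat I q' q) (i, k) (i, l))
    = (if k = l then \<Sum>i\<in>I. wgt i * X i i else 0)"
proof -
  let ?W = "E12 X" and ?D = "\<lambda>i::int. q ^ (2 * nat \<bar>i\<bar>)"
  note nz = k[THEN I_nonzero] l[THEN I_nonzero]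
  note uk = k[THEN uminus_I] and ul = l[THEN uminus_I]
  have W: "?W (a, b) (c, e) = (if b = e \<and> b \<in> I then pm (odd_pair a c \<and> b < 0) * X a c else 0)" for a b c e
    by (simp add: emb12_def)
  have zX: "X a b * z = z * X a b" for a b
    using X by (rule z_comm)
  have zX2: "X a b * (z * y) = z * (X a b * y)" for a b y
    using zX[of a b] by (metis mult.assoc)
  have qz: "X a b * qe q' q m = qe q' q m * X a b" "z * qe q' q m = qe q' q m * z" "z * (qe q' q m * y) = qe q' q m * (z * y)" for a b m y
    using X[of a b] qcomm_z by (auto simp: qe_def qcomm_def mult.assoc simp flip: mult.assoc)
  have z': "q' - q = - z" "q - q' = z" by (simp_all add: z_def)
  have delta: "(\<Sum>i\<in>I. f i) = f a" if "a \<in> I" "\<And>i. i \<in> I \<Longrightarrow> i \<noteq> a \<Longrightarrow> f i = 0" for a and f :: "int \<Rightarrow> 'r"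
    using finite_I that by (simp add: sum.remove)
  have s11: "(\<Sum>i\<in>I. wgt i * (qe q q' (\<phi> i k) * ?W (i, k) (i, l) * qe q' q (\<phi> i l)))
     = (if k = l then \<Sum>i\<in>I. wgt i * X i i else 0)"
  proof (cases "k = l")
    case True
    have "qe q q' m * X i i * qe q' q m = X i i" for m i
    proof -
      have "qe q q' m * qe q' q m = 1" using qq' q'q by (simp add: qe_def)
      then show ?thesis using X[of i i] by (metis qcomm_coeff(1) mult.assoc mult_1_right)
    qed
    then show ?thesis using True k by (simp add: W odd_pair_def mult.assoc)
  qed (simp add: W)
  have s12: "(\<Sum>i\<in>I. wgt i * (qe q q' (\<phi> i k) * ?W (i, k) (l, i) * (ob (i < l) * ((q' - q) * al i l))))
     = - (ob (k < l) * (?D k * qe q q' (sgn k) * z * X k l))"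
    by (subst delta[of k]) (use k l nz uk ul in \<open>auto simp: ob_def W wgt_def al_def be_def \<phi>_def odd_pair_def z' zX zX2 qz mult.assoc\<close>)
  have s13: "(\<Sum>i\<in>I. wgt i * (qe q q' (\<phi> i k) * ?W (i, k) (- l, - i) * (ob (- i < l) * ((q' - q) * be i l))))
     = ob (k < l) * (pm (k < 0) * pm (l < 0) * (?D k * qe q q' (sgn k) * z * X (- k) (- l)))"
    by (subst delta[of "- k"]) (use k l nz uk ul in \<open>auto simp: ob_def W wgt_def al_def be_def \<phi>_def odd_pair_def z' zX zX2 qz mult.assoc\<close>)
  have s21: "(\<Sum>i\<in>I. wgt i * (ob (k < i) * ((q - q') * al k i) * ?W (k, i) (i, l) * qe q' q (\<phi> i l)))
     = ob (k < l) * (?D l * qe q' q (sgn l) * z * X k l)"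
    by (subst delta[of l]) (use k l nz uk ul in \<open>auto simp: ob_def W wgt_def al_def be_def \<phi>_def odd_pair_def z' zX zX2 qz mult.assoc\<close>)
  have s22: "(\<Sum>i\<in>I. wgt i * (ob (k < i) * ((q - q') * al k i) * ?W (k, i) (l, i) * (ob (i < l) * ((q' - q) * al i l))))
     = - ((\<Sum>i | i \<in> I \<and> k < i \<and> i < l. wgt i) * z * z * X k l)"
  proof -
    have "wgt i * (ob (k < i) * ((q - q') * al k i) * ?W (k, i) (l, i) * (ob (i < l) * ((q' - q) * al i l)))
      = (if k < i \<and> i < l then - (wgt i * z * z * X k l) else 0)" if "i \<in> I" for i
      using that nz I_nonzero[OF that]
      by (auto simp: ob_def W al_def odd_pair_def z' zX mult.assoc)
    then show ?thesis
      using finite_I by (simp add: sum.inter_filter[symmetric] sum_negf sum_distrib_right)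
  qed
  have s23: "(\<Sum>i\<in>I. wgt i * (ob (k < i) * ((q - q') * al k i) * ?W (k, i) (- l, - i) * (ob (- i < l) * ((q' - q) * be i l)))) = 0"
    using zero_I by (intro sum.neutral ballI) (auto simp: W)
  have s31: "(\<Sum>i\<in>I. wgt i * (ob (k < - i) * ((q - q') * be (- k) (- i)) * ?W (- k, - i) (i, l) * qe q' q (\<phi> i l)))
     = - (ob (k < l) * (pm (k < 0) * pm (l < 0) * (?D l * qe q' q (sgn l) * z * X (- k) (- l))))"
    by (subst delta[of "- l"]) (use k l nz uk ul in \<open>auto simp: ob_def W wgt_def al_def be_def \<phi>_def odd_pair_def z' zX zX2 qz mult.assoc\<close>)
  have s32: "(\<Sum>i\<in>I. wgt i * (ob (k < - i) * ((q - q') * be (- k) (- i)) * ?W (- k, - i) (l, i) * (ob (i < l) * ((q' - q) * al i l)))) = 0"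
    using zero_I by (intro sum.neutral ballI) (auto simp: W)
  have s33: "(\<Sum>i\<in>I. wgt i * (ob (k < - i) * ((q - q') * be (- k) (- i)) * ?W (- k, - i) (- l, - i) * (ob (- i < l) * ((q' - q) * be i l))))
     = pm (k < 0) * pm (l < 0) * ((\<Sum>i | i \<in> I \<and> k < i \<and> i < l. wgt i) * z * z * X (- k) (- l))"
  proof -
    have "wgt i * (ob (k < - i) * ((q - q') * be (- k) (- i)) * ?W (- k, - i) (- l, - i) * (ob (- i < l) * ((q' - q) * be i l)))
      = (if k < - i \<and> - i < l then pm (k < 0) * pm (l < 0) * (wgt (- i) * z * z * X (- k) (- l)) else 0)" if "i \<in> I" for i
      using that nz I_nonzero[OF that] uminus_I[OF that]
      by (auto simp: ob_def W wgt_def be_def odd_pair_def z' zX mult.assoc)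
    then have "(\<Sum>i\<in>I. wgt i * (ob (k < - i) * ((q - q') * be (- k) (- i)) * ?W (- k, - i) (- l, - i) * (ob (- i < l) * ((q' - q) * be i l))))
      = (\<Sum>i\<in>I. if k < - i \<and> - i < l then pm (k < 0) * pm (l < 0) * (wgt (- i) * z * z * X (- k) (- l)) else 0)"
      by (rule sum.cong[OF refl])
    also have "\<dots> = (\<Sum>i\<in>I. if k < i \<and> i < l then pm (k < 0) * pm (l < 0) * (wgt i * z * z * X (- k) (- l)) else 0)"
      by (rule sum.reindex_bij_witness[of _ uminus uminus]) (simp_all add: uminus_I)
    also have "\<dots> = pm (k < 0) * pm (l < 0) * ((\<Sum>i | i \<in> I \<and> k < i \<and> i < l. wgt i) * z * z * X (- k) (- l))"
      using finite_I by (simp add: sum.inter_filter[symmetric] sum_distrib_right sum_distrib_left)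
    finally show ?thesis .
  qed
  have tele: "(\<Sum>i | i \<in> I \<and> k < i \<and> i < l. wgt i) * z * z * x
      = ob (k < l) * (?D l * qe q' q (sgn l) * z * x) - ob (k < l) * (?D k * qe q q' (sgn k) * z * x)" for x
  proof (cases "k < l")
    case True
    have "(\<Sum>i | i \<in> I \<and> k < i \<and> i < l. wgt i) * z = z * (\<Sum>i | i \<in> I \<and> k < i \<and> i < l. wgt i)"
      by (intro z_comm qcomm_sum qcomm_wgt)
    also have "\<dots> = ?D l * qe q' q (sgn l) - ?D k * qe q q' (sgn k)"
      using sum_indices_telescope[OF qq' q'q, of k n l] k l True unfolding I_eq wgt_def z_def by simp
    finally show ?thesis using True by (simp add: left_diff_distrib)
  next
    case False
    then have "{i. i \<in> I \<and> k < i \<and> i < l} = {}" by auto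
    then show ?thesis using False by (simp only: sum.empty) (simp add: ob_def)
  qed
  have "(\<Sum>i\<in>I. wgt i * (S \<odot> E12 X \<odot> smat I q' q) (i, k) (i, l)) =
    (\<Sum>i\<in>I. wgt i * (qe q q' (\<phi> i k) * ?W (i, k) (i, l) * qe q' q (\<phi> i l)))
    + (\<Sum>i\<in>I. wgt i * (ob (k < i) * ((q - q') * al k i) * ?W (k, i) (i, l) * qe q' q (\<phi> i l)))
    + (\<Sum>i\<in>I. wgt i * (ob (k < - i) * ((q - q') * be (- k) (- i)) * ?W (- k, - i) (i, l) * qe q' q (\<phi> i l)))
    + ((\<Sum>i\<in>I. wgt i * (qe q q' (\<phi> i k) * ?W (i, k) (l, i) * (ob (i < l) * ((q' - q) * al i l))))
    + (\<Sum>i\<in>I. wgt i * (ob (k < i) * ((q - q') * al k i) * ?W (k, i) (l, i) * (ob (i < l) * ((q' - q) * al i l))))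
    + (\<Sum>i\<in>I. wgt i * (ob (k < - i) * ((q - q') * be (- k) (- i)) * ?W (- k, - i) (l, i) * (ob (i < l) * ((q' - q) * al i l)))))
    + ((\<Sum>i\<in>I. wgt i * (qe q q' (\<phi> i k) * ?W (i, k) (- l, - i) * (ob (- i < l) * ((q' - q) * be i l))))
    + (\<Sum>i\<in>I. wgt i * (ob (k < i) * ((q - q') * al k i) * ?W (k, i) (- l, - i) * (ob (- i < l) * ((q' - q) * be i l))))
    + (\<Sum>i\<in>I. wgt i * (ob (k < - i) * ((q - q') * be (- k) (- i)) * ?W (- k, - i) (- l, - i) * (ob (- i < l) * ((q' - q) * be i l)))))"
    unfolding sum.distrib[symmetric]
    by (intro sum.cong refl) (simp only: mmul_smat_right mmul_smat_left k l distrib_right distrib_left)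
  also have "\<dots> = (if k = l then \<Sum>i\<in>I. wgt i * X i i else 0)"
    unfolding s11 s12 s13 s21 s22 s23 s31 s32 s33 tele by (simp add: ob_def algebra_simps)
  finally show ?thesis .
qed

text \<open>Weighted trace of \<open>M_rel\<close> over the second leg: one side gives
  \<open>C * L k l\<close>, the other \<open>L k l * C\<close> by \<open>trace_conj\<close>.\<close>

lemma C_central: "C * L k l = L k l * C"
proof (cases "k \<in> I \<and> l \<in> I")
  case False
  then show ?thesis using supported_L unfolding supported_def by (metis mult_zero_left mult_zero_right)
next
  case True
  then have k: "k \<in> I" and l: "l \<in> I" by auto
  have supp: "supported (I \<times> I) (E12 M \<odot> E13 L)"
    by (intro supported_mmul supported_emb12 supported_emb13 supported_M supported_L)
  have "E13 L \<odot> (S \<odot> E12 M \<odot> smat I q' q) = E12 M \<odot> E13 L \<odot> (S \<odot> smat I q' q)"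
    using M_rel by (metis mmul_assoc)
  also have "\<dots> = E12 M \<odot> E13 L"
    using supp by (simp add: smat_inverse qq' q'q mmul_idm_right finite_II)
  finally have eq: "E13 L \<odot> (S \<odot> E12 M \<odot> smat I q' q) = E12 M \<odot> E13 L" .
  have "C * L k l = (\<Sum>i\<in>I. wgt i * (E12 M \<odot> E13 L) (i, k) (i, l))"
    using k l by (simp add: C_def sum_distrib_right mmul_emb12_emb13 odd_pair_def mult.assoc)
  also have "\<dots> = (\<Sum>i\<in>I. wgt i * (E13 L \<odot> (S \<odot> E12 M \<odot> smat I q' q)) (i, k) (i, l))"
    by (simp add: eq)
  also have "\<dots> = (\<Sum>i\<in>I. wgt i * (\<Sum>m\<in>I. L k m * (S \<odot> E12 M \<odot> smat I q' q) (i, m) (i, l)))"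
  proof (intro sum.cong refl arg_cong2[of _ _ _ _ "(*)"])
    fix i assume i: "i \<in> I"
    let ?T = "S \<odot> E12 M \<odot> smat I q' q"
    have "(E13 L \<odot> ?T) (i, k) (i, l) = (\<Sum>a\<in>I. \<Sum>b\<in>I. E13 L (i, k) (a, b) * ?T (a, b) (i, l))"
      unfolding mmul_def[of _ "E13 L"] by (simp add: sum.cartesian_product case_prod_beta)
    also have "\<dots> = (\<Sum>a\<in>I. if a = i then \<Sum>b\<in>I. L k b * ?T (i, b) (i, l) else 0)"
      using i by (intro sum.cong refl) (simp add: emb13_def)
    also have "\<dots> = (\<Sum>b\<in>I. L k b * ?T (i, b) (i, l))"
      using i finite_I by simp
    finally show "(E13 L \<odot> ?T) (i, k) (i, l) = (\<Sum>b\<in>I. L k b * ?T (i, b) (i, l))" .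
  qed
  also have "\<dots> = (\<Sum>i\<in>I. \<Sum>m\<in>I. L k m * (wgt i * (S \<odot> E12 M \<odot> smat I q' q) (i, m) (i, l)))"
  proof -
    have "wgt i * L k m = L k m * wgt i" for i m
    proof -
      have "q ^ a * L k m = L k m * q ^ a" for a
        using qcomm_L[of k m] by (induction a) (simp_all add: qcomm_def mult.assoc, metis mult.assoc)
      then show ?thesis by (auto simp: wgt_def pm_def)
    qed
    then show ?thesis unfolding sum_distrib_left by (simp flip: mult.assoc)
  qed
  also have "\<dots> = (\<Sum>m\<in>I. L k m * (\<Sum>i\<in>I. wgt i * (S \<odot> E12 M \<odot> smat I q' q) (i, m) (i, l)))"
    unfolding sum_distrib_left by (rule sum.swap)
  also have "\<dots> = (\<Sum>m\<in>I. if m = l then L k l * C else 0)"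
    using l by (intro sum.cong refl) (simp add: trace_conj qcomm_M C_def)
  also have "\<dots> = L k l * C"
    using l finite_I by simp
  finally show ?thesis .
qed

section \<open>Exchange relations between the entries of \<open>N\<close> and
  \<open>L\<close>\<close>

lemma N_entry:
  assumes "i \<in> I" "j \<in> I" "k \<in> I" "l \<in> I"
  shows "(\<Sum>a\<in>I. pm (odd_pair i a \<and> k < 0) * N i a *
      (ob (a = j) * (qe q q' (\<phi> a k) * L k l) + ob (k < a \<and> k = j) * (z * al k a * L a l)
       + ob (k < - a \<and> - k = j) * (z * be (- k) (- a) * L (- a) l)))
    = (\<Sum>b\<in>I. L k b *
      (ob (b = l) * (qe q q' (\<phi> i b) * (pm (odd_pair i j \<and> l < 0) * N i j))
       + ob (b < i \<and> i = l) * (z * al b i * (pm (odd_pair b j \<and> l < 0) * N b j))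
       + ob (b < - i \<and> - i = l) * (z * be (- b) (- i) * (pm (odd_pair (- b) j \<and> l < 0) * N (- b) j))))"
proof -
  have z: "q - q' = z" by (simp add: z_def)
  have "(E12 N \<odot> (S \<odot> E13 L)) (i, k) (j, l)
      = (\<Sum>a\<in>I. \<Sum>b\<in>I. E12 N (i, k) (a, b) * (S \<odot> E13 L) (a, b) (j, l))"
    unfolding mmul_def[of _ "E12 N"] by (simp add: sum.cartesian_product case_prod_beta)
  also have "\<dots> = (\<Sum>a\<in>I. \<Sum>b\<in>I. if b = k then pm (odd_pair i a \<and> k < 0) * N i a * (S \<odot> E13 L) (a, k) (j, l) else 0)"
    using assms by (intro sum.cong refl) (simp add: emb12_def)
  also have "\<dots> = (\<Sum>a\<in>I. pm (odd_pair i a \<and> k < 0) * N i a * (S \<odot> E13 L) (a, k) (j, l))"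
    using assms finite_I by simp
  also have "\<dots> = (\<Sum>a\<in>I. pm (odd_pair i a \<and> k < 0) * N i a *
      (ob (a = j) * (qe q q' (\<phi> a k) * L k l) + ob (k < a \<and> k = j) * (z * al k a * L a l)
       + ob (k < - a \<and> - k = j) * (z * be (- k) (- a) * L (- a) l)))"
    using assms
    by (intro sum.cong refl arg_cong2[of _ _ _ _ "(*)"])
      (auto simp: mmul_smat_left emb13_def z ob_def)
  finally have l: "(E12 N \<odot> (S \<odot> E13 L)) (i, k) (j, l) = \<dots>" .
  have "(E13 L \<odot> (S \<odot> E12 N)) (i, k) (j, l)
      = (\<Sum>a\<in>I. \<Sum>b\<in>I. E13 L (i, k) (a, b) * (S \<odot> E12 N) (a, b) (j, l))"
    unfolding mmul_def[of _ "E13 L"] by (simp add: sum.cartesian_product case_prod_beta)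
  also have "\<dots> = (\<Sum>a\<in>I. if a = i then \<Sum>b\<in>I. L k b * (S \<odot> E12 N) (i, b) (j, l) else 0)"
    using assms by (intro sum.cong refl) (simp add: emb13_def)
  also have "\<dots> = (\<Sum>b\<in>I. L k b * (S \<odot> E12 N) (i, b) (j, l))"
    using assms finite_I by simp
  also have "\<dots> = (\<Sum>b\<in>I. L k b *
      (ob (b = l) * (qe q q' (\<phi> i b) * (pm (odd_pair i j \<and> l < 0) * N i j))
       + ob (b < i \<and> i = l) * (z * al b i * (pm (odd_pair b j \<and> l < 0) * N b j))
       + ob (b < - i \<and> - i = l) * (z * be (- b) (- i) * (pm (odd_pair (- b) j \<and> l < 0) * N (- b) j))))"
    using assms
    by (intro sum.cong refl arg_cong2[of _ _ _ _ "(*)"])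
      (auto simp: mmul_smat_left emb12_def z ob_def)
  finally show ?thesis
    using l N_rel by (simp add: mmul_assoc)
qed

lemma pm_cancel: "pm b * x = pm b * y \<Longrightarrow> x = (y :: 'r)"
  by (cases b) simp_all

lemma sum_ob:
  assumes "a \<in> I"
  shows "(\<Sum>b\<in>I. f b * (ob (b = a) * g b)) = (f a * g a :: 'r)"
proof -
  have "f b * (ob (b = a) * g b) = (if b = a then f a * g a else 0)" for b by (simp add: ob_def)
  then show ?thesis using assms finite_I by simp
qed

lemma qe_comm: "qcomm q q' x \<Longrightarrow> x * qe q q' k = qe q q' k * x"
  by (rule qcomm_coeff(1))

text \<open>The entry of \<open>N_rel\<close> with \<open>k = j\<close> and \<open>l = i\<close>. On
  either side one off-diagonal term of \<open>S\<close> drops out, and the other becomes a partial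
  sum of a diagonal entry: of \<open>N L\<close> at \<open>i\<close> on the left, of
  \<open>L N\<close> at \<open>j\<close> on the right.\<close>

lemma N_L_even:
  assumes "i \<in> I" "j \<in> I"
  shows "qe q q' (sgn j) * pm (j < 0) * (N i j * L j i) + z * (\<Sum>m | m \<in> I \<and> j < m. N i m * L m i)
    = qe q q' (sgn i) * pm (i < 0) * (L j i * N i j) + z * (\<Sum>a | a \<in> I \<and> a < i. L j a * N a j)"
proof -
  note nz = assms[THEN I_nonzero]
  have zN: "N a b * (z * x) = z * (N a b * x)" "L a b * (z * x) = z * (L a b * x)" for a b x
    using z_comm[OF qcomm_N[of a b]] z_comm[OF qcomm_L[of a b]] by (metis mult.assoc)+
  have eN: "N a b * (qe q q' m * x) = qe q q' m * (N a b * x)" "L a b * (qe q q' m * x) = qe q q' m * (L a b * x)" for a b m x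
    using qe_comm[OF qcomm_N[of a b]] qe_comm[OF qcomm_L[of a b]] by (metis mult.assoc)+
  have p: "\<phi> j j = sgn j" "\<phi> i i = sgn i" by (simp_all add: \<phi>_def)
  have l: "(\<Sum>a\<in>I. pm (odd_pair i a \<and> j < 0) * N i a *
      (ob (a = j) * (qe q q' (\<phi> a j) * L j i) + ob (j < a \<and> j = j) * (z * al j a * L a i)
       + ob (j < - a \<and> - j = j) * (z * be (- j) (- a) * L (- a) i)))
    = pm (i < 0 \<and> j < 0) * (qe q q' (sgn j) * pm (j < 0) * (N i j * L j i) + z * (\<Sum>m | m \<in> I \<and> j < m. N i m * L m i))"
  proof -
    have a: "(\<Sum>m | m \<in> I \<and> j < m. N i m * L m i) = (\<Sum>m\<in>I. ob (j < m) * (N i m * L m i))"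
      using finite_I by (subst sum.inter_filter) (auto simp: ob_def intro!: sum.cong)
    have b: "pm (odd_pair i j \<and> j < 0) * N i j * (qe q q' (\<phi> j j) * L j i) = pm (i < 0 \<and> j < 0) * (qe q q' (sgn j) * pm (j < 0) * (N i j * L j i))"
      using nz by (auto simp: p odd_pair_def eN)
    have c: "pm (odd_pair i a \<and> j < 0) * N i a * (z * al j a * L a i) = pm (i < 0 \<and> j < 0) * (z * (N i a * L a i))" if "a \<in> I" for a
      using nz by (cases "a < 0") (auto simp: odd_pair_def al_def zN mult.assoc)
    have "(\<Sum>a\<in>I. pm (odd_pair i a \<and> j < 0) * N i a *
      (ob (a = j) * (qe q q' (\<phi> a j) * L j i) + ob (j < a \<and> j = j) * (z * al j a * L a i)
       + ob (j < - a \<and> - j = j) * (z * be (- j) (- a) * L (- a) i)))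
      = (\<Sum>a\<in>I. (pm (odd_pair i a \<and> j < 0) * N i a) * (ob (a = j) * (qe q q' (\<phi> a j) * L j i)))
        + (\<Sum>a\<in>I. pm (i < 0 \<and> j < 0) * (z * (ob (j < a) * (N i a * L a i))))"
      unfolding sum.distrib[symmetric] using nz c
      by (intro sum.cong refl) (auto simp: ob_def distrib_left)
    then show ?thesis
      unfolding a sum_ob[OF assms(2)] b by (simp add: sum_distrib_left distrib_left)
  qed
  have r: "(\<Sum>b\<in>I. L j b *
      (ob (b = i) * (qe q q' (\<phi> i b) * (pm (odd_pair i j \<and> i < 0) * N i j))
       + ob (b < i \<and> i = i) * (z * al b i * (pm (odd_pair b j \<and> i < 0) * N b j))
       + ob (b < - i \<and> - i = i) * (z * be (- b) (- i) * (pm (odd_pair (- b) j \<and> i < 0) * N (- b) j))))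
    = pm (i < 0 \<and> j < 0) * (qe q q' (sgn i) * pm (i < 0) * (L j i * N i j) + z * (\<Sum>a | a \<in> I \<and> a < i. L j a * N a j))"
  proof -
    have a: "(\<Sum>m | m \<in> I \<and> m < i. L j m * N m j) = (\<Sum>m\<in>I. ob (m < i) * (L j m * N m j))"
      using finite_I by (subst sum.inter_filter) (auto simp: ob_def intro!: sum.cong)
    have b: "L j i * (qe q q' (\<phi> i i) * (pm (odd_pair i j \<and> i < 0) * N i j)) = pm (i < 0 \<and> j < 0) * (qe q q' (sgn i) * pm (i < 0) * (L j i * N i j))"
      using nz by (auto simp: p odd_pair_def eN)
    have c: "L j a * (z * al a i * (pm (odd_pair a j \<and> i < 0) * N a j)) = pm (i < 0 \<and> j < 0) * (z * (L j a * N a j))" if "a \<in> I" for a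
      using nz by (cases "a < 0") (auto simp: odd_pair_def al_def zN mult.assoc)
    have "(\<Sum>b\<in>I. L j b *
      (ob (b = i) * (qe q q' (\<phi> i b) * (pm (odd_pair i j \<and> i < 0) * N i j))
       + ob (b < i \<and> i = i) * (z * al b i * (pm (odd_pair b j \<and> i < 0) * N b j))
       + ob (b < - i \<and> - i = i) * (z * be (- b) (- i) * (pm (odd_pair (- b) j \<and> i < 0) * N (- b) j))))
      = (\<Sum>b\<in>I. L j b * (ob (b = i) * (qe q q' (\<phi> i b) * (pm (odd_pair i j \<and> i < 0) * N i j))))
        + (\<Sum>a\<in>I. pm (i < 0 \<and> j < 0) * (z * (ob (a < i) * (L j a * N a j))))"
      unfolding sum.distrib[symmetric] using nz c
      by (intro sum.cong refl) (auto simp: ob_def distrib_left)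
    then show ?thesis
      unfolding a sum_ob[OF assms(1)] b by (simp add: sum_distrib_left distrib_left)
  qed
  show ?thesis
    using N_entry[OF assms(1,2,2,1)] unfolding l r by (rule pm_cancel)
qed

text \<open>The entry of \<open>N_rel\<close> with \<open>k = - j\<close> and \<open>l = i\<close>.
  Now the other off-diagonal term survives on the left; up to sign it is a partial sum of the entry
  \<open>(i, - i)\<close> of \<open>N LJ\<close>, whose total is zero.\<close>

lemma N_L_odd:
  assumes "i \<in> I" "j \<in> I"
  shows "qe q q' (- sgn j) * (N i j * L (- j) i) - z * (\<Sum>a | a \<in> I \<and> a < j. pm (a < 0) * (N i a * L (- a) i))
    = qe q q' (sgn i) * (L (- j) i * N i j) + z * pm (i < 0) * (\<Sum>b | b \<in> I \<and> b < i. L (- j) b * N b j)"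
proof -
  note nz = assms[THEN I_nonzero]
  have zN: "N a b * (z * x) = z * (N a b * x)" "L a b * (z * x) = z * (L a b * x)" for a b x
    using z_comm[OF qcomm_N[of a b]] z_comm[OF qcomm_L[of a b]] by (metis mult.assoc)+
  have eN: "N a b * (qe q q' m * x) = qe q q' m * (N a b * x)" "L a b * (qe q q' m * x) = qe q q' m * (L a b * x)" for a b m x
    using qe_comm[OF qcomm_N[of a b]] qe_comm[OF qcomm_L[of a b]] by (metis mult.assoc)+
  have p: "\<phi> j (- j) = - sgn j" "\<phi> i i = sgn i" by (simp_all add: \<phi>_def sgn_minus)
  let ?s = "pm (i < 0 \<and> 0 < j) :: 'r"
  have l: "(\<Sum>a\<in>I. pm (odd_pair i a \<and> - j < 0) * N i a *
      (ob (a = j) * (qe q q' (\<phi> a (- j)) * L (- j) i) + ob (- j < a \<and> - j = j) * (z * al (- j) a * L a i)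
       + ob (- j < - a \<and> - (- j) = j) * (z * be (- (- j)) (- a) * L (- a) i)))
    = ?s * (qe q q' (- sgn j) * (N i j * L (- j) i) - z * (\<Sum>a | a \<in> I \<and> a < j. pm (a < 0) * (N i a * L (- a) i)))"
  proof -
    have a: "(\<Sum>a | a \<in> I \<and> a < j. pm (a < 0) * (N i a * L (- a) i)) = (\<Sum>a\<in>I. ob (a < j) * (pm (a < 0) * (N i a * L (- a) i)))"
      using finite_I by (subst sum.inter_filter) (auto simp: ob_def intro!: sum.cong)
    have b: "pm (odd_pair i j \<and> - j < 0) * N i j * (qe q q' (\<phi> j (- j)) * L (- j) i) = ?s * (qe q q' (- sgn j) * (N i j * L (- j) i))"
      using nz by (auto simp: p odd_pair_def eN)
    have c: "pm (odd_pair i a \<and> - j < 0) * N i a * (z * be j (- a) * L (- a) i) = - (?s * (z * (pm (a < 0) * (N i a * L (- a) i))))" if "a \<in> I" for a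
      using nz I_nonzero[OF that] by (cases "a < 0") (auto simp: odd_pair_def be_def zN mult.assoc)
    have "(\<Sum>a\<in>I. pm (odd_pair i a \<and> - j < 0) * N i a *
      (ob (a = j) * (qe q q' (\<phi> a (- j)) * L (- j) i) + ob (- j < a \<and> - j = j) * (z * al (- j) a * L a i)
       + ob (- j < - a \<and> - (- j) = j) * (z * be (- (- j)) (- a) * L (- a) i)))
      = (\<Sum>a\<in>I. (pm (odd_pair i a \<and> - j < 0) * N i a) * (ob (a = j) * (qe q q' (\<phi> a (- j)) * L (- j) i)))
        + (\<Sum>a\<in>I. - (?s * (z * (ob (a < j) * (pm (a < 0) * (N i a * L (- a) i))))))"
      unfolding sum.distrib[symmetric] using nz c
      by (intro sum.cong refl) (auto simp: ob_def distrib_left)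
    then show ?thesis
      unfolding a sum_ob[OF assms(2)] b by (simp add: sum_distrib_left right_diff_distrib sum_negf)
  qed
  have r: "(\<Sum>b\<in>I. L (- j) b *
      (ob (b = i) * (qe q q' (\<phi> i b) * (pm (odd_pair i j \<and> i < 0) * N i j))
       + ob (b < i \<and> i = i) * (z * al b i * (pm (odd_pair b j \<and> i < 0) * N b j))
       + ob (b < - i \<and> - i = i) * (z * be (- b) (- i) * (pm (odd_pair (- b) j \<and> i < 0) * N (- b) j))))
    = ?s * (qe q q' (sgn i) * (L (- j) i * N i j) + z * pm (i < 0) * (\<Sum>b | b \<in> I \<and> b < i. L (- j) b * N b j))"
  proof -
    have a: "(\<Sum>m | m \<in> I \<and> m < i. L (- j) m * N m j) = (\<Sum>m\<in>I. ob (m < i) * (L (- j) m * N m j))"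
      using finite_I by (subst sum.inter_filter) (auto simp: ob_def intro!: sum.cong)
    have b: "L (- j) i * (qe q q' (\<phi> i i) * (pm (odd_pair i j \<and> i < 0) * N i j)) = ?s * (qe q q' (sgn i) * (L (- j) i * N i j))"
      using nz by (auto simp: p odd_pair_def eN)
    have c: "L (- j) a * (z * al a i * (pm (odd_pair a j \<and> i < 0) * N a j)) = ?s * (z * pm (i < 0) * (L (- j) a * N a j))" if "a \<in> I" for a
      using nz I_nonzero[OF that] by (cases "a < 0") (auto simp: odd_pair_def al_def zN mult.assoc)
    have "(\<Sum>b\<in>I. L (- j) b *
      (ob (b = i) * (qe q q' (\<phi> i b) * (pm (odd_pair i j \<and> i < 0) * N i j))
       + ob (b < i \<and> i = i) * (z * al b i * (pm (odd_pair b j \<and> i < 0) * N b j))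
       + ob (b < - i \<and> - i = i) * (z * be (- b) (- i) * (pm (odd_pair (- b) j \<and> i < 0) * N (- b) j))))
      = (\<Sum>b\<in>I. L (- j) b * (ob (b = i) * (qe q q' (\<phi> i b) * (pm (odd_pair i j \<and> i < 0) * N i j))))
        + (\<Sum>a\<in>I. ?s * (z * pm (i < 0) * (ob (a < i) * (L (- j) a * N a j))))"
      unfolding sum.distrib[symmetric] using nz c
      by (intro sum.cong refl) (auto simp: ob_def distrib_left)
    then show ?thesis
      unfolding a sum_ob[OF assms(1)] b by (simp add: sum_distrib_left distrib_left)
  qed
  show ?thesis
    using N_entry[OF assms(1,2) assms(2)[THEN uminus_I] assms(1)] unfolding l r by (rule pm_cancel)
qed

end

section \<open>Additive endomorphisms\<close>

text \<open>Only additivity is built in, since linearity would refer to the locale parameter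
  \<open>scale\<close>, on which a type cannot depend. Linearity enters as a separate hypothesis
  such as \<open>L_scale\<close>.\<close>

typedef (overloaded) 'v endo = "{f :: 'v::ab_group_add \<Rightarrow> 'v. \<forall>x y. f (x + y) = f x + f y}"
  morphisms app Endo
  by (rule exI[of _ id]) simp

setup_lifting type_definition_endo

lemma app_add_right: "app f (x + y) = app f x + app f y"
  using app[of f] by simp

instantiation endo :: (ab_group_add) ring
begin
lift_definition zero_endo :: "'a endo" is "\<lambda>_. 0" by simp
lift_definition plus_endo :: "'a endo \<Rightarrow> 'a endo \<Rightarrow> 'a endo" is "\<lambda>f g x. f x + g x" by (simp add: algebra_simps)
lift_definition minus_endo :: "'a endo \<Rightarrow> 'a endo \<Rightarrow> 'a endo" is "\<lambda>f g x. f x - g x" by (simp add: algebra_simps)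
lift_definition uminus_endo :: "'a endo \<Rightarrow> 'a endo" is "\<lambda>f x. - f x" by simp
lift_definition times_endo :: "'a endo \<Rightarrow> 'a endo \<Rightarrow> 'a endo" is "\<lambda>f g x. f (g x)" by simp
instance by standard (transfer; simp add: fun_eq_iff algebra_simps)+
end

instantiation endo :: (ab_group_add) monoid_mult
begin
lift_definition one_endo :: "'a endo" is "\<lambda>x. x" by simp
instance by standard (transfer; simp)+
end

lemma app_simps [simp]:
  "app 0 x = 0" "app (f + g) x = app f x + app g x" "app (f - g) x = app f x - app g x" "app (- f) x = - app f x"
  "app (f * g) x = app f (app g x)" "app 1 x = x"
  by (transfer; simp)+

lemma app_right [simp]: "app f 0 = 0" "app f (- x) = - app f x" "app f (x - y) = app f x - app f y"
proof -
  show z: "app f 0 = 0" using app_add_right[of f 0 0] by simp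
  show m: "app f (- x) = - app f x" for x using app_add_right[of f x "- x"] z by (simp add: eq_neg_iff_add_eq_0 add.commute)
  show "app f (x - y) = app f x - app f y" using app_add_right[of f x "- y"] m[of y] by simp
qed

lemma app_sum: "app (sum f A) x = (\<Sum>a\<in>A. app (f a) x)"
  by (induction A rule: infinite_finite_induct) simp_all

lemma app_sum_right: "app f (sum g A) = (\<Sum>a\<in>A. app f (g a))"
  by (induction A rule: infinite_finite_induct) (simp_all add: app_add_right)

lemma endo_eqI: "(\<And>x. app f x = app g x) \<Longrightarrow> f = g"
  by transfer (simp add: fun_eq_iff)

section \<open>Operators satisfying the defining relations\<close>

text \<open>The equation \<open>relator i j k l = 0\<close>, read in an arbitrary ring with the
  scalars mapped by \<open>sc\<close>.\<close>

definition L_relation :: "(Cq \<Rightarrow> 'r::{ring,monoid_mult}) \<Rightarrow> (int \<Rightarrow> int \<Rightarrow> 'r) \<Rightarrow> int \<Rightarrow> int \<Rightarrow> int \<Rightarrow> int \<Rightarrow> bool" where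
  "L_relation sc L i j k l \<longleftrightarrow>
    sc ((-1) ^ (par i j * par k l) * qq powi \<phi> j l) * L i j * L k l
     + sc (of_bool (k \<le> j \<and> j < l) * of_int (\<theta> i j k) * (qq - inverse qq)) * L i l * L k j
     + sc (of_bool (i \<le> - l \<and> - l < j \<and> j \<le> - k) * of_int (\<theta> (- i) (- j) k) * (qq - inverse qq))
         * L i (- l) * L k (- j)
    = sc (qq powi \<phi> i k) * L k l * L i j
       + sc (of_bool (k < i \<and> i \<le> l) * of_int (\<theta> i j k) * (qq - inverse qq)) * L i l * L k j
       + sc (of_bool (- l \<le> i \<and> i < - k \<and> - k \<le> j) * of_int (\<theta> (- i) (- j) k) * (qq - inverse qq))
           * L (- i) l * L (- k) j"

lemma qq_nonzero: "qq \<noteq> 0"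
  by (simp add: qq_def Zero_fract_def eq_fract)

locale scalar_hom =
  fixes sc :: "Cq \<Rightarrow> 'r::{ring,monoid_mult}"
  assumes sc_add: "sc (a + b) = sc a + sc b" and sc_mult: "sc (a * b) = sc a * sc b" and sc_one: "sc 1 = 1"
begin

lemma sc_zero: "sc 0 = 0"
  using sc_add[of 0 0] by simp

lemma sc_uminus: "sc (- a) = - sc a"
  using sc_add[of a "- a"] by (simp add: sc_zero eq_neg_iff_add_eq_0 add.commute)

lemma sc_diff: "sc (a - b) = sc a - sc b"
  using sc_add[of a "- b"] by (simp add: sc_uminus)

lemma sc_pm: "sc (pm b * a) = pm b * sc a"
  by (simp add: pm_def sc_uminus)

lemma sc_ob: "sc (of_bool b * a) = ob b * sc a"
  by (simp add: ob_def sc_zero)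

lemma sc_qq_powi: "k \<in> {-1, 0, 1} \<Longrightarrow> sc (qq powi k) = qe (sc qq) (sc (inverse qq)) k"
  by (auto simp: qe_def sc_one)

lemma \<phi>_range: "j \<noteq> 0 \<Longrightarrow> \<phi> i j \<in> {-1, 0, 1}"
  by (auto simp: \<phi>_def sgn_if)

lemma \<theta>_pm:
  assumes "i \<noteq> 0" "j \<noteq> 0" "k \<noteq> 0"
  shows "of_int (\<theta> i j k) = (pm ((i < 0 \<and> j < 0) \<or> (j < 0 \<and> k < 0) \<or> (i < 0 \<and> k < 0)) :: Cq)"
  using assms by (auto simp: \<theta>_def sgn_if)

text \<open>For \<open>i \<le> j\<close> and \<open>k \<le> l\<close> the additional inequalities in
  the defining relations only record when both factors can be nonzero, and the common sign
  \<open>?s\<close> matches all six terms. For other indices there is no defining relation; then the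
  terms vanish by triangularity or occur equally on both sides.\<close>

lemma rll_entry_of_relation:
  assumes L0: "\<And>i j. j < i \<Longrightarrow> L i j = 0"
    and nz: "i \<noteq> 0" "j \<noteq> 0" "k \<noteq> 0" "l \<noteq> 0"
    and rel: "i \<le> j \<Longrightarrow> k \<le> l \<Longrightarrow> L_relation sc L i j k l"
  shows "rll_entry (sc qq) (sc (inverse qq)) L L i j k l"
proof -
  let ?q = "sc qq" and ?q' = "sc (inverse qq)" and ?z = "sc (qq - inverse qq)"
  have z: "?q - ?q' = ?z" by (simp add: sc_diff)
  have sgns: "i < 0 \<or> 0 < i" "j < 0 \<or> 0 < j" "k < 0 \<or> 0 < k" "l < 0 \<or> 0 < l" using nz by auto
  consider "i \<le> j" "k \<le> l" | "j < i" | "i \<le> j" "l < k" by linarith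
  then show ?thesis
  proof cases
    case 1
    let ?s = "pm (odd_pair i j \<and> l < 0)"
    have sc_th: "sc (of_bool P * of_int (\<theta> a b c) * (qq - inverse qq))
        = ob P * (pm ((a < 0 \<and> b < 0) \<or> (b < 0 \<and> c < 0) \<or> (a < 0 \<and> c < 0)) * ?z)"
      if "a \<noteq> 0" "b \<noteq> 0" "c \<noteq> 0" for P a b c
      unfolding \<theta>_pm[OF that] mult.assoc sc_ob sc_pm ..
    have th: "sc (of_bool P * of_int (\<theta> i j k) * (qq - inverse qq))
        = ob P * (pm ((i < 0 \<and> j < 0) \<or> (j < 0 \<and> k < 0) \<or> (i < 0 \<and> k < 0)) * ?z)"
      "sc (of_bool P * of_int (\<theta> (- i) (- j) k) * (qq - inverse qq))
        = ob P * (pm ((- i < 0 \<and> - j < 0) \<or> (- j < 0 \<and> k < 0) \<or> (- i < 0 \<and> k < 0)) * ?z)" for P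
      using nz by (intro sc_th; simp)+
    have t1: "qe ?q ?q' (\<phi> j l) * (pm (odd_pair i j \<and> k < 0) * L i j * L k l)
      = ?s * (sc ((-1) ^ (par i j * par k l) * qq powi \<phi> j l) * L i j * L k l)"
    proof -
      have "(-1) ^ (par i j * par k l) = (pm (odd_pair i j \<and> odd_pair k l) :: Cq)"
        using sgns by (auto simp: par_def odd_pair_def zero_less_mult_iff mult_less_0_iff)
      then show ?thesis
        unfolding mult.assoc sc_pm using sgns
        by (auto simp: sc_uminus sc_qq_powi[OF \<phi>_range[OF nz(4)]] odd_pair_def pm_def)
    qed
    have t2: "ob (j < l) * ((?q - ?q') * al j l) * (pm (odd_pair i l \<and> k < 0) * L i l * L k j)
      = ?s * (sc (of_bool (k \<le> j \<and> j < l) * of_int (\<theta> i j k) * (qq - inverse qq)) * L i l * L k j)"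
    proof (cases "k \<le> j \<and> j < l")
      case True
      then show ?thesis unfolding th z using sgns 1
        by (auto simp: al_def odd_pair_def pm_def ob_def z mult.assoc)
    next
      case False
      then show ?thesis unfolding th z by (auto simp: ob_def L0 mult.assoc)
    qed
    have t3: "ob (- j < l) * ((?q - ?q') * be j l) * (pm (odd_pair i (- l) \<and> k < 0) * L i (- l) * L k (- j))
      = ?s * (sc (of_bool (i \<le> - l \<and> - l < j \<and> j \<le> - k) * of_int (\<theta> (- i) (- j) k) * (qq - inverse qq)) * L i (- l) * L k (- j))"
    proof (cases "i \<le> - l \<and> - l < j \<and> j \<le> - k")
      case True
      then show ?thesis unfolding th z using sgns 1
        by (auto simp: be_def odd_pair_def pm_def ob_def z mult.assoc)
    next
      case False
      then show ?thesis unfolding th z by (auto simp: ob_def L0 mult.assoc)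
    qed
    have t4: "qe ?q ?q' (\<phi> i k) * (pm (odd_pair i j \<and> l < 0) * L k l * L i j)
      = ?s * (sc (qq powi \<phi> i k) * L k l * L i j)"
      using sgns nz by (auto simp: sc_qq_powi[OF \<phi>_range[OF nz(3)]] odd_pair_def pm_def mult.assoc)
    have t5: "ob (k < i) * ((?q - ?q') * al k i) * (pm (odd_pair k j \<and> l < 0) * L i l * L k j)
      = ?s * (sc (of_bool (k < i \<and> i \<le> l) * of_int (\<theta> i j k) * (qq - inverse qq)) * L i l * L k j)"
    proof (cases "k < i \<and> i \<le> l")
      case True
      then show ?thesis unfolding th z using sgns 1
        by (auto simp: al_def odd_pair_def pm_def ob_def z mult.assoc)
    next
      case False
      then show ?thesis unfolding th z by (auto simp: ob_def L0 mult.assoc)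
    qed
    have t6: "ob (k < - i) * ((?q - ?q') * be (- k) (- i)) * (pm (odd_pair (- k) j \<and> l < 0) * L (- i) l * L (- k) j)
      = ?s * (sc (of_bool (- l \<le> i \<and> i < - k \<and> - k \<le> j) * of_int (\<theta> (- i) (- j) k) * (qq - inverse qq)) * L (- i) l * L (- k) j)"
    proof (cases "- l \<le> i \<and> i < - k \<and> - k \<le> j")
      case True
      then show ?thesis unfolding th z using sgns 1
        by (auto simp: be_def odd_pair_def pm_def ob_def z mult.assoc)
    next
      case False
      then show ?thesis unfolding th z by (auto simp: ob_def L0 mult.assoc)
    qed
    show ?thesis
      using rel[OF 1] unfolding rll_entry_def L_relation_def t1 t2 t3 t4 t5 t6
      by (simp only: distrib_left[symmetric])
  next
    case 2
    have a: "ob (- j < l) * x * (y * L i (- l) * L k (- j)) = 0" for x y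
      using 2 by (cases "- l < i"; cases "- j < k") (auto simp: L0 ob_def)
    have b: "ob (k < - i) * x * (y * L (- i) l * L (- k) j) = 0" for x y
      using 2 by (cases "l < - i"; cases "j < - k") (auto simp: L0 ob_def)
    have c: "ob (j < l) * ((?q - ?q') * al j l) * (pm (odd_pair i l \<and> k < 0) * L i l * L k j)
        = ob (k < i) * ((?q - ?q') * al k i) * (pm (odd_pair k j \<and> l < 0) * L i l * L k j)"
    proof (cases "l < i \<or> j < k")
      case True
      then show ?thesis by (auto simp: L0)
    next
      case False
      then have "j < l" "k < i" using 2 by linarith+
      then show ?thesis using sgns
        by (auto simp: al_def odd_pair_def pm_def algebra_simps)
    qed
    show ?thesis
      unfolding rll_entry_def a b c using 2 by (simp add: L0)
  next
    case 3
    have "ob (- j < l) * x * (y * L i (- l) * L k (- j)) = 0" for x y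
      using 3 by (cases "- l < i"; cases "- j < k") (auto simp: L0 ob_def)
    moreover have "ob (k < - i) * x * (y * L (- i) l * L (- k) j) = 0" for x y
      using 3 by (cases "l < - i"; cases "j < - k") (auto simp: L0 ob_def)
    moreover have "ob (j < l) * x * (y * L i l * L k j) = 0" for x y
      using 3 by (cases "l < i"; cases "j < k") (auto simp: L0 ob_def)
    moreover have "ob (k < i) * x * (y * L i l * L k j) = 0" for x y
      using 3 by (cases "l < i"; cases "j < k") (auto simp: L0 ob_def)
    ultimately show ?thesis
      unfolding rll_entry_def using 3 by (simp add: L0)
  qed
qed

end

section \<open>Modules as families of operators\<close>

locale queer_ops = vector_space scale
  for scale :: "Cq \<Rightarrow> 'v::ab_group_add \<Rightarrow> 'v" (infixr \<open>*s\<close> 75) +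
  fixes n :: nat and L :: "int \<Rightarrow> int \<Rightarrow> 'v endo"
  assumes L_scale: "app (L i j) (c *s v) = c *s app (L i j) v"
    and L_zero: "(i, j) \<notin> generators n \<Longrightarrow> L i j = 0"
    and L_inv: "i \<in> indices n \<Longrightarrow> L i i * L (- i) (- i) = 1"
    and L_rel: "(i, j) \<in> generators n \<Longrightarrow> (k, l) \<in> generators n \<Longrightarrow> L_relation (\<lambda>c. Endo (scale c)) L i j k l"
begin

definition sc :: "Cq \<Rightarrow> 'v endo" where
  "sc c = Endo (scale c)"

lemma app_sc [simp]: "app (sc c) v = c *s v"
  unfolding sc_def by (subst Endo_inverse) (simp_all add: scale_right_distrib)

sublocale scalar_hom sc
  by standard (auto intro!: endo_eqI simp: scale_left_distrib)

lemma index_set_indices: "index_set (indices n)"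
  by standard (auto simp: indices_def)

lemma L_nonzero_index: "L i j \<noteq> 0 \<Longrightarrow> i \<in> indices n \<and> j \<in> indices n \<and> i \<le> j"
  using L_zero by (force simp: generators_def)

sublocale R: rll "indices n" n "sc qq" "sc (inverse qq)" L
proof (intro rll.intro index_set_indices rll_axioms.intro)
  interpret index_set "indices n" by (rule index_set_indices)
  show "sc qq * sc (inverse qq) = 1" "sc (inverse qq) * sc qq = 1"
    by (simp_all add: sc_mult[symmetric] sc_one qq_nonzero)
  have c: "sc c * L i j = L i j * sc c" for c i j
    by (rule endo_eqI) (simp add: L_scale)
  then show "qcomm (sc qq) (sc (inverse qq)) (L i j)" for i j
    by (simp add: qcomm_def)
  show "supported (indices n) L"
    using L_nonzero_index by (auto simp: supported_def)
  show 0: "L i j = 0" if "j < i" for i j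
    using that L_nonzero_index by fastforce
  show "rll_entry (sc qq) (sc (inverse qq)) L L i j k l"
    if "i \<in> indices n" "j \<in> indices n" "k \<in> indices n" "l \<in> indices n" for i j k l
  proof (rule rll_entry_of_relation[OF 0])
    show "L_relation sc L i j k l" if "i \<le> j" "k \<le> l"
      using L_rel[of i j k l] that \<open>i \<in> _\<close> \<open>j \<in> _\<close> \<open>k \<in> _\<close> \<open>l \<in> _\<close>
      by (simp add: generators_def sc_def[abs_def])
  qed (use that in \<open>auto simp: indices_def\<close>)
qed (simp_all add: L_inv)

section \<open>Weight spaces, height and stable subspaces\<close>

abbreviation "I \<equiv> indices n"

lemma I_iff: "i \<in> I \<longleftrightarrow> i \<noteq> 0 \<and> \<bar>i\<bar> \<le> int n"
  by (auto simp: indices_def)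

definition wsp :: "(int \<Rightarrow> int) \<Rightarrow> 'v set" where
  "wsp \<mu> = {v. \<forall>i\<in>{1..int n}. app (L i i) v = (qq powi \<mu> i) *s v}"

definition shift :: "(int \<Rightarrow> int) \<Rightarrow> int \<Rightarrow> int \<Rightarrow> int \<Rightarrow> int" where
  "shift \<mu> k l = (\<lambda>i. \<mu> i + (if i = \<bar>l\<bar> then 1 else 0) - (if i = \<bar>k\<bar> then 1 else 0))"

text \<open>An integer in place of the dominance order: \<open>L k l\<close> changes it by
  \<open>|k| - |l|\<close> (\<open>ht_shift\<close>), so the raising operators are the
  \<open>L i j\<close> with \<open>|j| < |i|\<close>, and highest weights are found by maximizing
  it.\<close>

definition ht :: "(int \<Rightarrow> int) \<Rightarrow> int" where
  "ht \<mu> = - (\<Sum>i = 1..int n. i * \<mu> i)"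

definition stable :: "'v set \<Rightarrow> bool" where
  "stable W \<longleftrightarrow> subspace W \<and> (\<forall>i j. \<forall>v\<in>W. app (L i j) v \<in> W)"

lemma stable_subspace: "stable W \<Longrightarrow> subspace W"
  by (simp add: stable_def)

lemma stable_L: "stable W \<Longrightarrow> v \<in> W \<Longrightarrow> app (L i j) v \<in> W"
  by (simp add: stable_def)

lemma subspace_wsp: "subspace (wsp \<mu>)"
  unfolding subspace_def wsp_def
  by (auto simp: app_add_right L_scale scale_right_distrib scale_left_commute)

lemma wspD: "v \<in> wsp \<mu> \<Longrightarrow> 1 \<le> i \<Longrightarrow> i \<le> int n \<Longrightarrow> app (L i i) v = (qq powi \<mu> i) *s v"
  by (simp add: wsp_def)

lemma wsp_cong: "(\<And>i. 1 \<le> i \<Longrightarrow> i \<le> int n \<Longrightarrow> \<mu> i = \<nu> i) \<Longrightarrow> wsp \<mu> = wsp \<nu>"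
  by (auto simp: wsp_def)

lemma wspD_neg:
  assumes "v \<in> wsp \<mu>" "1 \<le> i" "i \<le> int n"
  shows "app (L (- i) (- i)) v = (qq powi (- \<mu> i)) *s v"
proof -
  have "app (L (- i) (- i)) (app (L i i) v) = v"
    using L_inv[of "- i"] assms by (simp add: I_iff flip: app_simps(5))
  then have "(qq powi (- \<mu> i)) *s v = (qq powi (- \<mu> i)) *s app (L (- i) (- i)) ((qq powi \<mu> i) *s v)"
    using wspD[OF assms] by simp
  also have "\<dots> = app (L (- i) (- i)) v"
    by (simp add: L_scale power_int_minus qq_nonzero)
  finally show ?thesis by simp
qed

text \<open>In the defining relation with second pair \<open>(i, i)\<close> every correction term
  asks for contradictory inequalities (\<open>f\<close>); only a commutation up to a power of
  \<open>q\<close> remains.\<close>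

lemma L_diag_commute:
  assumes "1 \<le> i" "i \<le> int n"
  shows "app (L i i) (app (L k l) v) = (qq powi (\<phi> l i - \<phi> k i)) *s app (L k l) (app (L i i) v)"
proof (cases "(k, l) \<in> generators n")
  case False
  then show ?thesis by (simp add: L_zero)
next
  case True
  have "(i, i) \<in> generators n" using assms by (simp add: generators_def I_iff)
  have f: "(i \<le> l \<and> l < i) = False" "(k \<le> - i \<and> - i < l \<and> l \<le> - i) = False"
    "(i < k \<and> k \<le> i) = False" "(- i \<le> k \<and> k < - i \<and> - i \<le> l) = False"
    by auto
  have "sc (qq powi \<phi> l i) * L k l * L i i = sc (qq powi \<phi> k i) * L i i * L k l"
    using L_rel[OF True \<open>(i, i) \<in> generators n\<close>] assms
    unfolding L_relation_def sc_def[symmetric] f by (simp add: par_def sc_zero)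
  then have "app (sc (qq powi \<phi> l i) * L k l * L i i) v = app (sc (qq powi \<phi> k i) * L i i * L k l) v"
    by simp
  then have "(qq powi (- \<phi> k i)) *s (qq powi \<phi> l i) *s app (L k l) (app (L i i) v)
    = (qq powi (- \<phi> k i)) *s (qq powi \<phi> k i) *s app (L i i) (app (L k l) v)"
    by simp
  then show ?thesis
    by (simp add: power_int_minus qq_nonzero power_int_diff field_simps)
qed

lemma wsp_L:
  assumes "v \<in> wsp \<mu>"
  shows "app (L k l) v \<in> wsp (shift \<mu> k l)"
proof (cases "(k, l) \<in> generators n")
  case False
  then show ?thesis using subspace_wsp subspace_0 by (simp add: L_zero)
next
  case True
  show ?thesis
    unfolding wsp_def
  proof (intro CollectI ballI)
    fix i assume i: "i \<in> {1..int n}"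
    have "shift \<mu> k l i = (\<phi> l i - \<phi> k i) + \<mu> i"
      using i by (auto simp: shift_def \<phi>_def)
    then show "app (L i i) (app (L k l) v) = (qq powi shift \<mu> k l i) *s app (L k l) v"
      using i by (simp add: L_diag_commute wspD[OF assms] L_scale power_int_add qq_nonzero)
  qed
qed

lemma shift_shift: "shift (shift \<mu> m j) i m = shift \<mu> i j"
  by (auto simp: shift_def)

lemma shift_abs: "shift \<mu> (- k) l = shift \<mu> k l" "shift \<mu> k (- l) = shift \<mu> k l"
  by (simp_all add: shift_def)

lemma shift_same: "\<bar>k\<bar> = \<bar>l\<bar> \<Longrightarrow> shift \<mu> k l = \<mu>"
  by (simp add: shift_def)

lemma ht_shift:
  assumes "k \<in> I" "l \<in> I"
  shows "ht (shift \<mu> k l) = ht \<mu> + \<bar>k\<bar> - \<bar>l\<bar>"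
proof -
  have e: "i * shift \<mu> k l i = i * \<mu> i + (if i = \<bar>l\<bar> then \<bar>l\<bar> else 0) - (if i = \<bar>k\<bar> then \<bar>k\<bar> else 0)" for i
    by (simp add: shift_def algebra_simps)
  have "\<bar>k\<bar> \<in> {1..int n}" "\<bar>l\<bar> \<in> {1..int n}" using assms by (auto simp: I_iff)
  then show ?thesis
    unfolding ht_def e by (simp add: sum.distrib sum_subtractf)
qed

text \<open>What the matrices \<open>L\<close> and \<open>N\<close> have in common.\<close>

definition graded_op :: "int \<Rightarrow> int \<Rightarrow> 'v endo \<Rightarrow> bool" where
  "graded_op i j x \<longleftrightarrow> (\<forall>c v. app x (c *s v) = c *s app x v) \<and> (\<forall>\<mu>. \<forall>v\<in>wsp \<mu>. app x v \<in> wsp (shift \<mu> i j)) \<and>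
     (\<forall>W. stable W \<longrightarrow> (\<forall>v\<in>W. app x v \<in> W))"

lemma graded_op_L: "graded_op i j (L i j)"
  by (simp add: graded_op_def L_scale wsp_L stable_L)

text \<open>Weight shifts compose along \<open>i\<close>, \<open>m\<close>, \<open>j\<close>, and
  \<open>L (- i) (- j)\<close> shifts weights as \<open>L i j\<close> does, so the recursion for the
  inverse preserves the property.\<close>

lemma graded_op_N: "graded_op i j (R.N i j)"
proof (rule R.N_induct[where Q = graded_op])
  fix i j x y assume "graded_op i j x" "graded_op i j y"
  then show "graded_op i j (x + y)"
    by (simp add: graded_op_def scale_right_distrib subspace_add[OF subspace_wsp] subspace_add[OF stable_subspace])
next
  fix i j x assume "graded_op i j x"
  then show "graded_op i j (- x)"
    by (simp add: graded_op_def subspace_neg[OF subspace_wsp] subspace_neg[OF stable_subspace])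
next
  fix i j m x y assume "graded_op i m x" "graded_op m j y"
  then show "graded_op i j (x * y)"
    by (simp add: graded_op_def) (metis shift_shift)
next
  show "graded_op i j (L (- i) (- j))" for i j
    using graded_op_L[of "- i" "- j"] by (simp add: graded_op_def shift_abs)
qed (auto simp: graded_op_def L_scale wsp_L stable_L subspace_0 subspace_wsp stable_subspace)

lemma graded_opD:
  assumes "graded_op i j x"
  shows "app x (c *s v) = c *s app x v" "v \<in> wsp \<mu> \<Longrightarrow> app x v \<in> wsp (shift \<mu> i j)"
    "stable W \<Longrightarrow> v \<in> W \<Longrightarrow> app x v \<in> W"
  using assms by (auto simp: graded_op_def)

lemma stable_sum: "stable W \<Longrightarrow> (\<And>a. a \<in> A \<Longrightarrow> f a \<in> W) \<Longrightarrow> sum f A \<in> W"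
  by (simp add: subspace_sum stable_subspace)

end

lemma one_plus_qq2_nonzero: "1 + qq ^ 2 \<noteq> 0"
proof -
  have "1 + qq ^ 2 = Fraction_Field.Fract [:1, 0, 1:] 1"
    by (simp add: qq_def power2_eq_square One_fract_def one_pCons)
  then show ?thesis by (simp add: Zero_fract_def eq_fract)
qed

section \<open>One-step recursions for running sums\<close>

context queer_ops
begin

definition zz :: "'v \<Rightarrow> 'v" where
  "zz x = qq *s x - inverse qq *s x"

lemma app_z: "app R.z x = zz x"
  by (simp add: R.z_def zz_def)

lemma qq_cancel: "qq *s inverse qq *s x = x" "inverse qq *s qq *s x = x"
  by (simp_all add: qq_nonzero)

lemma app_qe: "app (qe (sc qq) (sc (inverse qq)) 1) x = qq *s x" "app (qe (sc qq) (sc (inverse qq)) (- 1)) x = inverse qq *s x"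
  by (simp_all add: qe_def)

text \<open>The difference of the recursions \<open>b = q^2 b' + q z X\<close> and
  \<open>a = q^2 a' + q z X'\<close>, where \<open>z\<close> is \<open>q - 1/q\<close>; the two long
  brackets are their defects, which will lie in \<open>W\<close>. The same pattern gives
  \<open>chain_up\<close>, and with \<open>q^-2\<close> in place of \<open>q^2\<close>
  \<open>chain_down\<close>.\<close>

lemma chain_odd:
  "b - a = qq *s qq *s (b' - a') + qq *s (inverse qq *s (b - b') - zz b' - zz X)
     - qq *s (- (qq *s (a' - a)) - zz a - zz X') + qq *s zz (X - X')"
  by (simp add: zz_def scale_right_diff_distrib scale_right_distrib qq_cancel algebra_simps del: scale_scale)

lemma chain_up:
  "b - a = qq *s qq *s (b' - a') + qq *s zz (Y - Y')
     - qq *s (- (inverse qq *s (b - b')) + zz b' - zz Y') + qq *s (qq *s (a' - a) + zz a - zz Y)"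
  by (simp add: zz_def scale_right_diff_distrib scale_right_distrib qq_cancel algebra_simps del: scale_scale)

lemma chain_down:
  "b - a = inverse qq *s inverse qq *s (b' - a') + inverse qq *s zz (Z - Z')
     + inverse qq *s (qq *s (b - b') + zz b' - zz Z) - inverse qq *s (- (inverse qq *s (a' - a)) + zz a - zz Z')"
  by (simp add: zz_def scale_right_diff_distrib scale_right_distrib qq_cancel algebra_simps del: scale_scale)

end

text \<open>A vector of weight \<open>\<mu>\<close> in \<open>V\<close> is a highest weight vector of the subquotient \<open>V / W\<close>, since no higher
  weight occurs there. All values below are computed modulo \<open>W\<close>.\<close>

locale top_weight = queer_ops scale n L
  for scale :: "Cq \<Rightarrow> 'v::ab_group_add \<Rightarrow> 'v" (infixr \<open>*s\<close> 75) and n L +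
  fixes V W :: "'v set" and \<mu> :: "int \<Rightarrow> int"
  assumes stable_V: "stable V" and stable_W: "stable W"
    and top: "ht \<mu> < ht \<nu> \<Longrightarrow> V \<inter> wsp \<nu> \<subseteq> W"
begin

lemmas W_sub = stable_subspace[OF stable_W]
lemmas W_add = subspace_add[OF W_sub]
lemmas W_diff = subspace_diff[OF W_sub]
lemmas W_neg = subspace_neg[OF W_sub]
lemmas W_scale = subspace_scale[OF W_sub]
lemmas W_0 = subspace_0[OF W_sub]

lemma W_zz: "x \<in> W \<Longrightarrow> zz x \<in> W"
  unfolding zz_def by (intro W_diff W_scale)

lemma mod_odd:
  assumes "b' - a' \<in> W" "inverse qq *s (b - b') - zz b' - zz X \<in> W" "- (qq *s (a' - a)) - zz a - zz X' \<in> W" "X - X' \<in> W"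
  shows "b - a \<in> W"
  using W_add[OF W_diff[OF W_add[OF W_scale[OF W_scale[OF assms(1)]] W_scale[OF assms(2)]] W_scale[OF assms(3)]] W_scale[OF W_zz[OF assms(4)]]]
  unfolding chain_odd[of b a b' a' X X'] .

text \<open>Operators with \<open>|j| < |i|\<close> raise the height, and above
  \<open>ht \<mu>\<close> every weight vector of \<open>V\<close> lies in \<open>W\<close>.\<close>

lemma kill:
  assumes "v \<in> V \<inter> wsp \<mu>" "graded_op i j x" "i \<in> I" "j \<in> I" "\<bar>j\<bar> < \<bar>i\<bar>"
  shows "app x v \<in> W"
proof -
  have "ht \<mu> < ht (shift \<mu> i j)" using assms(3-5) by (simp add: ht_shift)
  then show ?thesis
    using top graded_opD(2,3)[OF assms(2)] assms(1) stable_V by blast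
qed

lemma kill_L: "v \<in> V \<inter> wsp \<mu> \<Longrightarrow> i \<in> I \<Longrightarrow> j \<in> I \<Longrightarrow> \<bar>j\<bar> < \<bar>i\<bar> \<Longrightarrow> app (L i j) v \<in> W"
  using kill graded_op_L by blast

lemma kill_N: "v \<in> V \<inter> wsp \<mu> \<Longrightarrow> i \<in> I \<Longrightarrow> j \<in> I \<Longrightarrow> \<bar>j\<bar> < \<bar>i\<bar> \<Longrightarrow> app (R.N i j) v \<in> W"
  using kill graded_op_N by blast

lemma cartan_top: "v \<in> V \<inter> wsp \<mu> \<Longrightarrow> app (L (- i) i) v \<in> V \<inter> wsp \<mu>"
  using wsp_L[of v \<mu> "- i" i] stable_L[OF stable_V] by (simp add: shift_same)

lemma sum_mod:
  assumes "finite A" "a \<in> A" "\<And>b. b \<in> A \<Longrightarrow> b \<noteq> a \<Longrightarrow> f b \<in> W"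
  shows "sum f A - f a \<in> W"
proof -
  have "sum f A - f a = sum f (A - {a})" using assms by (simp add: sum.remove)
  then show ?thesis using assms(3) stable_sum[OF stable_W, of "A - {a}" f] by simp
qed

lemma finite_I: "finite I"
  by (rule R.finite_I)

lemma sum_le_step:
  assumes "k \<in> I" "1 \<le> k" shows "(\<Sum>r | r \<in> I \<and> r \<le> k. f r) = (\<Sum>r | r \<in> I \<and> r \<le> k - 1. f r) + (f k :: 'v)"
proof -
  have "{r. r \<in> I \<and> r \<le> k} = insert k {r. r \<in> I \<and> r \<le> k - 1}" using assms by auto
  then show ?thesis using finite_I by (simp add: add.commute)
qed

lemma sum_less_step:
  assumes "k \<in> I" "1 \<le> k" shows "(\<Sum>r | r \<in> I \<and> r < - (k - 1). f r) = (\<Sum>r | r \<in> I \<and> r < - k. f r) + (f (- k) :: 'v)"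
proof -
  have "{r. r \<in> I \<and> r < - (k - 1)} = insert (- k) {r. r \<in> I \<and> r < - k}"
    using assms R.uminus_I[of k] by auto
  then show ?thesis using finite_I by (simp add: add.commute)
qed

lemma sum_less_0: "(\<Sum>r | r \<in> I \<and> r \<le> 0. f r) = (\<Sum>r | r \<in> I \<and> r < - 0. f r)"
  by (rule sum.cong) (auto simp: I_iff)

text \<open>The entry \<open>(i, - i)\<close> of \<open>N LJ = 1\<close> is a vanishing sum. Its
  last nonzero term contains \<open>L (- i) i\<close>, its first one \<open>N i (- i)\<close>. The
  recursion from \<open>N_L_odd\<close> shows that the part up to \<open>i - 1\<close> agrees modulo
  \<open>W\<close> with the part below \<open>- (i - 1)\<close>, which is that first term. This
  evaluates the odd contributions in \<open>diag_values\<close>.\<close>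

lemma N_odd_cartan:
  assumes "v \<in> V \<inter> wsp \<mu>" "1 \<le> i" "i \<le> int n"
  shows "app (R.N i (- i)) v - app (L (- i) i) v \<in> W"
  using assms(2,3)
proof (induction "nat i" arbitrary: i rule: less_induct)
  case less
  define f where "f r = app (pm (r < 0) * (R.N i r * L (- r) i)) v" for r
  define a where "a k = (\<Sum>r | r \<in> I \<and> r < - k. f r)" for k
  define b where "b k = (\<Sum>r | r \<in> I \<and> r \<le> k. f r)" for k
  have i: "i \<in> I" "0 < i" using less.prems by (auto simp: I_iff)
  \<comment> \<open>In the sum over \<open>c\<close> only \<open>c = |j|\<close> survives modulo
    \<open>W\<close>: for smaller \<open>c\<close> one factor is zero by triangularity, for larger
    \<open>c\<close> the entry \<open>N c j\<close> raises.\<close>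
  have key: "app (qe (sc qq) (sc (inverse qq)) (- sgn j)) (app (R.N i j) (app (L (- j) i) v))
      - zz (\<Sum>r | r \<in> I \<and> r < j. f r) - zz (app (L (- j) \<bar>j\<bar>) (app (R.N \<bar>j\<bar> j) v)) \<in> W"
    if j: "j \<in> I" "\<bar>j\<bar> < i" for j
  proof -
    have s: "(\<Sum>c | c \<in> I \<and> c < i. app (L (- j) c) (app (R.N c j) v)) - app (L (- j) \<bar>j\<bar>) (app (R.N \<bar>j\<bar> j) v) \<in> W"
    proof (rule sum_mod[where a = "\<bar>j\<bar>"])
      show "\<bar>j\<bar> \<in> {c. c \<in> I \<and> c < i}" using j by (simp add: I_iff)
    next
      fix c assume c: "c \<in> {c. c \<in> I \<and> c < i}" "c \<noteq> \<bar>j\<bar>"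
      consider "c < j" | "c < - j" | "\<bar>j\<bar> < c" using c(2) by linarith
      then show "app (L (- j) c) (app (R.N c j) v) \<in> W"
        using c j W_0 kill_N[OF assms(1), of c j] stable_L[OF stable_W]
        by cases (simp_all add: R.N_lower R.L_upper)
    qed (simp add: finite_I)
    have "app (L (- j) i) (app (R.N i j) v) \<in> W"
      using j i kill_N[OF assms(1), of i j] stable_L[OF stable_W] by simp
    then have "qq *s app (L (- j) i) (app (R.N i j) v) + zz ((\<Sum>c | c \<in> I \<and> c < i. app (L (- j) c) (app (R.N c j) v)) - app (L (- j) \<bar>j\<bar>) (app (R.N \<bar>j\<bar> j) v)) \<in> W"
      using s by (intro W_add W_scale W_zz)
    moreover have "qq *s app (L (- j) i) (app (R.N i j) v) + zz ((\<Sum>c | c \<in> I \<and> c < i. app (L (- j) c) (app (R.N c j) v)) - app (L (- j) \<bar>j\<bar>) (app (R.N \<bar>j\<bar> j) v))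
      = app (qe (sc qq) (sc (inverse qq)) (- sgn j)) (app (R.N i j) (app (L (- j) i) v))
      - zz (\<Sum>r | r \<in> I \<and> r < j. f r) - zz (app (L (- j) \<bar>j\<bar>) (app (R.N \<bar>j\<bar> j) v))"
      using arg_cong[OF R.N_L_odd[OF i(1) j(1)], of "\<lambda>x. app x v"] i(2)
      by (simp add: app_sum app_z app_qe f_def) (simp add: zz_def scale_right_diff_distrib algebra_simps)
    ultimately show ?thesis by simp
  qed
  have chain: "0 \<le> k \<Longrightarrow> k < i \<Longrightarrow> b k - a k \<in> W" for k
  proof (induction k rule: int_ge_induct)
    case base
    \<comment> \<open>As 0 is not an index, both running sums start over the same set.\<close>
    show ?case using W_0 by (simp add: a_def b_def sum_less_0)
  next
    case (step k')
    define k where "k = k' + 1"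
    have k: "k \<in> I" "1 \<le> k" "k < i" "k - 1 = k'" using step i by (auto simp: I_iff k_def)
    define X where "X = app (L (- k) k) (app (L k k) v)"
    define X' where "X' = app (L k k) (app (R.N k (- k)) v)"
    have w1: "inverse qq *s (b k - b k') - zz (b k') - zz X \<in> W"
    proof -
      have "{r. r \<in> I \<and> r < k} = {r. r \<in> I \<and> r \<le> k'}" using k by auto
      then show ?thesis
        using key[of k] k sum_le_step[OF k(1,2), of f] by (simp add: b_def X_def R.N_diag app_qe f_def)
    qed
    have w2: "- (qq *s (a k' - a k)) - zz (a k) - zz X' \<in> W"
      using key[of "- k"] k R.uminus_I[OF k(1)] sum_less_step[OF k(1,2), of f]
      by (simp add: a_def X'_def app_qe f_def)
    \<comment> \<open>The inhomogeneous terms at \<open>k\<close> and \<open>- k\<close> agree by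
      the outer induction hypothesis, the claim itself for \<open>k < i\<close>.\<close>
    have "X' - X \<in> W"
    proof -
      have "app (L k k) (app (L (- k) k) v) = X"
        using k i by (simp add: L_diag_commute I_iff X_def \<phi>_def)
      then have "X' - X = app (L k k) (app (R.N k (- k)) v - app (L (- k) k) v)"
        by (simp add: X'_def)
      moreover have "app (R.N k (- k)) v - app (L (- k) k) v \<in> W"
        using less.hyps[of k] k less.prems by simp
      ultimately show ?thesis
        using stable_L[OF stable_W, of _ k k] by metis
    qed
    then have "X - X' \<in> W" using W_neg[of "X' - X"] by simp
    then show ?case
      using mod_odd[OF _ w1 w2] step.IH k unfolding k_def[symmetric] by simp
  qed
  have total: "b (i - 1) + f i = 0"
  proof -
    have 0: "(\<Sum>m\<in>I. R.N i m * R.LJ m (- i)) = 0"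
      using fun_cong[OF fun_cong[OF R.N_LJ, of i], of "- i"] i by (simp add: mmul_def idm_def)
    have "b (i - 1) + f i = (\<Sum>r | r \<in> I \<and> r \<le> i. f r)"
      using sum_le_step[of i f] i less.prems by (simp add: b_def)
    also have "\<dots> = (\<Sum>r\<in>I. f r)"
    proof (rule sum.mono_neutral_left)
      show "\<forall>r\<in>I - {r. r \<in> I \<and> r \<le> i}. f r = 0"
        by (clarsimp simp: f_def R.N_lower not_le)
    qed (auto simp: finite_I)
    also have "\<dots> = - app (\<Sum>m\<in>I. R.N i m * R.LJ m (- i)) v"
      unfolding app_sum sum_negf[symmetric]
    proof (rule sum.cong)
      fix r assume "r \<in> I"
      then show "f r = - app (R.N i r * R.LJ r (- i)) v"
        using i by (cases "r < 0") (auto simp: f_def R.LJ_def odd_pair_def I_iff)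
    qed simp
    finally show ?thesis by (simp add: 0)
  qed
  have last: "a (i - 1) = f (- i)"
  proof -
    have "a (i - 1) = (\<Sum>r\<in>{- i}. f r)"
      unfolding a_def
    proof (rule sum.mono_neutral_right)
      show "\<forall>r\<in>{r. r \<in> I \<and> r < - (i - 1)} - {- i}. f r = 0"
        by (clarsimp simp: f_def R.L_upper)
    qed (use i finite_I R.uminus_I[OF i(1)] in simp_all)
    then show ?thesis by simp
  qed
  have fi: "f (- i) = - app (R.N i (- i)) (app (L i i) v)" "f i = app (L i i) (app (L (- i) i) v)"
    using i by (simp_all add: f_def R.N_diag)
  have w: "app (L i i) v = (qq powi \<mu> i) *s v" "app (L i i) (app (L (- i) i) v) = (qq powi \<mu> i) *s app (L (- i) i) v"
    using wspD[of v \<mu> i] wspD[of "app (L (- i) i) v" \<mu> i] cartan_top[OF assms(1)] assms(1) less.prems by auto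
  have "(qq powi \<mu> i) *s (app (R.N i (- i)) v - app (L (- i) i) v) = b (i - 1) - a (i - 1)"
  proof -
    have "b (i - 1) = - f i" using total by (simp add: eq_neg_iff_add_eq_0)
    then show ?thesis
      unfolding last fi w by (simp add: graded_opD(1)[OF graded_op_N] scale_right_diff_distrib)
  qed
  then have "(qq powi \<mu> i) *s (app (R.N i (- i)) v - app (L (- i) i) v) \<in> W"
    using chain[of "i - 1"] less.prems by simp
  then have "(qq powi - \<mu> i) *s (qq powi \<mu> i) *s (app (R.N i (- i)) v - app (L (- i) i) v) \<in> W"
    by (rule W_scale)
  then show ?case by (simp add: power_int_minus qq_nonzero)
qed

end

section \<open>The value of the central element on top vectors\<close>

context queer_ops
begin

text \<open>A diagonal entry of the product in the opposite order. It does not occur in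
  \<open>C\<close>, but \<open>N_L_even\<close> expresses partial sums of \<open>M i i\<close>
  through it.\<close>

definition LN :: "int \<Rightarrow> 'v endo" where
  "LN j = (\<Sum>a\<in>I. L j a * R.N a j)"

definition Dq :: "(int \<Rightarrow> int) \<Rightarrow> int \<Rightarrow> Cq" where
  "Dq \<mu> k = qq powi (2 * \<mu> k) - qq powi (- 2 * \<mu> k)"

text \<open>The even Cartan generators contribute \<open>Dq\<close>, the odd one adds or subtracts
  the square computed in \<open>odd_square\<close>. The outcomes are
  \<open>2 q^2 / (1 + q^2)\<close> and \<open>2 / (1 + q^2)\<close> times \<open>Dq\<close>, that is
  \<open>qq ^ 2 * del\<close> and \<open>del\<close>.\<close>

definition del :: "(int \<Rightarrow> int) \<Rightarrow> int \<Rightarrow> Cq" where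
  "del \<mu> k = 2 * Dq \<mu> k / (1 + qq ^ 2)"

definition Sg :: "(int \<Rightarrow> int) \<Rightarrow> int \<Rightarrow> Cq" where
  "Sg \<mu> k = (\<Sum>j = 1..k. del \<mu> j)"

lemma Sg_0: "Sg \<mu> 0 = 0"
  by (simp add: Sg_def)

lemma Sg_step: "1 \<le> k \<Longrightarrow> Sg \<mu> k = Sg \<mu> (k - 1) + del \<mu> k"
proof -
  assume "1 \<le> k"
  then have "{1..k} = insert k {1..k - 1}" by auto
  then show ?thesis by (simp add: Sg_def)
qed

lemma app_M: "app (R.M i j) v = (\<Sum>m\<in>I. app (R.N i m) (app (L m j) v))"
  by (simp add: R.M_def mmul_def app_sum)

lemma app_LN: "app (LN j) v = (\<Sum>a\<in>I. app (L j a) (app (R.N a j) v))"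
  by (simp add: LN_def app_sum)

lemma zz_diff: "zz (x - y) = zz x - zz y"
  by (simp add: zz_def scale_right_diff_distrib)

lemma zz_scale: "zz (c *s v) = (c * (qq - inverse qq)) *s v"
  by (simp add: zz_def algebra_simps)

lemma powi_2: "qq powi (2 * k) = qq powi k * qq powi k"
  by (simp add: qq_nonzero flip: power_int_add)

text \<open>With \<open>x = L (- i) i\<close> and \<open>K = L i i\<close>, the defining relation of
  \<open>x\<close> with itself reads \<open>(q + 1/q) x^2 = (q - 1/q) (K^2 - K^-2)\<close>. The
  resulting scalar is zero exactly when \<open>\<mu> i = 0\<close>.\<close>

lemma odd_square:
  assumes "1 \<le> i" "i \<le> int n" "v \<in> wsp \<mu>"
  shows "app (L (- i) i) (app (L (- i) i) v) = ((qq ^ 2 - 1) / (1 + qq ^ 2) * Dq \<mu> i) *s v"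
proof -
  let ?x = "L (- i) i"
  have g: "(- i, i) \<in> generators n" using assms by (simp add: generators_def I_iff)
  have s: "\<theta> (- i) i (- i) = - 1" "\<theta> (- (- i)) (- i) (- i) = - 1" "\<phi> i i = 1" "\<phi> (- i) (- i) = - 1" "par (- i) i = 1"
    using assms(1) by (simp_all add: \<theta>_def \<phi>_def par_def mult_less_0_iff)
  have f: "(- i \<le> i \<and> i < i) = False" "(- i \<le> - i \<and> - i < i \<and> i \<le> - (- i)) = True"
    "(- i < - i \<and> - i \<le> i) = False" "(- i \<le> - i \<and> - i < - (- i) \<and> - (- i) \<le> i) = True"
    using assms by auto
  have "sc ((- 1) ^ (par (- i) i * par (- i) i) * qq powi \<phi> i i) * ?x * ?x
      + sc (- (qq - inverse qq)) * L (- i) (- i) * L (- i) (- i)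
    = sc (qq powi \<phi> (- i) (- i)) * ?x * ?x + sc (- (qq - inverse qq)) * L i i * L i i"
    using L_rel[OF g g] unfolding L_relation_def sc_def[symmetric] f s by (simp add: sc_zero)
  then have e: "sc (- qq) * ?x * ?x + sc (inverse qq - qq) * L (- i) (- i) * L (- i) (- i)
    = sc (inverse qq) * ?x * ?x + sc (inverse qq - qq) * L i i * L i i"
    unfolding s by simp
  have ee: "app (sc (- qq) * ?x * ?x + sc (inverse qq - qq) * L (- i) (- i) * L (- i) (- i)) v
    = app (sc (inverse qq) * ?x * ?x + sc (inverse qq - qq) * L i i * L i i) v"
    using e by simp
  have k: "app (L i i) (app (L i i) v) = (qq powi (2 * \<mu> i)) *s v" "app (L (- i) (- i)) (app (L (- i) (- i)) v) = (qq powi (- 2 * \<mu> i)) *s v"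
    using wspD[OF assms(3,1,2)] wspD_neg[OF assms(3,1,2)] powi_2[of "\<mu> i"] powi_2[of "- \<mu> i"] by (simp_all add: L_scale)
  have "(- qq) *s app ?x (app ?x v) + ((inverse qq - qq) * (qq powi (- 2 * \<mu> i))) *s v
    = inverse qq *s app ?x (app ?x v) + ((inverse qq - qq) * (qq powi (2 * \<mu> i))) *s v"
    using ee by (simp only: app_simps app_sc k scale_scale)
  then have "((inverse qq - qq) * (qq powi (- 2 * \<mu> i))) *s v - ((inverse qq - qq) * (qq powi (2 * \<mu> i))) *s v
    = inverse qq *s app ?x (app ?x v) - (- qq) *s app ?x (app ?x v)"
    by (simp add: algebra_simps)
  then have eq: "((qq - inverse qq) * Dq \<mu> i) *s v = (qq + inverse qq) *s app ?x (app ?x v)"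
    unfolding scale_left_diff_distrib[symmetric] by (simp add: Dq_def algebra_simps)
  have q: "qq + inverse qq = (1 + qq ^ 2) / qq" "qq - inverse qq = (qq ^ 2 - 1) / qq"
    using qq_nonzero by (simp_all add: field_simps power2_eq_square)
  have "(qq / (1 + qq ^ 2)) *s ((qq - inverse qq) * Dq \<mu> i) *s v = app ?x (app ?x v)"
    unfolding eq using one_plus_qq2_nonzero by (simp add: q qq_nonzero)
  then show ?thesis
    using qq_nonzero by (simp add: q)
qed

end

context top_weight
begin

lemma mod_up:
  assumes "b' - a' - c0 *s v \<in> W" "Y - Y' - g *s v \<in> W"
    "- (inverse qq *s (b - b')) + zz b' - zz Y' \<in> W" "qq *s (a' - a) + zz a - zz Y \<in> W"
    "qq ^ 2 * c0 + (qq ^ 2 - 1) * g = c1"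
  shows "b - a - c1 *s v \<in> W"
proof -
  have "qq *s qq *s (b' - a' - c0 *s v) + qq *s zz (Y - Y' - g *s v)
     - qq *s (- (inverse qq *s (b - b')) + zz b' - zz Y') + qq *s (qq *s (a' - a) + zz a - zz Y) \<in> W"
    by (rule W_add[OF W_diff[OF W_add[OF W_scale[OF W_scale[OF assms(1)]] W_scale[OF W_zz[OF assms(2)]]] W_scale[OF assms(3)]] W_scale[OF assms(4)]])
  moreover have "qq *s qq *s (b' - a' - c0 *s v) + qq *s zz (Y - Y' - g *s v) = qq *s qq *s (b' - a') + qq *s zz (Y - Y') - c1 *s v"
  proof -
    have "c1 *s v = (qq ^ 2 * c0) *s v + ((qq ^ 2 - 1) * g) *s v"
      unfolding assms(5)[symmetric] by (simp add: scale_left_distrib)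
    moreover have "qq * (g * (qq - inverse qq)) = (qq ^ 2 - 1) * g"
      using qq_nonzero by (simp add: field_simps power2_eq_square)
    ultimately show ?thesis
      by (simp add: zz_diff zz_scale scale_right_diff_distrib power2_eq_square mult.assoc)
  qed
  ultimately have "qq *s qq *s (b' - a') + qq *s zz (Y - Y') - c1 *s v
     - qq *s (- (inverse qq *s (b - b')) + zz b' - zz Y') + qq *s (qq *s (a' - a) + zz a - zz Y) \<in> W"
    by (simp only:)
  moreover have "x + y - c - z + w = (x + y - z + w) - c" for x y z w c :: 'v by simp
  ultimately show ?thesis
    using chain_up[of b a b' a' Y Y'] by metis
qed

lemma mod_down:
  assumes "b' - a' - c0 *s v \<in> W" "Y - Y' - g *s v \<in> W"
    "qq *s (b - b') + zz b' - zz Y \<in> W" "- (inverse qq *s (a' - a)) + zz a - zz Y' \<in> W"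
    "c0 + (qq ^ 2 - 1) * g = qq ^ 2 * c1"
  shows "b - a - c1 *s v \<in> W"
proof -
  have "inverse qq *s inverse qq *s (b' - a' - c0 *s v) + inverse qq *s zz (Y - Y' - g *s v)
     + inverse qq *s (qq *s (b - b') + zz b' - zz Y) - inverse qq *s (- (inverse qq *s (a' - a)) + zz a - zz Y') \<in> W"
    by (rule W_diff[OF W_add[OF W_add[OF W_scale[OF W_scale[OF assms(1)]] W_scale[OF W_zz[OF assms(2)]]] W_scale[OF assms(3)]] W_scale[OF assms(4)]])
  moreover have "inverse qq *s inverse qq *s (b' - a' - c0 *s v) + inverse qq *s zz (Y - Y' - g *s v)
     = inverse qq *s inverse qq *s (b' - a') + inverse qq *s zz (Y - Y') - c1 *s v"
  proof -
    have "c1 = inverse qq * inverse qq * c0 + inverse qq * (qq - inverse qq) * g"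
      using assms(5) qq_nonzero by (simp add: field_simps power2_eq_square)
    then have "c1 *s v = (inverse qq * inverse qq * c0) *s v + (inverse qq * (qq - inverse qq) * g) *s v"
      by (simp only: scale_left_distrib)
    then show ?thesis
      by (simp add: zz_def scale_right_diff_distrib algebra_simps)
  qed
  ultimately have "inverse qq *s inverse qq *s (b' - a') + inverse qq *s zz (Y - Y') - c1 *s v
     + inverse qq *s (qq *s (b - b') + zz b' - zz Y) - inverse qq *s (- (inverse qq *s (a' - a)) + zz a - zz Y') \<in> W"
    by (simp only:)
  moreover have "x + y - c + z - w = (x + y + z - w) - c" for x y z w c :: 'v by simp
  ultimately show ?thesis
    using chain_down[of b a b' a' Y Y'] by metis
qed

lemma sum_ge_step:
  assumes "k \<in> I" "1 \<le> k" shows "(\<Sum>r | r \<in> I \<and> - k \<le> r. f r) = (\<Sum>r | r \<in> I \<and> - (k - 1) \<le> r. f r) + (f (- k) :: 'v)"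
proof -
  have "{r. r \<in> I \<and> - k \<le> r} = insert (- k) {r. r \<in> I \<and> - (k - 1) \<le> r}" using assms R.uminus_I[of k] by auto
  then show ?thesis using finite_I by (simp add: add.commute)
qed

lemma sum_greater_step:
  assumes "k \<in> I" "1 \<le> k" shows "(\<Sum>r | r \<in> I \<and> k - 1 < r. f r) = (\<Sum>r | r \<in> I \<and> k < r. f r) + (f k :: 'v)"
proof -
  have "{r. r \<in> I \<and> k - 1 < r} = insert k {r. r \<in> I \<and> k < r}" using assms by auto
  then show ?thesis using finite_I by (simp add: add.commute)
qed

lemma sum_greater_0: "(\<Sum>r | r \<in> I \<and> - 0 \<le> r. f r) = (\<Sum>r | r \<in> I \<and> 0 < r. f r)"
  by (rule sum.cong) (auto simp: I_iff)

lemma sum_split_mod: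
  assumes "\<And>b. b \<in> I \<Longrightarrow> \<not> P b \<Longrightarrow> f b \<in> W"
  shows "(\<Sum>b\<in>I. f b) - (\<Sum>b | b \<in> I \<and> P b. f b) \<in> W"
proof -
  have "I = {b. b \<in> I \<and> P b} \<union> {b. b \<in> I \<and> \<not> P b}" by auto
  then have "(\<Sum>b\<in>I. f b) = (\<Sum>b | b \<in> I \<and> P b. f b) + (\<Sum>b | b \<in> I \<and> \<not> P b. f b)"
    using finite_I by (metis (no_types, lifting) sum.union_disjoint disjoint_iff finite_Un mem_Collect_eq)
  then show ?thesis
    using assms stable_sum[OF stable_W, of "{b. b \<in> I \<and> \<not> P b}" f] by simp
qed

text \<open>\<open>N_L_even\<close> on a top vector. As \<open>|j| < i\<close>, the product in which
  \<open>N i j\<close> acts first lies in \<open>W\<close>, and the truncated sum differs from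
  \<open>LN j\<close> only by terms with \<open>N a j\<close>, \<open>a \<ge> i\<close>, which
  raise.\<close>

lemma key_up:
  assumes v: "v \<in> V \<inter> wsp \<mu>" and i: "i \<in> I" "0 < i" and j: "j \<in> I" "\<bar>j\<bar> < i"
  shows "app (qe (sc qq) (sc (inverse qq)) (sgn j)) (app (pm (j < 0)) (app (R.N i j) (app (L j i) v)))
    + zz (\<Sum>m | m \<in> I \<and> j < m. app (R.N i m) (app (L m i) v)) - zz (app (LN j) v) \<in> W"
proof -
  let ?r = "\<Sum>a | a \<in> I \<and> a < i. app (L j a) (app (R.N a j) v)"
  have 1: "app (LN j) v - ?r \<in> W"
    unfolding app_LN
  proof (rule sum_split_mod)
    fix a assume "a \<in> I" "\<not> a < i"
    then show "app (L j a) (app (R.N a j) v) \<in> W"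
      using kill_N[OF v, of a j] j stable_L[OF stable_W] by simp
  qed
  have 2: "app (L j i) (app (R.N i j) v) \<in> W"
    using kill_N[OF v, of i j] i j stable_L[OF stable_W] by simp
  have "app (qe (sc qq) (sc (inverse qq)) (sgn j)) (app (pm (j < 0)) (app (R.N i j) (app (L j i) v)))
    + zz (\<Sum>m | m \<in> I \<and> j < m. app (R.N i m) (app (L m i) v))
    = qq *s app (L j i) (app (R.N i j) v) + zz ?r"
    using arg_cong[OF R.N_L_even[OF i(1) j(1)], of "\<lambda>x. app x v"] i(2)
    by (simp add: app_sum app_z app_qe)
  then have "app (qe (sc qq) (sc (inverse qq)) (sgn j)) (app (pm (j < 0)) (app (R.N i j) (app (L j i) v)))
    + zz (\<Sum>m | m \<in> I \<and> j < m. app (R.N i m) (app (L m i) v)) - zz (app (LN j) v)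
    = qq *s app (L j i) (app (R.N i j) v) - zz (app (LN j) v - ?r)"
    by (simp add: zz_def scale_right_diff_distrib algebra_simps)
  then show ?thesis using W_diff[OF W_scale[OF 2] W_zz[OF 1]] by simp
qed

text \<open>The mirror image of \<open>key_up\<close>: \<open>N_L_even\<close> at
  \<open>(j, - i)\<close>. Here \<open>L (- i) j\<close> acts first and raises, and the truncated
  sum completes to \<open>M j j\<close>.\<close>

lemma key_down:
  assumes v: "v \<in> V \<inter> wsp \<mu>" and i: "i \<in> I" "0 < i" and j: "j \<in> I" "\<bar>j\<bar> < i"
  shows "app (qe (sc qq) (sc (inverse qq)) (sgn j)) (app (pm (j < 0)) (app (L (- i) j) (app (R.N j (- i)) v)))
    + zz (\<Sum>r | r \<in> I \<and> r < j. app (L (- i) r) (app (R.N r (- i)) v)) - zz (app (R.M j j) v) \<in> W"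
proof -
  let ?r = "\<Sum>m | m \<in> I \<and> - i < m. app (R.N j m) (app (L m j) v)"
  have 1: "app (R.M j j) v - ?r \<in> W"
    unfolding app_M
  proof (rule sum_split_mod)
    fix a assume "a \<in> I" "\<not> - i < a"
    then show "app (R.N j a) (app (L a j) v) \<in> W"
      using kill_L[OF v, of a j] j graded_opD(3)[OF graded_op_N stable_W] by simp
  qed
  have 2: "app (R.N j (- i)) (app (L (- i) j) v) \<in> W"
    using kill_L[OF v, of "- i" j] i j R.uminus_I[OF i(1)] graded_opD(3)[OF graded_op_N stable_W] by simp
  have "app (qe (sc qq) (sc (inverse qq)) (sgn j)) (app (pm (j < 0)) (app (L (- i) j) (app (R.N j (- i)) v)))
    + zz (\<Sum>r | r \<in> I \<and> r < j. app (L (- i) r) (app (R.N r (- i)) v))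
    = - (inverse qq *s app (R.N j (- i)) (app (L (- i) j) v)) + zz ?r"
    using arg_cong[OF R.N_L_even[OF j(1) R.uminus_I[OF i(1)]], of "\<lambda>x. app x v"] i(2)
    by (simp add: app_sum app_z app_qe sgn_minus)
  then have "app (qe (sc qq) (sc (inverse qq)) (sgn j)) (app (pm (j < 0)) (app (L (- i) j) (app (R.N j (- i)) v)))
    + zz (\<Sum>r | r \<in> I \<and> r < j. app (L (- i) r) (app (R.N r (- i)) v)) - zz (app (R.M j j) v)
    = - (inverse qq *s app (R.N j (- i)) (app (L (- i) j) v)) - zz (app (R.M j j) v - ?r)"
    by (simp add: zz_def scale_right_diff_distrib algebra_simps)
  then show ?thesis using W_diff[OF W_neg[OF W_scale[OF 2]] W_zz[OF 1]] by simp
qed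

end

lemma two_nonzero: "(2 :: Cq) \<noteq> 0"
proof -
  have 2: "(2 :: Cq) = Fraction_Field.Fract (1 + 1) 1"
    by (simp only: one_add_one[symmetric] One_fract_def) simp
  have "Fraction_Field.Fract (1 + 1) (1 :: complex poly) \<noteq> Fraction_Field.Fract 0 1"
    by (subst eq_fract) simp_all
  then show ?thesis unfolding 2 Zero_fract_def .
qed

lemma four_nonzero: "(4 :: Cq) \<noteq> 0"
proof -
  have "(2 :: Cq) * 2 \<noteq> 0" using two_nonzero mult_eq_0_iff by blast
  then show ?thesis by simp
qed

context top_weight
begin

lemma del_expand: "Dq \<mu> k = (1 + qq ^ 2) / 2 * del \<mu> k"
  using one_plus_qq2_nonzero two_nonzero by (simp add: del_def)

text \<open>Going from \<open>k - 1\<close> to \<open>k\<close> moves the indices \<open>k\<close>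
  and \<open>- k\<close> across the two cuts, and \<open>key_up\<close> at both of them gives one
  step of a recursion. The hypothesis on \<open>LN\<close> supplies its inhomogeneous term, and
  \<open>(q^2 - 1) Sg\<close> solves it (\<open>4\<close>).\<close>

lemma chain_up_value:
  assumes v: "v \<in> V \<inter> wsp \<mu>" and i: "i \<in> I" "0 < i"
    and IH: "\<And>k. 1 \<le> k \<Longrightarrow> k < i \<Longrightarrow>
      app (LN k) v - app (LN (- k)) v - (del \<mu> k - (qq ^ 2 - 1) * Sg \<mu> (k - 1)) *s v \<in> W"
    and k: "0 \<le> k" "k < i"
  shows "(\<Sum>m | m \<in> I \<and> - k \<le> m. app (R.N i m) (app (L m i) v)) - (\<Sum>m | m \<in> I \<and> k < m. app (R.N i m) (app (L m i) v))
    - ((qq ^ 2 - 1) * Sg \<mu> k) *s v \<in> W"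
  using k
proof (induction k rule: int_ge_induct)
  case base
  show ?case using W_0 by (simp only: sum_greater_0) (simp add: Sg_0)
next
  case (step k')
  define f where "f m = app (R.N i m) (app (L m i) v)" for m
  define b where "b k = (\<Sum>m | m \<in> I \<and> - k \<le> m. f m)" for k
  define a where "a k = (\<Sum>m | m \<in> I \<and> k < m. f m)" for k
  define k where "k = k' + 1"
  have k: "k \<in> I" "1 \<le> k" "k < i" "k - 1 = k'" using step i by (auto simp: I_iff k_def)
  have b: "b k = b k' + f (- k)" using sum_ge_step[OF k(1,2), of f] k(4) by (simp add: b_def)
  have a: "a k' = a k + f k" using sum_greater_step[OF k(1,2), of f] k(4) by (simp add: a_def)
  have 1: "- (inverse qq *s (b k - b k')) + zz (b k') - zz (app (LN (- k)) v) \<in> W"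
  proof -
    have "{m. m \<in> I \<and> - k < m} = {m. m \<in> I \<and> - k' \<le> m}" using k by auto
    then show ?thesis
      using key_up[OF v i, of "- k"] k R.uminus_I[OF k(1)] by (simp add: app_qe b) (simp add: f_def b_def)
  qed
  have 2: "qq *s (a k' - a k) + zz (a k) - zz (app (LN k) v) \<in> W"
    using key_up[OF v i, of k] k by (simp add: app_qe a) (simp add: f_def a_def)
  have 3: "b k' - a k' - ((qq ^ 2 - 1) * Sg \<mu> k') *s v \<in> W"
    using step.IH k unfolding a_def b_def f_def by simp
  have 4: "qq ^ 2 * ((qq ^ 2 - 1) * Sg \<mu> k') + (qq ^ 2 - 1) * (del \<mu> k - (qq ^ 2 - 1) * Sg \<mu> k') = (qq ^ 2 - 1) * Sg \<mu> k"
    using Sg_step[OF k(2), of \<mu>] k(4) by (simp add: algebra_simps)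
  have "b k - a k - ((qq ^ 2 - 1) * Sg \<mu> k) *s v \<in> W"
    by (rule mod_up[OF 3 _ 1 2 4]) (use IH[OF k(2,3)] k(4) in simp)
  then show ?case by (simp only: a_def b_def f_def k_def)
qed

lemma chain_down_value:
  assumes v: "v \<in> V \<inter> wsp \<mu>" and i: "i \<in> I" "0 < i"
    and IH: "\<And>k. 1 \<le> k \<Longrightarrow> k < i \<Longrightarrow>
      app (R.M k k) v - app (R.M (- k) (- k)) v - (qq ^ 2 * del \<mu> k + (qq ^ 2 - 1) * Sg \<mu> (k - 1)) *s v \<in> W"
    and k: "0 \<le> k" "k < i"
  shows "(\<Sum>r | r \<in> I \<and> r \<le> k. app (L (- i) r) (app (R.N r (- i)) v)) - (\<Sum>r | r \<in> I \<and> r < - k. app (L (- i) r) (app (R.N r (- i)) v))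
    - ((qq ^ 2 - 1) * Sg \<mu> k) *s v \<in> W"
  using k
proof (induction k rule: int_ge_induct)
  case base
  show ?case using W_0 by (simp only: sum_less_0) (simp add: Sg_0)
next
  case (step k')
  define f where "f r = app (L (- i) r) (app (R.N r (- i)) v)" for r
  define b where "b k = (\<Sum>m | m \<in> I \<and> m \<le> k. f m)" for k
  define a where "a k = (\<Sum>m | m \<in> I \<and> m < - k. f m)" for k
  define k where "k = k' + 1"
  have k: "k \<in> I" "1 \<le> k" "k < i" "k - 1 = k'" using step i by (auto simp: I_iff k_def)
  have b: "b k = b k' + f k" using sum_le_step[OF k(1,2), of f] k(4) by (simp add: b_def)
  have a: "a k' = a k + f (- k)" using sum_less_step[OF k(1,2), of f] k(4) by (simp add: a_def)
  have 1: "qq *s (b k - b k') + zz (b k') - zz (app (R.M k k) v) \<in> W"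
  proof -
    have "{m. m \<in> I \<and> m < k} = {m. m \<in> I \<and> m \<le> k'}" using k by auto
    then show ?thesis
      using key_down[OF v i, of k] k by (simp add: app_qe b) (simp add: f_def b_def)
  qed
  have 2: "- (inverse qq *s (a k' - a k)) + zz (a k) - zz (app (R.M (- k) (- k)) v) \<in> W"
    using key_down[OF v i, of "- k"] k R.uminus_I[OF k(1)] by (simp add: app_qe a) (simp add: f_def a_def)
  have 3: "b k' - a k' - ((qq ^ 2 - 1) * Sg \<mu> k') *s v \<in> W"
    using step.IH k unfolding a_def b_def f_def by simp
  have 4: "(qq ^ 2 - 1) * Sg \<mu> k' + (qq ^ 2 - 1) * (qq ^ 2 * del \<mu> k + (qq ^ 2 - 1) * Sg \<mu> k') = qq ^ 2 * ((qq ^ 2 - 1) * Sg \<mu> k)"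
    using Sg_step[OF k(2), of \<mu>] k(4) by (simp add: algebra_simps)
  have "b k - a k - ((qq ^ 2 - 1) * Sg \<mu> k) *s v \<in> W"
    by (rule mod_down[OF 3 _ 1 2 4]) (use IH[OF k(2,3)] k(4) in simp)
  then show ?case by (simp only: a_def b_def f_def k_def)
qed

text \<open>Both values need a common induction: the running sums for \<open>M i i\<close> use
  \<open>LN\<close> at \<open>k < i\<close>, those for \<open>LN (- i)\<close> use \<open>M\<close>
  at \<open>k < i\<close>. At \<open>k = i - 1\<close> one running sum is a single square of an even
  Cartan generator, and the other lacks just one odd term, known from \<open>N_odd_cartan\<close>
  and \<open>odd_square\<close>.\<close>

lemma diag_values:
  assumes v: "v \<in> V \<inter> wsp \<mu>" and "1 \<le> i" "i \<le> int n"
  shows "app (LN i) v - app (LN (- i)) v - (del \<mu> i - (qq ^ 2 - 1) * Sg \<mu> (i - 1)) *s v \<in> W \<and>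
    app (R.M i i) v - app (R.M (- i) (- i)) v - (qq ^ 2 * del \<mu> i + (qq ^ 2 - 1) * Sg \<mu> (i - 1)) *s v \<in> W"
  using assms(2,3)
proof (induction "nat i" arbitrary: i rule: less_induct)
  case less
  have i: "i \<in> I" "- i \<in> I" "0 < i" using less.prems by (auto simp: I_iff)
  have IH: "app (LN k) v - app (LN (- k)) v - (del \<mu> k - (qq ^ 2 - 1) * Sg \<mu> (k - 1)) *s v \<in> W"
    "app (R.M k k) v - app (R.M (- k) (- k)) v - (qq ^ 2 * del \<mu> k + (qq ^ 2 - 1) * Sg \<mu> (k - 1)) *s v \<in> W"
    if "1 \<le> k" "k < i" for k
    using less that by auto
  define f where "f m = app (R.N i m) (app (L m i) v)" for m
  define t where "t r = app (L (- i) r) (app (R.N r (- i)) v)" for r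
  let ?s = "((qq ^ 2 - 1) * Sg \<mu> (i - 1)) *s v" and ?xx = "((qq ^ 2 - 1) / (1 + qq ^ 2) * Dq \<mu> i) *s v"
  let ?p = "(qq powi (2 * \<mu> i)) *s v" and ?m = "(qq powi (- 2 * \<mu> i)) *s v"
  have K: "app (L i i) (app (L i i) v) = ?p" "app (L (- i) (- i)) (app (L (- i) (- i)) v) = ?m"
    using wspD[of v \<mu> i] wspD_neg[of v \<mu> i] v less.prems powi_2[of "\<mu> i"] powi_2[of "- \<mu> i"]
    by (simp_all add: L_scale)
  have xx: "app (L (- i) i) (app (L (- i) i) v) = ?xx"
    using odd_square[OF less.prems] v by blast
  have up: "(\<Sum>m | m \<in> I \<and> - (i - 1) \<le> m. f m) - (\<Sum>m | m \<in> I \<and> i - 1 < m. f m) - ?s \<in> W"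
    unfolding f_def by (rule chain_up_value[OF v i(1,3) IH(1)]) (use less.prems in auto)
  have down: "(\<Sum>r | r \<in> I \<and> r \<le> i - 1. t r) - (\<Sum>r | r \<in> I \<and> r < - (i - 1). t r) - ?s \<in> W"
    unfolding t_def by (rule chain_down_value[OF v i(1,3) IH(2)]) (use less.prems in auto)
  have up_i: "(\<Sum>m | m \<in> I \<and> i - 1 < m. f m) = ?p"
  proof -
    have "(\<Sum>m | m \<in> I \<and> i - 1 < m. f m) = (\<Sum>m\<in>{i}. f m)"
    proof (rule sum.mono_neutral_right)
      show "\<forall>m\<in>{m. m \<in> I \<and> i - 1 < m} - {i}. f m = 0"
        by (clarsimp simp: f_def R.L_upper)
    qed (use i finite_I in simp_all)
    then show ?thesis by (simp add: f_def R.N_diag K)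
  qed
  have down_i: "(\<Sum>r | r \<in> I \<and> r < - (i - 1). t r) = ?m"
  proof -
    have "(\<Sum>r | r \<in> I \<and> r < - (i - 1). t r) = (\<Sum>r\<in>{- i}. t r)"
    proof (rule sum.mono_neutral_right)
      show "\<forall>r\<in>{r. r \<in> I \<and> r < - (i - 1)} - {- i}. t r = 0"
        by (clarsimp simp: t_def R.L_upper)
    qed (use i finite_I in simp_all)
    then show ?thesis by (simp add: t_def R.N_diag K)
  qed
  have Mii: "app (R.M i i) v - (\<Sum>m | m \<in> I \<and> - (i - 1) \<le> m. f m) - ?xx \<in> W"
  proof -
    have "{m. m \<in> I \<and> - i \<le> m} = insert (- i) {m. m \<in> I \<and> - (i - 1) \<le> m}" using i by auto
    then have e: "(\<Sum>m | m \<in> I \<and> - i \<le> m. f m) = f (- i) + (\<Sum>m | m \<in> I \<and> - (i - 1) \<le> m. f m)"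
      using finite_I by simp
    have "app (R.M i i) v - (\<Sum>m | m \<in> I \<and> - i \<le> m. f m) \<in> W"
      unfolding app_M f_def
    proof (rule sum_split_mod)
      fix a assume "a \<in> I" "\<not> - i \<le> a"
      then show "app (R.N i a) (app (L a i) v) \<in> W"
        using kill_L[OF v, of a i] i graded_opD(3)[OF graded_op_N stable_W] by simp
    qed
    moreover have "f (- i) - ?xx \<in> W"
      using N_odd_cartan[OF cartan_top[OF v, of i] less.prems] by (simp add: f_def xx)
    ultimately show ?thesis using W_add[of "app (R.M i i) v - (\<Sum>m | m \<in> I \<and> - i \<le> m. f m)" "f (- i) - ?xx"]
      by (simp add: e algebra_simps)
  qed
  have Mm: "app (R.M (- i) (- i)) v - ?m \<in> W"
  proof -
    have "(\<Sum>m\<in>I. app (R.N (- i) m) (app (L m (- i)) v)) - app (R.N (- i) (- i)) (app (L (- i) (- i)) v) \<in> W"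
    proof (rule sum_mod[OF finite_I i(2)])
      fix b assume b: "b \<in> I" "b \<noteq> - i"
      show "app (R.N (- i) b) (app (L b (- i)) v) \<in> W"
      proof (cases "b < - i")
        case True
        then show ?thesis using kill_L[OF v, of b "- i"] b i graded_opD(3)[OF graded_op_N stable_W] by simp
      next
        case False
        then show ?thesis using b W_0 by (simp add: R.L_upper)
      qed
    qed
    then show ?thesis by (simp add: app_M R.N_diag K)
  qed
  have Lm: "app (LN (- i)) v - (\<Sum>r | r \<in> I \<and> r \<le> i - 1. t r) - ?xx \<in> W"
  proof -
    have "{m. m \<in> I \<and> m \<le> i} = insert i {m. m \<in> I \<and> m \<le> i - 1}" using i by auto
    then have e: "(\<Sum>m | m \<in> I \<and> m \<le> i. t m) = t i + (\<Sum>m | m \<in> I \<and> m \<le> i - 1. t m)"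
      using finite_I by simp
    have "app (LN (- i)) v - (\<Sum>m | m \<in> I \<and> m \<le> i. t m) \<in> W"
      unfolding app_LN t_def
    proof (rule sum_split_mod)
      fix a assume "a \<in> I" "\<not> a \<le> i"
      then show "app (L (- i) a) (app (R.N a (- i)) v) \<in> W"
        using kill_N[OF v, of a "- i"] i stable_L[OF stable_W] by simp
    qed
    moreover have "t i - ?xx \<in> W"
      using stable_L[OF stable_W N_odd_cartan[OF v less.prems], of "- i" i] by (simp add: t_def xx)
    ultimately show ?thesis using W_add[of "app (LN (- i)) v - (\<Sum>m | m \<in> I \<and> m \<le> i. t m)" "t i - ?xx"]
      by (simp add: e algebra_simps)
  qed
  have Li: "app (LN i) v - ?p \<in> W"
  proof -
    have "(\<Sum>a\<in>I. app (L i a) (app (R.N a i) v)) - app (L i i) (app (R.N i i) v) \<in> W"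
    proof (rule sum_mod[OF finite_I i(1)])
      fix b assume b: "b \<in> I" "b \<noteq> i"
      show "app (L i b) (app (R.N b i) v) \<in> W"
      proof (cases "i < b")
        case True
        then show ?thesis using kill_N[OF v, of b i] b i stable_L[OF stable_W] by simp
      next
        case False
        then show ?thesis using b W_0 by (simp add: R.L_upper)
      qed
    qed
    then show ?thesis by (simp add: app_LN R.N_diag K)
  qed
  have D: "(Dq \<mu> i) *s v = ?p - ?m"
    by (simp add: Dq_def scale_left_diff_distrib)
  have c: "(qq ^ 2 - 1) / (1 + qq ^ 2) * Dq \<mu> i = (qq ^ 2 * del \<mu> i - del \<mu> i) / 2"
  proof -
    have "(qq ^ 2 - 1) * x = (qq ^ 2 * (2 * x) - 2 * x) / 2" for x :: Cq
      using two_nonzero by (simp add: field_simps)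
    from this[of "Dq \<mu> i / (1 + qq ^ 2)"] show ?thesis by (simp add: del_def)
  qed
  have A: "app (LN i) v - app (LN (- i)) v - (?p - ?m - ?xx - ?s) \<in> W"
  proof -
    have "(app (LN i) v - ?p) - (app (LN (- i)) v - (\<Sum>r | r \<in> I \<and> r \<le> i - 1. t r) - ?xx)
      - ((\<Sum>r | r \<in> I \<and> r \<le> i - 1. t r) - ?m - ?s) \<in> W"
      using Li Lm down unfolding down_i by (rule W_diff[OF W_diff])
    then show ?thesis by (simp add: algebra_simps)
  qed
  have B: "app (R.M i i) v - app (R.M (- i) (- i)) v - (?p - ?m + ?xx + ?s) \<in> W"
  proof -
    have "(app (R.M i i) v - (\<Sum>m | m \<in> I \<and> - (i - 1) \<le> m. f m) - ?xx)
      + ((\<Sum>m | m \<in> I \<and> - (i - 1) \<le> m. f m) - ?p - ?s) - (app (R.M (- i) (- i)) v - ?m) \<in> W"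
      using Mii up Mm unfolding up_i by (rule W_diff[OF W_add])
    then show ?thesis by (simp add: algebra_simps)
  qed
  have h: "(1 + a) / 2 * x - (a * x - x) / 2 = x" "(1 + a) / 2 * x + (a * x - x) / 2 = a * x" for a x :: Cq
    using two_nonzero four_nonzero by (simp_all add: field_simps)
  have "?p - ?m - ?xx - ?s = (Dq \<mu> i - (qq ^ 2 * del \<mu> i - del \<mu> i) / 2 - (qq ^ 2 - 1) * Sg \<mu> (i - 1)) *s v"
    by (simp only: D[symmetric] c scale_left_diff_distrib)
  moreover have "?p - ?m + ?xx + ?s = (Dq \<mu> i + (qq ^ 2 * del \<mu> i - del \<mu> i) / 2 + (qq ^ 2 - 1) * Sg \<mu> (i - 1)) *s v"
    by (simp only: D[symmetric] c scale_left_distrib)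
  ultimately have "?p - ?m - ?xx - ?s = (del \<mu> i - (qq ^ 2 - 1) * Sg \<mu> (i - 1)) *s v"
    "?p - ?m + ?xx + ?s = (qq ^ 2 * del \<mu> i + (qq ^ 2 - 1) * Sg \<mu> (i - 1)) *s v"
    by (simp_all only: del_expand h)
  then show ?case using A B by simp
qed

text \<open>The weights make the partial sums over \<open>|i| \<le> k\<close> collapse:
  \<open>q^(2k+2) (q^2 del + (q^2 - 1) Sg) + q^(2k+2) Sg\<close> is
  \<open>q^(2k+4) (Sg + del)\<close>, with \<open>del\<close> at \<open>k + 1\<close> and
  \<open>Sg\<close> at \<open>k\<close>.\<close>

theorem C_eigenvalue:
  assumes v: "v \<in> V \<inter> wsp \<mu>"
  shows "app R.C v - (qq ^ (2 * n + 2) * Sg \<mu> (int n)) *s v \<in> W"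
proof -
  define T where "T k = (\<Sum>i | i \<in> I \<and> \<bar>i\<bar> \<le> int k. app (R.wgt i) (app (R.M i i) v))" for k
  have T: "k \<le> n \<Longrightarrow> T k - (qq ^ (2 * k + 2) * Sg \<mu> (int k)) *s v \<in> W" for k
  proof (induction k)
    case 0
    have "{i. i \<in> I \<and> \<bar>i\<bar> \<le> int 0} = {}" by (auto simp: I_iff)
    then have "T 0 = 0" unfolding T_def by (simp only: sum.empty)
    then show ?case using W_0 by (simp add: Sg_0)
  next
    case (Suc k)
    let ?i = "int (Suc k)"
    have "{i. i \<in> I \<and> \<bar>i\<bar> \<le> ?i} = insert ?i (insert (- ?i) {i. i \<in> I \<and> \<bar>i\<bar> \<le> int k})"
      using Suc.prems by (auto simp: I_iff)
    then have "T (Suc k) = app (R.wgt ?i) (app (R.M ?i ?i) v) + (app (R.wgt (- ?i)) (app (R.M (- ?i) (- ?i)) v) + T k)"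
      using finite_I by (simp add: T_def)
    moreover have "app (R.wgt ?i) x = qq ^ (2 * Suc k) *s x" "app (R.wgt (- ?i)) x = - (qq ^ (2 * Suc k) *s x)" for x
    proof -
      have "app (sc qq ^ m) x = qq ^ m *s x" for m
        by (induction m arbitrary: x) simp_all
      then show "app (R.wgt ?i) x = qq ^ (2 * Suc k) *s x" "app (R.wgt (- ?i)) x = - (qq ^ (2 * Suc k) *s x)"
        unfolding R.wgt_def by (simp_all add: nat_add_distrib)
    qed
    ultimately have Ts: "T (Suc k) = qq ^ (2 * Suc k) *s (app (R.M ?i ?i) v - app (R.M (- ?i) (- ?i)) v) + T k"
      by (simp add: scale_right_diff_distrib algebra_simps)
    let ?c = "qq ^ 2 * del \<mu> ?i + (qq ^ 2 - 1) * Sg \<mu> (int k)"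
    have d: "app (R.M ?i ?i) v - app (R.M (- ?i) (- ?i)) v - ?c *s v \<in> W"
      using diag_values[OF v, of ?i] Suc.prems by simp
    have "qq ^ (2 * Suc k) *s (app (R.M ?i ?i) v - app (R.M (- ?i) (- ?i)) v - ?c *s v)
        + (T k - (qq ^ (2 * k + 2) * Sg \<mu> (int k)) *s v) \<in> W"
      using Suc by (intro W_add W_scale d) simp_all
    moreover have "qq ^ (2 * Suc k + 2) * Sg \<mu> ?i = qq ^ (2 * Suc k) * ?c + qq ^ (2 * k + 2) * Sg \<mu> (int k)"
      using Sg_step[of ?i \<mu>] by (simp add: algebra_simps power2_eq_square)
    ultimately show ?case
      unfolding Ts by (simp add: scale_right_diff_distrib scale_left_distrib algebra_simps)
  qed
  have "app R.C v = T n"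
    unfolding T_def R.C_def app_sum by (rule sum.cong) (auto simp: I_iff)
  then show ?thesis using T[of n] by simp
qed

end

section \<open>Separation of the eigenvalues\<close>

lemma qq_power: "qq ^ k = Fraction_Field.Fract (monom 1 k) 1"
proof (induction k)
  case 0
  then show ?case by (simp add: One_fract_def)
next
  case (Suc k)
  have "qq = Fraction_Field.Fract (monom 1 1) 1"
    by (simp add: qq_def monom_altdef)
  then have "qq ^ Suc k = Fraction_Field.Fract (monom 1 1) 1 * Fraction_Field.Fract (monom 1 k) 1"
    by (metis Suc power_Suc)
  also have "\<dots> = Fraction_Field.Fract (monom 1 (Suc k)) 1"
    by (simp add: mult_monom)
  finally show ?case .
qed

lemma qq_powi_inj:
  assumes "qq powi a = qq powi b"
  shows "a = b"
proof -
  have *: "a = b" if "a \<le> b" "qq powi a = qq powi b" for a b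
  proof -
    have "qq ^ nat (b - a) = qq powi (b - a)"
      using that by (simp add: power_int_def)
    also have "\<dots> = 1"
      using that qq_nonzero by (simp add: power_int_diff)
    finally have "Fraction_Field.Fract (monom 1 (nat (b - a))) 1 = Fraction_Field.Fract (monom 1 0) (1 :: complex poly)"
      unfolding qq_power by (simp add: One_fract_def)
    then have "monom (1::complex) (nat (b - a)) = monom 1 0"
      by (simp add: eq_fract)
    then have "nat (b - a) = 0"
      by (metis degree_monom_eq zero_neq_one)
    then show "a = b" using that by simp
  qed
  show ?thesis
    using *[of a b] *[of b a] assms by (metis linear)
qed

lemma Fract_sum: "(\<Sum>j\<in>A. Fraction_Field.Fract (f j) 1) = Fraction_Field.Fract (sum f A) (1 :: complex poly)"
  by (induction A rule: infinite_finite_induct) (simp_all add: Zero_fract_def)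

text \<open>Since \<open>q\<close> is transcendental, the parts of a partition are the exponents that occur.\<close>

lemma card_parts_eq:
  fixes \<mu> \<nu> :: "int \<Rightarrow> int"
  assumes "finite A" "\<And>j. j \<in> A \<Longrightarrow> 0 \<le> \<mu> j" "\<And>j. j \<in> A \<Longrightarrow> 0 \<le> \<nu> j"
    and eq: "(\<Sum>j\<in>A. qq powi (2 * \<mu> j) - qq powi (- 2 * \<mu> j)) = (\<Sum>j\<in>A. qq powi (2 * \<nu> j) - qq powi (- 2 * \<nu> j))"
    and "0 < m"
  shows "card {j\<in>A. \<mu> j = m} = card {j\<in>A. \<nu> j = m}"
proof -
  define K where "K = Max (insert 0 ((nat \<circ> \<mu>) ` A \<union> (nat \<circ> \<nu>) ` A))"
  have K: "nat (\<mu> j) \<le> K" "nat (\<nu> j) \<le> K" if "j \<in> A" for j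
    unfolding K_def using assms(1) that by (auto intro!: Max_ge)
  \<comment> \<open>Multiplication by \<open>q^(2K)\<close>, with \<open>K\<close> a bound for all
    parts, clears the negative exponents. For \<open>m > 0\<close> the degree \<open>2K + 2m\<close>
    is reached only by positive exponents, so its coefficient counts the parts equal to
    \<open>m\<close>; parts equal to 0 cancel.\<close>
  define P where "P \<mu> = (\<Sum>j\<in>A. monom (1::complex) (2 * K + 2 * nat (\<mu> j)) - monom 1 (2 * K - 2 * nat (\<mu> j)))" for \<mu> :: "int \<Rightarrow> int"
  have shift: "qq ^ (2 * K) * (\<Sum>j\<in>A. qq powi (2 * \<mu> j) - qq powi (- 2 * \<mu> j)) = Fraction_Field.Fract (P \<mu>) 1"
    if bnd: "\<And>j. j \<in> A \<Longrightarrow> 0 \<le> \<mu> j \<and> nat (\<mu> j) \<le> K" for \<mu> :: "int \<Rightarrow> int"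
  proof -
    have "qq ^ (2 * K) * (qq powi (2 * \<mu> j) - qq powi (- 2 * \<mu> j))
        = Fraction_Field.Fract (monom 1 (2 * K + 2 * nat (\<mu> j)) - monom 1 (2 * K - 2 * nat (\<mu> j))) 1" if jA: "j \<in> A" for j
    proof -
      obtain p where p: "\<mu> j = int p" "p \<le> K" using bnd[OF jA] by (metis int_nat_eq)
      have 1: "qq powi (2 * \<mu> j) = qq ^ (2 * p)" "qq powi (- 2 * \<mu> j) = inverse (qq ^ (2 * p))"
        by (simp_all add: p power_int_def nat_mult_distrib power_inverse)
      have "qq ^ (2 * K) * inverse (qq ^ (2 * p)) = qq ^ (2 * K - 2 * p)"
        using p(2) qq_nonzero by (simp add: power_diff field_simps)
      then have "qq ^ (2 * K) * (qq powi (2 * \<mu> j) - qq powi (- 2 * \<mu> j)) = qq ^ (2 * K + 2 * p) - qq ^ (2 * K - 2 * p)"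
        unfolding 1 by (simp add: right_diff_distrib power_add)
      then show ?thesis unfolding qq_power using p by simp
    qed
    then show ?thesis unfolding sum_distrib_left P_def by (simp add: Fract_sum)
  qed
  have "Fraction_Field.Fract (P \<mu>) 1 = Fraction_Field.Fract (P \<nu>) 1"
    using shift[of \<mu>] shift[of \<nu>] eq assms(2,3) K by simp
  then have PP: "P \<mu> = P \<nu>" by (simp add: eq_fract)
  have "coeff (P \<mu>) (2 * K + 2 * nat m) = of_nat (card {j\<in>A. \<mu> j = m})"
    if "\<And>j. j \<in> A \<Longrightarrow> 0 \<le> \<mu> j \<and> nat (\<mu> j) \<le> K" for \<mu> :: "int \<Rightarrow> int"
  proof -
    have "coeff (P \<mu>) (2 * K + 2 * nat m) = (\<Sum>j\<in>A. if \<mu> j = m then 1 else 0)"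
      unfolding P_def coeff_sum using that \<open>0 < m\<close>
      by (intro sum.cong refl) (force simp: eq_nat_nat_iff)
    then show ?thesis using assms(1) by (simp add: sum.If_cases Int_def conj_commute)
  qed
  from this[of \<mu>] this[of \<nu>] show ?thesis
    using PP assms(2,3) K by simp
qed

text \<open>For a decreasing sequence the sets where the value is at least \<open>m\<close> are
  initial segments. Two such sets are nested, so equal cardinality makes them equal; positive
  \<open>m\<close> suffice because all values are nonnegative.\<close>

lemma dominant_eqI:
  fixes \<mu> \<nu> :: "int \<Rightarrow> int"
  assumes "\<And>j. j \<in> {1..N} \<Longrightarrow> 0 \<le> \<mu> j" "\<And>j. j \<in> {1..N} \<Longrightarrow> 0 \<le> \<nu> j"
    and dec: "\<And>a b. 1 \<le> a \<Longrightarrow> a < b \<Longrightarrow> b \<le> N \<Longrightarrow> \<mu> b \<le> \<mu> a" "\<And>a b. 1 \<le> a \<Longrightarrow> a < b \<Longrightarrow> b \<le> N \<Longrightarrow> \<nu> b \<le> \<nu> a"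
    and card: "\<And>m. 0 < m \<Longrightarrow> card {j\<in>{1..N}. \<mu> j = m} = card {j\<in>{1..N}. \<nu> j = m}"
    and j: "j \<in> {1..N}"
  shows "\<mu> j = \<nu> j"
proof -
  define U where "U \<mu> m = {j\<in>{1..N}. m \<le> \<mu> j}" for \<mu> :: "int \<Rightarrow> int" and m
  have fin: "finite (U \<mu> m)" for \<mu> m unfolding U_def by (rule finite_subset[of _ "{1..N}"]) auto
  obtain K where K: "\<And>j. j \<in> {1..N} \<Longrightarrow> \<mu> j \<le> K \<and> \<nu> j \<le> K"
  proof
    show "\<mu> j \<le> Max (\<mu> ` {1..N} \<union> \<nu> ` {1..N}) \<and> \<nu> j \<le> Max (\<mu> ` {1..N} \<union> \<nu> ` {1..N})" if "j \<in> {1..N}" for j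
      using that by (auto intro!: Max_ge)
  qed
  have cU: "card (U \<mu>' m) = (\<Sum>k\<in>{m..K}. card {j\<in>{1..N}. \<mu>' j = k})" if "\<And>j. j \<in> {1..N} \<Longrightarrow> \<mu>' j \<le> K" for \<mu>' :: "int \<Rightarrow> int" and m
  proof -
    have "U \<mu>' m = (\<Union>k\<in>{m..K}. {j\<in>{1..N}. \<mu>' j = k})" using that by (auto simp: U_def)
    moreover have "finite {j\<in>{1..N}. \<mu>' j = k}" for k
      by (rule finite_subset[of _ "{1..N}"]) auto
    ultimately show ?thesis by (simp only:) (rule card_UN_disjoint, simp, blast, blast)
  qed
  have UU: "U \<mu> m = U \<nu> m" if "0 < m" for m
  proof -
    have c: "card (U \<mu> m) = card (U \<nu> m)"
    proof -
      have "card (U \<mu> m) = (\<Sum>k\<in>{m..K}. card {j\<in>{1..N}. \<mu> j = k})"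
        using K by (intro cU) blast
      also have "\<dots> = (\<Sum>k\<in>{m..K}. card {j\<in>{1..N}. \<nu> j = k})"
        using that by (intro sum.cong refl card) simp
      also have "\<dots> = card (U \<nu> m)"
        using K by (intro cU[symmetric]) blast
      finally show ?thesis .
    qed
    have "U \<mu> m \<subseteq> U \<nu> m \<or> U \<nu> m \<subseteq> U \<mu> m"
    proof (rule ccontr)
      assume "\<not> ?thesis"
      then obtain a b where ab: "a \<in> U \<mu> m" "a \<notin> U \<nu> m" "b \<in> U \<nu> m" "b \<notin> U \<mu> m" by blast
      then have "a \<noteq> b" by auto
      then consider "a < b" | "b < a" by linarith
      then show False
        using ab dec(1)[of b a] dec(2)[of a b] by cases (auto simp: U_def)
    qed
    then show ?thesis using c fin card_subset_eq by metis
  qed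
  have "m \<le> \<mu> j \<longleftrightarrow> m \<le> \<nu> j" if "0 < m" for m
    using UU[OF that] j by (auto simp: U_def set_eq_iff)
  from this[of "\<mu> j"] this[of "\<nu> j"] show ?thesis
    using assms(1,2) j by fastforce
qed

section \<open>Weight modules\<close>

lemma (in vector_space) eigen_sum_mem:
  fixes T :: "'j \<Rightarrow> 'b \<Rightarrow> 'b" and f :: "'i \<Rightarrow> 'b"
  assumes "finite F" "subspace U"
    and T_add: "\<And>t x y. t \<in> J \<Longrightarrow> T t (x + y) = T t x + T t y"
    and T_scale: "\<And>t c x. t \<in> J \<Longrightarrow> T t (c *s x) = c *s T t x"
    and T_U: "\<And>t x. t \<in> J \<Longrightarrow> x \<in> U \<Longrightarrow> T t x \<in> U"
    and ev: "\<And>t a. t \<in> J \<Longrightarrow> a \<in> F \<Longrightarrow> T t (f a) = ev t a *s f a"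
    and sep: "\<And>a b. a \<in> F \<Longrightarrow> b \<in> F \<Longrightarrow> a \<noteq> b \<Longrightarrow> \<exists>t\<in>J. ev t a \<noteq> ev t b"
    and "sum f F \<in> U" "a \<in> F"
  shows "f a \<in> U"
  using assms(1) ev sep assms(8,9)
proof (induction F arbitrary: f a rule: finite_induct)
  case (insert x F)
  have T_sum: "T t (sum g A) = (\<Sum>a\<in>A. T t (g a))" if "t \<in> J" for t and g :: "'i \<Rightarrow> 'b" and A
  proof (induction A rule: infinite_finite_induct)
    case (infinite A)
    then show ?case using T_scale[OF that, of 0 0] by simp
  next
    case empty
    then show ?case using T_scale[OF that, of 0 0] by simp
  qed (simp add: T_add[OF that])
  have F: "f b \<in> U" if b: "b \<in> F" for b
  proof -
    have "b \<noteq> x" using b insert.hyps by blast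
    then obtain t where t: "t \<in> J" "ev t b \<noteq> ev t x" using insert.prems(2)[of b x] b by blast
    define g where "g a = (ev t a - ev t x) *s f a" for a
    have "T t (sum f (insert x F)) - ev t x *s sum f (insert x F) \<in> U"
      using assms(2) t insert.prems(3) T_U by (intro subspace_diff subspace_scale) auto
    moreover have "T t (sum f (insert x F)) - ev t x *s sum f (insert x F) = sum g F"
    proof -
      have "T t (sum f (insert x F)) = (\<Sum>a\<in>insert x F. ev t a *s f a)"
        unfolding T_sum[OF t(1)] by (rule sum.cong[OF refl insert.prems(1)[OF t(1)]])
      then have "T t (sum f (insert x F)) - ev t x *s sum f (insert x F) = (\<Sum>a\<in>insert x F. g a)"
        unfolding g_def scale_sum_right scale_left_diff_distrib sum_subtractf by (rule arg_cong2[of _ _ _ _ "(-)", OF _ refl])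
      then show ?thesis using insert.hyps by (simp add: g_def)
    qed
    ultimately have "sum g F \<in> U" by simp
    then have "g b \<in> U"
    proof (rule insert.IH[of g b, rotated 2])
      show "T s (g a) = ev s a *s g a" if "s \<in> J" "a \<in> F" for s a
        using insert.prems(1)[of s a] that by (simp add: g_def T_scale scale_left_commute)
      show "\<exists>t\<in>J. ev t a \<noteq> ev t c" if "a \<in> F" "c \<in> F" "a \<noteq> c" for a c
        using insert.prems(2)[of a c] that by blast
    qed (use b in simp_all)
    then have "inverse (ev t b - ev t x) *s g b \<in> U" using assms(2) subspace_scale by blast
    then show ?thesis using t by (simp add: g_def)
  qed
  show ?case
  proof (cases "a = x")
    case True
    have "f x = sum f (insert x F) - sum f F" using insert.hyps by simp
    moreover have "sum f F \<in> U" using F assms(2) by (intro subspace_sum)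
    ultimately show ?thesis using True insert.prems(3) assms(2) subspace_diff by metis
  qed (use F insert.prems(4) in blast)
qed simp

text \<open>The grading is carried by an involution \<open>sg\<close>, to be 1 on even and -1 on odd
  vectors, so that a graded submodule is a stable subspace closed under one more operator.
  \<open>\<Omega>\<close> is a finite set of weights whose weight spaces span the module, and
  \<open>odd_zero\<close> is condition (ii).\<close>

locale queer_module = queer_ops scale n L
  for scale :: "Cq \<Rightarrow> 'v::ab_group_add \<Rightarrow> 'v" (infixr \<open>*s\<close> 75) and n L +
  fixes sg :: "'v endo" and \<Omega> :: "(int \<Rightarrow> int) set"
  assumes sg_scale: "app sg (c *s v) = c *s app sg v"
    and sg_sg: "app sg (app sg v) = v"
    and sg_L: "i \<in> indices n \<Longrightarrow> j \<in> indices n \<Longrightarrow> app sg (app (L i j) v) = app (pm (odd_pair i j)) (app (L i j) (app sg v))"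
    and finite_dim: "\<exists>B. finite B \<and> span B = UNIV"
    and finite_\<Omega>: "finite \<Omega>" and \<Omega>_lattice: "\<Omega> \<subseteq> lattice_P_ge0 n"
    and weight_decomp: "\<exists>f. (\<forall>\<mu>\<in>\<Omega>. f \<mu> \<in> wsp \<mu>) \<and> v = sum f \<Omega>"
    and odd_zero: "\<mu> \<in> \<Omega> \<Longrightarrow> 1 \<le> i \<Longrightarrow> i \<le> int n \<Longrightarrow> \<mu> i = 0 \<Longrightarrow> v \<in> wsp \<mu> \<Longrightarrow> app (L (- i) i) v = 0"
begin

lemma \<Omega>_eqI: "\<mu> \<in> \<Omega> \<Longrightarrow> \<nu> \<in> \<Omega> \<Longrightarrow> (\<And>i. 1 \<le> i \<Longrightarrow> i \<le> int n \<Longrightarrow> \<mu> i = \<nu> i) \<Longrightarrow> \<mu> = \<nu>"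
proof (rule ext)
  fix i assume a: "\<mu> \<in> \<Omega>" "\<nu> \<in> \<Omega>" "\<And>i. 1 \<le> i \<Longrightarrow> i \<le> int n \<Longrightarrow> \<mu> i = \<nu> i"
  show "\<mu> i = \<nu> i"
  proof (cases "i \<in> {1..int n}")
    case False
    have "\<mu> i = 0" "\<nu> i = 0"
      using False a(1,2) \<Omega>_lattice unfolding lattice_P_ge0_def lattice_P_def by blast+
    then show ?thesis by simp
  qed (use a(3) in simp)
qed

lemma \<Omega>_nonneg: "\<mu> \<in> \<Omega> \<Longrightarrow> 1 \<le> i \<Longrightarrow> i \<le> int n \<Longrightarrow> 0 \<le> \<mu> i"
  using \<Omega>_lattice[THEN subsetD, of \<mu>] by (simp add: lattice_P_ge0_def)

lemma wsp_sum_mem: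
  assumes "finite F" "subspace U" "\<And>i x. x \<in> U \<Longrightarrow> app (L i i) x \<in> U"
    and "\<And>\<mu>. \<mu> \<in> F \<Longrightarrow> f \<mu> \<in> wsp \<mu>"
    and "\<And>\<mu> \<nu>. \<mu> \<in> F \<Longrightarrow> \<nu> \<in> F \<Longrightarrow> \<mu> \<noteq> \<nu> \<Longrightarrow> \<exists>i\<in>{1..int n}. \<mu> i \<noteq> \<nu> i"
    and "sum f F \<in> U" "\<mu> \<in> F"
  shows "f \<mu> \<in> U"
proof (rule eigen_sum_mem[where f = f and a = \<mu> and T = "\<lambda>i. app (L i i)" and J = "{1..int n}" and ev = "\<lambda>i \<mu>. qq powi \<mu> i", OF assms(1,2)])
  show "\<exists>t\<in>{1..int n}. qq powi a t \<noteq> qq powi b t" if "a \<in> F" "b \<in> F" "a \<noteq> b" for a b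
    using assms(5)[OF that] qq_powi_inj by blast
qed (use assms wspD in \<open>auto simp: app_add_right L_scale\<close>)

text \<open>Otherwise \<open>v\<close> and its decomposition over \<open>\<Omega>\<close> would give
  a relation between distinct weight spaces. Agreement is claimed on \<open>{1..int n}\<close> only,
  because \<open>wsp\<close> sees no other coordinates.\<close>

lemma wsp_nonzero:
  assumes "v \<in> wsp \<nu>" "v \<noteq> 0"
  shows "\<exists>\<mu>\<in>\<Omega>. \<forall>i\<in>{1..int n}. \<mu> i = \<nu> i"
proof (rule ccontr)
  assume ne: "\<not> ?thesis"
  then have nu: "\<nu> \<notin> \<Omega>" by blast
  obtain f where f: "\<forall>\<mu>\<in>\<Omega>. f \<mu> \<in> wsp \<mu>" "v = sum f \<Omega>" using weight_decomp by blast
  define g where "g \<mu> = (if \<mu> = \<nu> then - v else f \<mu>)" for \<mu>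
  have "g \<nu> \<in> {0}"
  proof (rule wsp_sum_mem[of "insert \<nu> \<Omega>" "{0}" g])
    have "sum g \<Omega> = sum f \<Omega>" using nu by (intro sum.cong) (auto simp: g_def)
    then show "sum g (insert \<nu> \<Omega>) \<in> {0}" using nu finite_\<Omega> f by (simp add: g_def)
    show "g \<mu> \<in> wsp \<mu>" if "\<mu> \<in> insert \<nu> \<Omega>" for \<mu>
      using that f assms(1) subspace_neg[OF subspace_wsp] by (auto simp: g_def)
    show "\<exists>i\<in>{1..int n}. a i \<noteq> b i" if "a \<in> insert \<nu> \<Omega>" "b \<in> insert \<nu> \<Omega>" "a \<noteq> b" for a b
      using that ne \<Omega>_eqI[of a b] by (metis atLeastAtMost_iff insertE)
  qed (use finite_\<Omega> in auto)
  then show False using assms(2) by (simp add: g_def)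
qed

lemma weight_component:
  assumes "stable W" "\<forall>\<mu>\<in>\<Omega>. f \<mu> \<in> wsp \<mu>" "sum f \<Omega> \<in> W" "\<mu> \<in> \<Omega>"
  shows "f \<mu> \<in> W"
proof (rule wsp_sum_mem[of \<Omega> W f])
  show "\<exists>i\<in>{1..int n}. a i \<noteq> b i" if "a \<in> \<Omega>" "b \<in> \<Omega>" "a \<noteq> b" for a b
    using that \<Omega>_eqI[of a b] by (meson atLeastAtMost_iff)
qed (use assms finite_\<Omega> stable_L stable_subspace in auto)

text \<open>Filtration by height; \<open>wsp_low\<close> and \<open>low_wsp\<close> compare it with
  single weight spaces.\<close>

definition low :: "int \<Rightarrow> 'v set" where
  "low h = {v. \<exists>f. (\<forall>\<mu>\<in>\<Omega>. f \<mu> \<in> wsp \<mu> \<and> (f \<mu> \<noteq> 0 \<longrightarrow> ht \<mu> < h)) \<and> v = sum f \<Omega>}"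

lemma subspace_low: "subspace (low h)"
  unfolding subspace_def
proof (intro conjI ballI allI)
  show "0 \<in> low h"
    unfolding low_def using subspace_0[OF subspace_wsp] by (auto intro!: exI[of _ "\<lambda>_. 0"])
next
  fix x y assume "x \<in> low h" "y \<in> low h"
  then obtain f g where "\<forall>\<mu>\<in>\<Omega>. f \<mu> \<in> wsp \<mu> \<and> (f \<mu> \<noteq> 0 \<longrightarrow> ht \<mu> < h)" "x = sum f \<Omega>"
    "\<forall>\<mu>\<in>\<Omega>. g \<mu> \<in> wsp \<mu> \<and> (g \<mu> \<noteq> 0 \<longrightarrow> ht \<mu> < h)" "y = sum g \<Omega>"
    unfolding low_def by blast
  then show "x + y \<in> low h"
    unfolding low_def
    by (intro CollectI exI[of _ "\<lambda>\<mu>. f \<mu> + g \<mu>"]) (auto simp: sum.distrib subspace_add[OF subspace_wsp])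
next
  fix c x assume "x \<in> low h"
  then obtain f where "\<forall>\<mu>\<in>\<Omega>. f \<mu> \<in> wsp \<mu> \<and> (f \<mu> \<noteq> 0 \<longrightarrow> ht \<mu> < h)" "x = sum f \<Omega>"
    unfolding low_def by blast
  then show "c *s x \<in> low h"
    unfolding low_def
    by (intro CollectI exI[of _ "\<lambda>\<mu>. c *s f \<mu>"]) (auto simp: scale_sum_right subspace_scale[OF subspace_wsp])
qed

lemma ht_cong: "(\<And>i. i \<in> {1..int n} \<Longrightarrow> \<mu> i = \<nu> i) \<Longrightarrow> ht \<mu> = ht \<nu>"
  by (simp add: ht_def)

lemma wsp_low:
  assumes "v \<in> wsp \<nu>" "ht \<nu> < h"
  shows "v \<in> low h"
proof (cases "v = 0")
  case True
  then show ?thesis using subspace_0[OF subspace_low] by simp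
next
  case False
  then obtain \<mu> where \<mu>: "\<mu> \<in> \<Omega>" "\<forall>i\<in>{1..int n}. \<mu> i = \<nu> i" using wsp_nonzero assms by blast
  then have "wsp \<mu> = wsp \<nu>" "ht \<mu> = ht \<nu>" using wsp_cong[of \<mu> \<nu>] ht_cong[of \<mu> \<nu>] by auto
  then show ?thesis
    unfolding low_def using \<mu>(1) assms finite_\<Omega> subspace_0[OF subspace_wsp]
    by (intro CollectI exI[of _ "\<lambda>\<mu>'. if \<mu>' = \<mu> then v else 0"]) auto
qed

lemma low_wsp:
  assumes "v \<in> low h" "v \<in> wsp \<nu>" "h \<le> ht \<nu>"
  shows "v = 0"
proof (rule ccontr)
  assume "v \<noteq> 0"
  then obtain \<mu> where \<mu>: "\<mu> \<in> \<Omega>" "\<forall>i\<in>{1..int n}. \<mu> i = \<nu> i" using wsp_nonzero assms by blast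
  then have e: "wsp \<mu> = wsp \<nu>" "ht \<mu> = ht \<nu>" using wsp_cong[of \<mu> \<nu>] ht_cong[of \<mu> \<nu>] by auto
  obtain f where f: "\<forall>\<mu>\<in>\<Omega>. f \<mu> \<in> wsp \<mu> \<and> (f \<mu> \<noteq> 0 \<longrightarrow> ht \<mu> < h)" "v = sum f \<Omega>"
    using assms(1) unfolding low_def by blast
  have f\<mu>: "f \<mu> = 0" using f(1) \<mu>(1) e assms(3) by force
  define g where "g \<mu>' = (if \<mu>' = \<mu> then - v else f \<mu>')" for \<mu>'
  have "sum g \<Omega> = g \<mu> + sum g (\<Omega> - {\<mu>})" using finite_\<Omega> \<mu>(1) by (simp add: sum.remove)
  also have "sum g (\<Omega> - {\<mu>}) = sum f (\<Omega> - {\<mu>})" by (rule sum.cong) (auto simp: g_def)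
  also have "\<dots> = v" using finite_\<Omega> \<mu>(1) f f\<mu> by (simp add: sum.remove)
  finally have "sum g \<Omega> = 0" by (simp add: g_def)
  have "stable {0}" by (auto simp: stable_def)
  then have "g \<mu> \<in> {0}"
  proof (rule weight_component[where f = g])
    show "\<forall>\<mu>\<in>\<Omega>. g \<mu> \<in> wsp \<mu>"
      using f(1) assms(2) e subspace_neg[OF subspace_wsp] by (simp add: g_def)
  qed (use \<open>sum g \<Omega> = 0\<close> \<mu>(1) in simp_all)
  then show False using \<open>v \<noteq> 0\<close> by (simp add: g_def)
qed

end

section \<open>Triangular decomposition\<close>

context queer_ops
begin

definition hw :: "(int \<Rightarrow> int) \<Rightarrow> 'v set" where
  "hw \<kappa> = {v \<in> wsp \<kappa>. \<forall>i\<in>I. \<forall>j\<in>I. \<bar>j\<bar> < \<bar>i\<bar> \<longrightarrow> app (L i j) v = 0}"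

text \<open>The number is the height lost on the way from the vector in \<open>X\<close>.\<close>

inductive_set words :: "'v set \<Rightarrow> (int \<times> 'v) set" for X :: "'v set" where
  base: "x \<in> X \<Longrightarrow> (0, x) \<in> words X"
| step: "(d, z) \<in> words X \<Longrightarrow> k \<in> I \<Longrightarrow> l \<in> I \<Longrightarrow> \<bar>k\<bar> \<le> \<bar>l\<bar> \<Longrightarrow> (d + \<bar>l\<bar> - \<bar>k\<bar>, app (L k l) z) \<in> words X"

definition words_span :: "'v set \<Rightarrow> int \<Rightarrow> 'v set" where
  "words_span X d = span {z. (d, z) \<in> words X}"

text \<open>Words use no raising operators. That this is nevertheless the whole submodule generated
  by \<open>X\<close> is shown in \<open>stable_gen\<close> for sets of highest weight
  vectors.\<close>

definition generated :: "'v set \<Rightarrow> 'v set" where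
  "generated X = span (snd ` words X)"

lemma subspace_Sp: "subspace (words_span X d)"
  by (simp add: words_span_def)

lemma words_nonneg: "(d, z) \<in> words X \<Longrightarrow> 0 \<le> d"
  by (induction rule: words.induct) auto

lemma words_Sp: "(d, z) \<in> words X \<Longrightarrow> z \<in> words_span X d"
  by (simp add: words_span_def span_base)

lemma app_span:
  assumes "\<And>c v. app x (c *s v) = c *s app x v" "\<And>z. z \<in> A \<Longrightarrow> app x z \<in> U" "subspace U" "v \<in> span A"
  shows "app x v \<in> U"
  using assms(4)
proof (induction rule: span_induct_alt)
  case base
  then show ?case using subspace_0[OF assms(3)] by simp
next
  case (step c y z)
  then show ?case
    using assms by (simp add: app_add_right subspace_add subspace_scale)
qed

lemma Sp_lower: "k \<in> I \<Longrightarrow> l \<in> I \<Longrightarrow> \<bar>k\<bar> \<le> \<bar>l\<bar> \<Longrightarrow> v \<in> words_span X d \<Longrightarrow> app (L k l) v \<in> words_span X (d + \<bar>l\<bar> - \<bar>k\<bar>)"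
  unfolding words_span_def[of X d]
  by (rule app_span[OF L_scale _ subspace_Sp]) (auto intro: words_Sp words.step)

lemma coeff_mem:
  assumes "subspace U" "v \<in> U"
  shows "app (qe (sc qq) (sc (inverse qq)) k) v \<in> U" "app (pm b) v \<in> U"
    "app (ob b) v \<in> U" "app (sc c) v \<in> U" "app (al a b') v \<in> U" "app (be a b') v \<in> U"
  using assms by (auto simp: qe_def pm_def ob_def al_def be_def subspace_scale subspace_neg subspace_0)

lemma qe_mem_iff:
  assumes "subspace U"
  shows "app (qe (sc qq) (sc (inverse qq)) k) v \<in> U \<longleftrightarrow> v \<in> U"
proof -
  have "c *s v \<in> U \<longleftrightarrow> v \<in> U" if "c \<noteq> 0" for c
  proof
    assume "c *s v \<in> U"
    then have "inverse c *s c *s v \<in> U" by (rule subspace_scale[OF assms])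
    then show "v \<in> U" using that by simp
  qed (rule subspace_scale[OF assms])
  then show ?thesis using qq_nonzero by (simp add: qe_def)
qed

text \<open>The exchange relation solved for \<open>L i j L k l\<close>, whose coefficient is up to
  sign a power of \<open>q\<close> and hence invertible. It serves to move a raising operator past a
  lowering one.\<close>

lemma exchange:
  assumes ijkl: "i \<in> I" "j \<in> I" "k \<in> I" "l \<in> I" and U: "subspace U"
    and "app (L k l) (app (L i j) v) \<in> U"
    and "j < l \<Longrightarrow> app (L i l) (app (L k j) v) \<in> U"
    and "- j < l \<Longrightarrow> app (L i (- l)) (app (L k (- j)) v) \<in> U"
    and "k < i \<Longrightarrow> app (L i l) (app (L k j) v) \<in> U"
    and "k < - i \<Longrightarrow> app (L (- i) l) (app (L (- k) j) v) \<in> U"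
  shows "app (L i j) (app (L k l) v) \<in> U"
proof -
  let ?q = "qe (sc qq) (sc (inverse qq))" and ?z = "sc qq - sc (inverse qq)"
  have z: "?z = sc (qq - inverse qq)" by (simp add: sc_diff)
  have t: "app (ob P * (?z * s) * (pm b * x * y)) v \<in> U"
    if "P \<Longrightarrow> app x (app y v) \<in> U" "s = al a c \<or> s = be a c" for P s b x y a c
    using that U by (cases P) (auto simp: z coeff_mem[OF U] subspace_0[OF U] subspace_scale[OF U])
  have e: "?q (\<phi> j l) * (pm (odd_pair i j \<and> k < 0) * L i j * L k l) =
      ?q (\<phi> i k) * (pm (odd_pair i j \<and> l < 0) * L k l * L i j)
    + ob (k < i) * (?z * al k i) * (pm (odd_pair k j \<and> l < 0) * L i l * L k j)
    + ob (k < - i) * (?z * be (- k) (- i)) * (pm (odd_pair (- k) j \<and> l < 0) * L (- i) l * L (- k) j)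
    - ob (j < l) * (?z * al j l) * (pm (odd_pair i l \<and> k < 0) * L i l * L k j)
    - ob (- j < l) * (?z * be j l) * (pm (odd_pair i (- l) \<and> k < 0) * L i (- l) * L k (- j))"
    using R.rll_L[OF ijkl] unfolding rll_entry_def by (simp add: algebra_simps)
  have "app (?q (\<phi> i k) * (pm (odd_pair i j \<and> l < 0) * L k l * L i j)) v \<in> U"
    using assms(6) by (simp add: coeff_mem[OF U])
  moreover have "app (ob (k < i) * (?z * al k i) * (pm (odd_pair k j \<and> l < 0) * L i l * L k j)) v \<in> U"
    by (rule t[OF assms(9)]) auto
  moreover have "app (ob (k < - i) * (?z * be (- k) (- i)) * (pm (odd_pair (- k) j \<and> l < 0) * L (- i) l * L (- k) j)) v \<in> U"
    by (rule t[OF assms(10)]) auto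
  moreover have "app (ob (j < l) * (?z * al j l) * (pm (odd_pair i l \<and> k < 0) * L i l * L k j)) v \<in> U"
    by (rule t[OF assms(7)]) auto
  moreover have "app (ob (- j < l) * (?z * be j l) * (pm (odd_pair i (- l) \<and> k < 0) * L i (- l) * L k (- j))) v \<in> U"
    by (rule t[OF assms(8)]) auto
  ultimately have "app (?q (\<phi> j l) * (pm (odd_pair i j \<and> k < 0) * L i j * L k l)) v \<in> U"
    unfolding e by (simp only: app_simps(2,3) subspace_add[OF U] subspace_diff[OF U])
  then have "app (pm (odd_pair i j \<and> k < 0)) (app (L i j) (app (L k l) v)) \<in> U"
    by (simp add: qe_mem_iff[OF U])
  then show ?thesis
    using subspace_neg[OF U] by (cases "odd_pair i j \<and> k < 0") force+
qed

lemma words_weight: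
  assumes "X \<subseteq> wsp \<kappa>" "(d, z) \<in> words X"
  shows "\<exists>\<nu>. z \<in> wsp \<nu> \<and> ht \<nu> = ht \<kappa> - d \<and> (d = 0 \<longrightarrow> \<nu> = \<kappa>)"
  using assms(2)
proof (induction rule: words.induct)
  case (base x)
  then show ?case using assms(1) by auto
next
  case (step d z k l)
  then obtain \<nu> where \<nu>: "z \<in> wsp \<nu>" "ht \<nu> = ht \<kappa> - d" "d = 0 \<longrightarrow> \<nu> = \<kappa>" by blast
  have "d + \<bar>l\<bar> - \<bar>k\<bar> = 0 \<Longrightarrow> d = 0 \<and> \<bar>k\<bar> = \<bar>l\<bar>" using step words_nonneg[OF step.hyps(1)] by linarith
  then show ?case
    using wsp_L[OF \<nu>(1), of k l] \<nu>(2,3) step.hyps ht_shift[of k l \<nu>] shift_same[of k l \<nu>]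
    by (intro exI[of _ "shift \<nu> k l"]) auto
qed

lemma words_diag:
  assumes "X \<subseteq> wsp \<kappa>" "(d, z) \<in> words X" "k \<in> I"
  obtains c where "app (L k k) z = c *s z"
proof -
  obtain \<nu> where "z \<in> wsp \<nu>" using words_weight[OF assms(1,2)] by blast
  then show ?thesis
    using wspD[of z \<nu> k] wspD_neg[of z \<nu> "- k"] assms(3) that by (cases "0 < k") (auto simp: I_iff)
qed

text \<open>The core of the triangular decomposition: raising operators do not leave the span of
  lowering words. The outer induction bounds the depth and handles products passing through a less
  deep vector. Cartan letters do not change the depth, hence the inner induction over words.\<close>

lemma L_words:
  assumes X: "X \<subseteq> hw \<kappa>"
  shows "\<forall>d z. (d, z) \<in> words X \<longrightarrow> d < int D \<longrightarrow> (\<forall>i\<in>I. \<forall>j\<in>I. app (L i j) z \<in> words_span X (d + \<bar>j\<bar> - \<bar>i\<bar>))"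
proof (induction D)
  case 0
  then show ?case using words_nonneg by fastforce
next
  case (Suc D)
  have Xw: "X \<subseteq> wsp \<kappa>" using X by (auto simp: hw_def)
  have IHS: "app (L i j) v \<in> words_span X (d + \<bar>j\<bar> - \<bar>i\<bar>)" if "v \<in> words_span X d" "d < int D" "i \<in> I" "j \<in> I" for v d i j
    using that(1) unfolding words_span_def[of X d]
    by (rule app_span[OF L_scale _ subspace_Sp, rotated]) (use Suc that(2-) in auto)
  have "d < int (Suc D) \<longrightarrow> (\<forall>i\<in>I. \<forall>j\<in>I. app (L i j) z \<in> words_span X (d + \<bar>j\<bar> - \<bar>i\<bar>))" if "(d, z) \<in> words X" for d z
    using that
  proof (induction rule: words.induct)
    case (base x)
    show ?case
    proof (intro impI ballI)
      fix i j assume ij: "i \<in> I" "j \<in> I"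
      show "app (L i j) x \<in> words_span X (0 + \<bar>j\<bar> - \<bar>i\<bar>)"
      proof (cases "\<bar>j\<bar> < \<bar>i\<bar>")
        case True
        then have "app (L i j) x = 0" using base ij X by (auto simp: hw_def)
        then show ?thesis using subspace_0[OF subspace_Sp] by simp
      next
        case False
        then show ?thesis using words.step[OF words.base[OF base] ij] words_Sp by force
      qed
    qed
  next
    case (step d z k l)
    show ?case
    proof (intro impI ballI)
      fix i j assume d: "d + \<bar>l\<bar> - \<bar>k\<bar> < int (Suc D)" and ij: "i \<in> I" "j \<in> I"
      let ?U = "words_span X (d + \<bar>l\<bar> - \<bar>k\<bar> + \<bar>j\<bar> - \<bar>i\<bar>)"
      have dD: "d < int (Suc D)" using d step.hyps(4) by linarith
      have z: "app (L i j) z \<in> words_span X (d + \<bar>j\<bar> - \<bar>i\<bar>)" if "i \<in> I" "j \<in> I" for i j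
        using step.IH dD that by blast
      have kl: "app (L k l) z \<in> words_span X (d + \<bar>l\<bar> - \<bar>k\<bar>)"
        using words_Sp[OF step.hyps(1)] step.hyps by (intro Sp_lower)
      show "app (L i j) (app (L k l) z) \<in> ?U"
      proof (cases "\<bar>i\<bar> \<le> \<bar>j\<bar> \<or> j < i \<or> l < k")
        case True
        then consider "\<bar>i\<bar> \<le> \<bar>j\<bar>" | "L i j = 0 \<or> L k l = 0" by (auto simp: R.L_upper)
        then show ?thesis
        proof cases
          case 1
          then show ?thesis using Sp_lower[OF ij 1 kl] by simp
        qed (auto simp: subspace_0[OF subspace_Sp])
      next
        case False
        then have i: "i < 0" "\<bar>j\<bar> < - i" "k \<le> l" using ij by (auto simp: I_iff)
        \<comment> \<open>Each correction product in \<open>exchange\<close> is harmless for one of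
          three reasons: its inner factor is diagonal and acts on \<open>z\<close> as a scalar; the
          intermediate vector is less deep than the current word, so \<open>IHS\<close> applies; or
          its outer factor does not raise.\<close>
        have pair: "app (L a b) (app (L c e) z) \<in> ?U"
          if abce: "a \<in> I" "b \<in> I" "c \<in> I" "e \<in> I" "\<bar>a\<bar> = \<bar>i\<bar>" "\<bar>b\<bar> = \<bar>l\<bar>" "\<bar>c\<bar> = \<bar>k\<bar>" "\<bar>e\<bar> = \<bar>j\<bar>"
            and cases: "c = e \<or> \<bar>j\<bar> < \<bar>l\<bar> \<or> \<bar>i\<bar> \<le> \<bar>l\<bar>" for a b c e
        proof -
          have ce: "app (L c e) z \<in> words_span X (d + \<bar>j\<bar> - \<bar>k\<bar>)" using z[of c e] abce by simp
          have tgt: "?U = words_span X ((d + \<bar>j\<bar> - \<bar>k\<bar>) + \<bar>b\<bar> - \<bar>a\<bar>)" using abce by (intro arg_cong[of _ _ "words_span X"]) simp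
          consider "c = e" | "\<bar>j\<bar> < \<bar>l\<bar>" | "\<bar>i\<bar> \<le> \<bar>l\<bar>" using cases by blast
          then show ?thesis
          proof cases
            case 1
            obtain c' where c': "app (L c e) z = c' *s z" using words_diag[OF Xw step.hyps(1) abce(3)] 1 by metis
            have "app (L a b) z \<in> words_span X (d + \<bar>b\<bar> - \<bar>a\<bar>)" using z abce by blast
            moreover have "\<bar>j\<bar> = \<bar>k\<bar>" using abce 1 by simp
            ultimately show ?thesis
              unfolding tgt c' L_scale by (simp add: subspace_scale[OF subspace_Sp])
          next
            case 2
            then show ?thesis unfolding tgt using d ce abce by (intro IHS) auto
          next
            case 3
            then show ?thesis unfolding tgt using ce abce by (intro Sp_lower) auto
          qed
        qed
        have zero: "app (L a b) (app (L c e) z) \<in> ?U" if "b < a \<or> e < c" for a b c e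
          using that by (auto simp: R.L_upper subspace_0[OF subspace_Sp])
        note u = ij[THEN R.uminus_I] step.hyps(2,3)[THEN R.uminus_I]
        show ?thesis
        proof (rule exchange[OF ij step.hyps(2,3) subspace_Sp])
          show "app (L k l) (app (L i j) z) \<in> ?U"
            using Sp_lower[OF step.hyps(2,3,4) z[OF ij]] by (simp add: algebra_simps)
          show "app (L i l) (app (L k j) z) \<in> ?U" if "j < l"
          proof (cases "k \<le> j")
            case True
            then have "k = j \<or> \<bar>j\<bar> < \<bar>l\<bar> \<or> \<bar>i\<bar> \<le> \<bar>l\<bar>" using that step.hyps(4) by linarith
            then show ?thesis using pair[of i l k j] ij step.hyps(2,3) by simp
          qed (use zero in auto)
          show "app (L i (- l)) (app (L k (- j)) z) \<in> ?U" if "- j < l"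
          proof (cases "k \<le> - j")
            case True
            then have "k = - j \<or> \<bar>j\<bar> < \<bar>l\<bar> \<or> \<bar>i\<bar> \<le> \<bar>l\<bar>" using that step.hyps(4) by linarith
            then show ?thesis using pair[of i "- l" k "- j"] ij u step.hyps(2,3) by simp
          qed (use zero in auto)
          show "app (L i l) (app (L k j) z) \<in> ?U" if "k < i"
          proof -
            have "\<bar>i\<bar> \<le> \<bar>l\<bar>" using that i step.hyps(4) by linarith
            then show ?thesis using pair[of i l k j] ij step.hyps(2,3) by simp
          qed
          show "app (L (- i) l) (app (L (- k) j) z) \<in> ?U" if "k < - i"
          proof (cases "- i \<le> l")
            case True
            then have "\<bar>i\<bar> \<le> \<bar>l\<bar>" using i by linarith
            then show ?thesis using pair[of "- i" l "- k" j] ij u step.hyps(2,3) by simp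
          qed (use zero in auto)
        qed
      qed
    qed
  qed
  then show ?case by blast
qed

lemma stable_gen:
  assumes "X \<subseteq> hw \<kappa>"
  shows "stable (generated X)"
  unfolding stable_def
proof (intro conjI allI ballI)
  show "subspace (generated X)" by (simp add: generated_def)
  fix i j v assume v: "v \<in> generated X"
  have Sp_gen: "words_span X d \<subseteq> generated X" for d
    unfolding words_span_def generated_def by (rule span_mono) force
  show "app (L i j) v \<in> generated X"
  proof (cases "i \<in> I \<and> j \<in> I")
    case False
    then have "L i j = 0" using L_nonzero_index[of i j] by blast
    then show ?thesis by (simp add: generated_def span_zero)
  next
    case True
    show ?thesis
    proof (rule app_span[OF L_scale _ _ v[unfolded generated_def]])
      fix z assume "z \<in> snd ` words X"
      then obtain d where d: "(d, z) \<in> words X" by auto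
      show "app (L i j) z \<in> generated X"
        using L_words[OF assms, of "Suc (nat d)"] d True words_nonneg[OF d] Sp_gen by fastforce
    qed (simp add: generated_def)
  qed
qed

lemma gen_superset: "X \<subseteq> generated X"
  unfolding generated_def using words.base by (force intro: span_base)

lemma gen_least:
  assumes "stable W" "X \<subseteq> W" shows "generated X \<subseteq> W"
proof -
  have "z \<in> W" if "(d, z) \<in> words X" for d z
    using that by (induction rule: words.induct) (use assms stable_L in auto)
  then have "snd ` words X \<subseteq> W" by auto
  then show ?thesis
    unfolding generated_def by (intro span_minimal stable_subspace[OF assms(1)])
qed

end

section \<open>Highest weight vectors\<close>

context queer_ops
begin

lemma app_wgt: "app (R.wgt i) x = (pm (i < 0) * qq ^ (2 * nat \<bar>i\<bar>)) *s x"
proof -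
  have "app (sc qq ^ m) x = qq ^ m *s x" for m
    by (induction m arbitrary: x) simp_all
  then show ?thesis by (simp add: R.wgt_def pm_def)
qed

lemma app_C: "app R.C v = (\<Sum>i\<in>I. (pm (i < 0) * qq ^ (2 * nat \<bar>i\<bar>)) *s (\<Sum>m\<in>I. app (R.N i m) (app (L m i) v)))"
  by (simp add: R.C_def app_sum app_wgt app_M)

lemma C_scale: "app R.C (c *s v) = c *s app R.C v"
  unfolding app_C by (simp add: L_scale graded_opD(1)[OF graded_op_N] scale_sum_right mult.commute)

lemma C_L: "app R.C (app (L k l) v) = app (L k l) (app R.C v)"
  using R.C_central[of k l] by (simp flip: app_simps(5))

lemma C_wsp:
  assumes "v \<in> wsp \<mu>" shows "app R.C v \<in> wsp \<mu>"
proof -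
  have "app (R.N i m) (app (L m i) v) \<in> wsp \<mu>" for i m
    using graded_opD(2)[OF graded_op_N wsp_L[OF assms, of m i], of i m]
    by (simp add: shift_shift shift_same)
  then show ?thesis
    unfolding app_C by (intro subspace_sum subspace_scale subspace_wsp)
qed

lemma subspace_hw: "subspace (hw \<kappa>)"
  using subspace_wsp[of \<kappa>] unfolding hw_def subspace_def
  by (auto simp: app_add_right L_scale)

lemma hw_wsp: "hw \<kappa> \<subseteq> wsp \<kappa>"
  by (auto simp: hw_def)

text \<open>A Cartan operator yields a word of depth 0, and a raising operator would take it to
  negative depth, where there are no words.\<close>

lemma hw_cartan:
  assumes "v \<in> hw \<kappa>" "k \<in> I" "l \<in> I" "\<bar>k\<bar> = \<bar>l\<bar>"
  shows "app (L k l) v \<in> hw \<kappa>"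
proof -
  have w: "(0, app (L k l) v) \<in> words (hw \<kappa>)"
    using words.step[OF words.base[OF assms(1)] assms(2,3)] assms(4) by simp
  have "app (L i j) (app (L k l) v) = 0" if "i \<in> I" "j \<in> I" "\<bar>j\<bar> < \<bar>i\<bar>" for i j
  proof -
    have "app (L i j) (app (L k l) v) \<in> words_span (hw \<kappa>) (0 + \<bar>j\<bar> - \<bar>i\<bar>)"
      using L_words[OF order.refl, of \<kappa> 1] w that by force
    moreover have "{z. (0 + \<bar>j\<bar> - \<bar>i\<bar>, z) \<in> words (hw \<kappa>)} = {}"
      using words_nonneg that(3) by fastforce
    ultimately show ?thesis by (simp add: words_span_def)
  qed
  moreover have "app (L k l) v \<in> wsp \<kappa>"
    using wsp_L[of v \<kappa> k l] assms hw_wsp by (auto simp: shift_same)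
  ultimately show ?thesis by (simp add: hw_def)
qed

text \<open>The analogue of the \<open>sl_2\<close> relation for the even root vectors of a pair
  \<open>a < b\<close>, whether or not the root is simple.\<close>

lemma commutator_ef:
  assumes "1 \<le> a" "a < b" "b \<le> int n" "v \<in> wsp \<mu>"
  shows "app (L (- b) (- a)) (app (L a b) v) = app (L a b) (app (L (- b) (- a)) v)
    + ((qq - inverse qq) * (qq powi (\<mu> b - \<mu> a) - qq powi (- (\<mu> b - \<mu> a)))) *s v"
proof -
  have g: "(- b, - a) \<in> generators n" "(a, b) \<in> generators n" using assms by (auto simp: generators_def I_iff)
  have s: "\<theta> (- (- b)) (- (- a)) a = 1" "\<phi> (- a) b = 0" "\<phi> (- b) a = 0" "par a b = 0"
    using assms(1,2) by (simp_all add: \<theta>_def \<phi>_def par_def zero_less_mult_iff)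
  have f: "(a \<le> - a \<and> - a < b) = False" "(- b \<le> - b \<and> - b < - a \<and> - a \<le> - a) = True"
    "(a < - b \<and> - b \<le> b) = False" "(- b \<le> - b \<and> - b < - a \<and> - a \<le> - a) = True"
    using assms by auto
  have "sc 1 * L (- b) (- a) * L a b + sc (qq - inverse qq) * L (- b) (- b) * L a a
    = sc 1 * L a b * L (- b) (- a) + sc (qq - inverse qq) * L b b * L (- a) (- a)"
    using L_rel[OF g] unfolding L_relation_def sc_def[symmetric] f s by (simp add: sc_zero)
  then have "app (sc 1 * L (- b) (- a) * L a b + sc (qq - inverse qq) * L (- b) (- b) * L a a) v
    = app (sc 1 * L a b * L (- b) (- a) + sc (qq - inverse qq) * L b b * L (- a) (- a)) v"
    by simp
  moreover have "app (L b b) (app (L (- a) (- a)) v) = (qq powi (\<mu> b - \<mu> a)) *s v"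
    "app (L (- b) (- b)) (app (L a a) v) = (qq powi (- (\<mu> b - \<mu> a))) *s v"
    using wspD[OF assms(4), of a] wspD[OF assms(4), of b] wspD_neg[OF assms(4), of a] wspD_neg[OF assms(4), of b] assms
    by (simp_all add: L_scale qq_nonzero flip: power_int_add)
  ultimately show ?thesis
    by (simp add: scale_left_diff_distrib right_diff_distrib algebra_simps)
qed

end

context queer_module
begin

lemma gen_low:
  assumes "X \<subseteq> hw \<kappa>" shows "generated X \<subseteq> low (ht \<kappa> + 1)"
proof -
  have "z \<in> low (ht \<kappa> + 1)" if dz: "(d, z) \<in> words X" for d z
  proof -
    obtain \<nu> where "z \<in> wsp \<nu>" "ht \<nu> = ht \<kappa> - d"
      using words_weight[of X \<kappa> d z] dz assms hw_wsp by blast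
    then show ?thesis using wsp_low words_nonneg[OF dz] by simp
  qed
  then have "snd ` words X \<subseteq> low (ht \<kappa> + 1)" by auto
  then show ?thesis unfolding generated_def by (intro span_minimal subspace_low)
qed

text \<open>Words of depth 0 stay in \<open>X\<close> by its stability under Cartan operators, and
  all deeper words lie strictly below \<open>ht \<kappa>\<close>. So the part of weight
  \<open>\<kappa>\<close> comes from \<open>X\<close> alone.\<close>

lemma gen_top:
  assumes X: "X \<subseteq> hw \<kappa>" "subspace X" and "\<And>k l v. v \<in> X \<Longrightarrow> k \<in> I \<Longrightarrow> l \<in> I \<Longrightarrow> \<bar>k\<bar> = \<bar>l\<bar> \<Longrightarrow> app (L k l) v \<in> X"
    and z: "z \<in> generated X" "z \<in> wsp \<kappa>"
  shows "z \<in> X"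
proof -
  have w: "d = 0 \<longrightarrow> z \<in> X" if "(d, z) \<in> words X" for d z
    using that
  proof (induction rule: words.induct)
    case (step d z k l)
    show ?case
    proof
      assume "d + \<bar>l\<bar> - \<bar>k\<bar> = 0"
      then have "d = 0" "\<bar>k\<bar> = \<bar>l\<bar>" using step words_nonneg[OF step.hyps(1)] by linarith+
      then show "app (L k l) z \<in> X" using step assms(3) by blast
    qed
  qed simp
  let ?S = "{x + y |x y. x \<in> X \<and> y \<in> low (ht \<kappa>)}"
  have "z \<in> ?S" if dz: "(d, z) \<in> words X" for d z
  proof (cases "d = 0")
    case True
    then show ?thesis using w[OF dz] subspace_0[OF subspace_low] by force
  next
    case False
    obtain \<nu> where "z \<in> wsp \<nu>" "ht \<nu> = ht \<kappa> - d"
      using words_weight[of X \<kappa> d z] dz X hw_wsp by blast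
    then have "z \<in> low (ht \<kappa>)" using wsp_low words_nonneg[OF dz] False by simp
    then show ?thesis using subspace_0[OF X(2)] by force
  qed
  then have "snd ` words X \<subseteq> ?S" by auto
  then have "generated X \<subseteq> ?S"
    unfolding generated_def by (intro span_minimal subspace_sums X(2) subspace_low)
  then obtain x y where xy: "z = x + y" "x \<in> X" "y \<in> low (ht \<kappa>)" using z(1) by blast
  have "y = z - x" using xy by simp
  then have "y \<in> wsp \<kappa>" using z(2) xy(2) X(1) hw_wsp subspace_diff[OF subspace_wsp] by blast
  then have "y = 0" using low_wsp[OF xy(3)] by simp
  then show ?thesis using xy by simp
qed

lemma sg_wsp: "v \<in> wsp \<mu> \<Longrightarrow> app sg v \<in> wsp \<mu>"
proof -
  assume v: "v \<in> wsp \<mu>"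
  have "app (L i i) (app sg v) = app sg (app (L i i) v)" if "i \<in> {1..int n}" for i
    using sg_L[of i i v] that by (simp add: I_iff odd_pair_def)
  then show ?thesis using v unfolding wsp_def by (simp add: sg_scale)
qed

lemma sg_hw: "v \<in> hw \<kappa> \<Longrightarrow> app sg v \<in> hw \<kappa>"
proof -
  assume v: "v \<in> hw \<kappa>"
  have "app (L i j) (app sg v) = 0" if ij: "i \<in> I" "j \<in> I" "\<bar>j\<bar> < \<bar>i\<bar>" for i j
  proof -
    have "app (pm (odd_pair i j)) (app (L i j) (app sg v)) = 0"
      using sg_L[of i j v] ij v by (simp add: hw_def)
    then show ?thesis by (cases "odd_pair i j") simp_all
  qed
  then show ?thesis using v sg_wsp by (simp add: hw_def)
qed

lemma sg_gen:
  assumes "X \<subseteq> hw \<kappa>" "\<And>v. v \<in> X \<Longrightarrow> app sg v \<in> X" "v \<in> generated X"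
  shows "app sg v \<in> generated X"
proof -
  note st = stable_gen[OF assms(1)]
  have "app sg z \<in> generated X" if "(d, z) \<in> words X" for d z
    using that
  proof (induction rule: words.induct)
    case (base x)
    then show ?case using gen_superset assms(2) by blast
  next
    case (step d z k l)
    then show ?case
      using stable_L[OF st step.IH, of k l] subspace_neg[OF stable_subspace[OF st]]
      by (cases "odd_pair k l") (auto simp: sg_L)
  qed
  then have "\<And>z. z \<in> snd ` words X \<Longrightarrow> app sg z \<in> generated X" by auto
  then show ?thesis
    by (rule app_span[OF sg_scale _ stable_subspace[OF st] assms(3)[unfolded generated_def]])
qed

section \<open>Eigenvalues and dominance of highest weights\<close>

definition C_value :: "(int \<Rightarrow> int) \<Rightarrow> Cq" where
  "C_value \<kappa> = qq ^ (2 * n + 2) * Sg \<kappa> (int n)"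

lemma stable_0: "stable {0}"
  by (auto simp: stable_def)

lemma top_weight_gen:
  assumes "X \<subseteq> hw \<kappa>" shows "top_weight scale n L (generated X) {0} \<kappa>"
proof (intro top_weight.intro top_weight_axioms.intro queer_ops_axioms)
  show "generated X \<inter> wsp \<nu> \<subseteq> {0}" if "ht \<kappa> < ht \<nu>" for \<nu>
    using gen_low[OF assms] low_wsp[of _ "ht \<kappa> + 1" \<nu>] that by auto
qed (use stable_gen[OF assms] stable_0 in auto)

text \<open>On highest weight vectors this is \<open>C_eigenvalue\<close> with
  \<open>W = {0}\<close>. An eigenspace of a central element is stable, so it contains all that they
  generate.\<close>

lemma C_gen:
  assumes "X \<subseteq> hw \<kappa>" "z \<in> generated X" shows "app R.C z = C_value \<kappa> *s z"
proof -
  have hwC: "app R.C v = C_value \<kappa> *s v" if "v \<in> hw \<kappa>" for v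
  proof -
    interpret top_weight scale n L "generated (hw \<kappa>)" "{0}" \<kappa>
      by (rule top_weight_gen) simp
    have "v \<in> generated (hw \<kappa>) \<inter> wsp \<kappa>" using that gen_superset hw_wsp by blast
    from C_eigenvalue[OF this] show ?thesis by (simp add: C_value_def)
  qed
  have "stable {z. app R.C z = C_value \<kappa> *s z}"
    unfolding stable_def subspace_def
    by (auto simp: app_add_right C_scale scale_right_distrib C_L L_scale scale_left_commute)
  moreover have "X \<subseteq> {z. app R.C z = C_value \<kappa> *s z}" using assms(1) hwC by auto
  ultimately show ?thesis using gen_least assms(2) by blast
qed

definition dominant :: "(int \<Rightarrow> int) \<Rightarrow> bool" where
  "dominant \<mu> \<longleftrightarrow> (\<forall>a b. 1 \<le> a \<longrightarrow> a < b \<longrightarrow> b \<le> int n \<longrightarrow> \<mu> b \<le> \<mu> a)"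

lemma cc_inj:
  assumes "\<mu> \<in> \<Omega>" "\<nu> \<in> \<Omega>" "dominant \<mu>" "dominant \<nu>" "C_value \<mu> = C_value \<nu>"
  shows "\<mu> = \<nu>"
proof (rule \<Omega>_eqI[OF assms(1,2)])
  fix i assume i: "1 \<le> i" "i \<le> int n"
  have Sg: "Sg \<mu> (int n) = 2 / (1 + qq ^ 2) * (\<Sum>j\<in>{1..int n}. qq powi (2 * \<mu> j) - qq powi (- 2 * \<mu> j))" for \<mu>
    unfolding Sg_def del_def Dq_def sum_distrib_left by simp
  have "Sg \<mu> (int n) = Sg \<nu> (int n)"
    using assms(5) qq_nonzero by (simp add: C_value_def)
  then have "(\<Sum>j\<in>{1..int n}. qq powi (2 * \<mu> j) - qq powi (- 2 * \<mu> j)) = (\<Sum>j\<in>{1..int n}. qq powi (2 * \<nu> j) - qq powi (- 2 * \<nu> j))"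
    unfolding Sg using two_nonzero one_plus_qq2_nonzero by simp
  then have "card {j\<in>{1..int n}. \<mu> j = m} = card {j\<in>{1..int n}. \<nu> j = m}" if "0 < m" for m
    using that \<Omega>_nonneg assms(1,2) by (intro card_parts_eq) auto
  then show "\<mu> i = \<nu> i"
    using assms(3,4) i \<Omega>_nonneg assms(1,2) unfolding dominant_def
    by (intro dominant_eqI[of "int n" \<mu> \<nu>]) auto
qed

text \<open>An \<open>sl_2\<close> string. Finitely many weights force some power of the lowering
  operator \<open>L a b\<close> to take \<open>v\<close> into \<open>W\<close>. If
  \<open>\<mu> b\<close> exceeded \<open>\<mu> a\<close>, the raising operator would carry the first
  such vector to a nonzero multiple of its predecessor, which would then lie in \<open>W\<close>
  too.\<close>

lemma dominant_top:
  assumes "top_weight scale n L V W \<mu>" "v \<in> V" "v \<in> wsp \<mu>" "v \<notin> W"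
  shows "dominant \<mu>"
  unfolding dominant_def
proof (intro allI impI, rule ccontr)
  interpret top_weight scale n L V W \<mu> by (rule assms(1))
  fix a b assume ab: "1 \<le> a" "a < b" "b \<le> int n" and "\<not> \<mu> b \<le> \<mu> a"
  define d where "d = \<mu> b - \<mu> a"
  have d: "0 < d" using \<open>\<not> \<mu> b \<le> \<mu> a\<close> by (simp add: d_def)
  have I: "a \<in> I" "b \<in> I" "- a \<in> I" "- b \<in> I" using ab by (auto simp: I_iff)
  define F where "F m = ((\<lambda>x. app (L a b) x) ^^ m) v" for m
  define wt where "wt m = (\<lambda>i. \<mu> i + int m * ((if i = b then 1 else 0) - (if i = a then 1 else 0)))" for m
  have F_Suc: "F (Suc m) = app (L a b) (F m)" for m by (simp add: F_def)
  have F_V: "F m \<in> V" for m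
    by (induction m) (use assms(2) stable_L[OF stable_V] F_Suc in \<open>auto simp: F_def\<close>)
  have F_wt: "F m \<in> wsp (wt m)" for m
  proof (induction m)
    case 0
    have "wt 0 = \<mu>" by (simp add: wt_def)
    then show ?case using assms(3) by (simp add: F_def)
  next
    case (Suc m)
    have "shift (wt m) a b = wt (Suc m)" using ab by (auto simp: shift_def wt_def algebra_simps)
    then show ?case using wsp_L[OF Suc, of a b] by (simp add: F_Suc)
  qed
  \<comment> \<open>The factor with which \<open>L (- b) (- a)\<close> takes \<open>F m\<close> back
    to \<open>F (m - 1)\<close> modulo \<open>W\<close>, the usual product of two quantum integers
    up to normalization. It is nonzero for \<open>m \<ge> 1\<close> because
    \<open>d > 0\<close>.\<close>
  define ka where "ka m = (qq powi int m - qq powi - int m) * (qq powi (d + int m - 1) - qq powi - (d + int m - 1))" for m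
  have ka_Suc: "ka (Suc m) = ka m + (qq - inverse qq) * (qq powi (d + 2 * int m) - qq powi - (d + 2 * int m))" for m
  proof -
    obtain x y where xy: "x = qq powi int m" "y = qq powi d" "x \<noteq> 0" "y \<noteq> 0" using qq_nonzero by simp
    have m2: "qq powi (int m * 2) = qq ^ m * qq ^ m" using powi_2[of "int m"] by (simp add: mult.commute)
    have p: "qq powi - int m = inverse x" "qq powi int (Suc m) = qq * x" "qq powi - int (Suc m) = inverse (qq * x)"
      "qq powi (d + int m - 1) = y * x / qq" "qq powi - (d + int m - 1) = qq / (y * x)"
      "qq powi (d + int (Suc m) - 1) = y * x" "qq powi - (d + int (Suc m) - 1) = inverse (y * x)"
      "qq powi (d + 2 * int m) = y * x * x" "qq powi - (d + 2 * int m) = inverse (y * x * x)"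
      using qq_nonzero by (simp_all add: xy power_int_add power_int_diff power_int_minus m2 divide_inverse mult.commute mult.left_commute)
    show ?thesis
      unfolding ka_def p xy(1)[symmetric] using xy(3,4) qq_nonzero by (simp add: field_simps)
  qed
  have eF: "app (L (- b) (- a)) (F (Suc m)) - ka (Suc m) *s F m \<in> W" for m
  proof (induction m)
    case 0
    have "app (L a b) (app (L (- b) (- a)) v) \<in> W"
      using kill_L[of v "- b" "- a"] assms(2,3) I ab stable_L[OF stable_W] by simp
    moreover have "app (L (- b) (- a)) (F 1) = app (L a b) (app (L (- b) (- a)) v) + ka 1 *s v"
      using commutator_ef[OF ab assms(3)] by (simp add: F_def ka_def d_def power_int_minus)
    ultimately show ?case by (simp add: F_def)
  next
    case (Suc m)
    have wd: "wt (Suc m) b - wt (Suc m) a = d + 2 * int (Suc m)" using ab by (simp add: wt_def d_def)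
    have "app (L (- b) (- a)) (F (Suc (Suc m))) = app (L a b) (app (L (- b) (- a)) (F (Suc m)))
      + (ka (Suc (Suc m)) - ka (Suc m)) *s F (Suc m)"
      unfolding F_Suc[of "Suc m"] using commutator_ef[OF ab F_wt[of "Suc m"]] ka_Suc[of "Suc m"] unfolding wd by simp
    then have "app (L (- b) (- a)) (F (Suc (Suc m))) - ka (Suc (Suc m)) *s F (Suc m)
      = app (L a b) (app (L (- b) (- a)) (F (Suc m)) - ka (Suc m) *s F m)"
      by (simp add: scale_left_diff_distrib L_scale flip: F_Suc)
    then show ?case using stable_L[OF stable_W Suc] by simp
  qed
  have "\<exists>m. F m \<in> W"
  proof (rule ccontr)
    assume "\<not> ?thesis"
    then have nz: "F m \<noteq> 0" for m using W_0 by metis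
    have "ht (wt m) \<in> ht ` \<Omega>" for m
      using wsp_nonzero[OF F_wt nz, of m] ht_cong by (metis image_eqI)
    then have "range (\<lambda>m. ht (wt m)) \<subseteq> ht ` \<Omega>" by auto
    then have "finite (range (\<lambda>m. ht (wt m)))" using finite_\<Omega> finite_subset by blast
    moreover have "ht (wt m) = ht \<mu> - int m * (b - a)" for m
    proof -
      have e: "i * wt m i = i * \<mu> i + ((if i = b then int m * b else 0) - (if i = a then int m * a else 0))" for i
        by (simp add: wt_def algebra_simps)
      show ?thesis unfolding ht_def e using ab by (simp add: sum.distrib sum_subtractf right_diff_distrib)
    qed
    then have "inj (\<lambda>m. ht (wt m))" using ab by (auto simp: inj_def)
    ultimately show False using finite_imageD by blast
  qed
  then obtain m where m: "F m \<in> W" "\<And>k. k < m \<Longrightarrow> F k \<notin> W" using exists_least_iff[of "\<lambda>m. F m \<in> W"] by blast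
  have "m \<noteq> 0" using m(1) assms(4) by (auto simp: F_def intro: Nat.gr0I)
  then obtain k where k: "m = Suc k" using not0_implies_Suc by blast
  have "ka m *s F k \<in> W"
    using W_diff[OF stable_L[OF stable_W m(1), of "- b" "- a"] eF[of k]] k by simp
  moreover have "ka m \<noteq> 0"
  proof -
    have "qq powi int m \<noteq> qq powi - int m" "qq powi (d + int m - 1) \<noteq> qq powi - (d + int m - 1)"
      using qq_powi_inj[of "int m" "- int m"] qq_powi_inj[of "d + int m - 1" "- (d + int m - 1)"] d k by auto
    then show ?thesis by (simp add: ka_def)
  qed
  ultimately have "inverse (ka m) *s ka m *s F k \<in> W" using W_scale by blast
  then have "F k \<in> W" using \<open>ka m \<noteq> 0\<close> by simp
  then show False using m(2)[of k] k by simp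
qed

lemma exists_hw:
  assumes "stable M" "M \<noteq> {0}"
  shows "\<exists>\<kappa>\<in>\<Omega>. \<exists>v\<in>M \<inter> hw \<kappa>. v \<noteq> 0"
proof -
  obtain v where v: "v \<in> M" "v \<noteq> 0" using assms subspace_0[OF stable_subspace[OF assms(1)]] by blast
  obtain f where f: "\<forall>\<mu>\<in>\<Omega>. f \<mu> \<in> wsp \<mu>" "v = sum f \<Omega>" using weight_decomp by blast
  define P where "P = {\<mu>\<in>\<Omega>. \<exists>x\<in>M \<inter> wsp \<mu>. x \<noteq> 0}"
  obtain \<mu> where "\<mu> \<in> \<Omega>" "f \<mu> \<noteq> 0" using v(2) f(2) by (metis sum.neutral)
  then have "P \<noteq> {}" using weight_component[OF assms(1) f(1)] f v(1) unfolding P_def by blast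
  moreover have "finite P" using finite_\<Omega> by (simp add: P_def)
  ultimately obtain \<kappa> where \<kappa>: "\<kappa> \<in> P" "\<And>\<mu>. \<mu> \<in> P \<Longrightarrow> ht \<mu> \<le> ht \<kappa>"
    using arg_min_if_finite[of P "\<lambda>\<mu>. - ht \<mu>"] by (metis linorder_not_le neg_less_iff_less)
  then obtain x where x: "x \<in> M" "x \<in> wsp \<kappa>" "x \<noteq> 0" by (auto simp: P_def)
  have "app (L i j) x = 0" if ij: "i \<in> I" "j \<in> I" "\<bar>j\<bar> < \<bar>i\<bar>" for i j
  proof (rule ccontr)
    assume nz: "app (L i j) x \<noteq> 0"
    obtain \<mu> where \<mu>: "\<mu> \<in> \<Omega>" "\<forall>k\<in>{1..int n}. \<mu> k = shift \<kappa> i j k" using wsp_nonzero[OF wsp_L[OF x(2)] nz] by blast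
    then have e: "wsp \<mu> = wsp (shift \<kappa> i j)" "ht \<mu> = ht (shift \<kappa> i j)"
      using wsp_cong[of \<mu> "shift \<kappa> i j"] ht_cong[of \<mu> "shift \<kappa> i j"] by auto
    then have "\<mu> \<in> P"
      using \<mu>(1) nz stable_L[OF assms(1) x(1)] wsp_L[OF x(2)] by (auto simp: P_def)
    then show False using \<kappa>(2) e(2) ht_shift[OF ij(1,2), of \<kappa>] ij(3) by fastforce
  qed
  then have "x \<in> hw \<kappa>" using x by (simp add: hw_def)
  then show ?thesis using \<kappa>(1) x by (auto simp: P_def)
qed

end

section \<open>Complements\<close>

context queer_ops
begin

lemma odd_anticommute:
  assumes "1 \<le> a" "a < b" "b \<le> int n"
  shows "app (L (- a) a) (app (L (- b) b) v) = - app (L (- b) b) (app (L (- a) a) v)"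
proof -
  have g: "(- a, a) \<in> generators n" "(- b, b) \<in> generators n" using assms by (auto simp: generators_def I_iff)
  have s: "\<phi> a b = 0" "\<phi> (- a) (- b) = 0" "par (- a) a = 1" "par (- b) b = 1"
    using assms by (simp_all add: \<phi>_def par_def mult_less_0_iff)
  have f: "(- b \<le> a \<and> a < b) = True" "(- a \<le> - b \<and> - b < a \<and> a \<le> - (- b)) = False"
    "(- b < - a \<and> - a \<le> b) = True" "(- b \<le> - a \<and> - a < - (- b) \<and> - (- b) \<le> a) = False"
    using assms by auto
  have "sc (- 1) * L (- a) a * L (- b) b = sc 1 * L (- b) b * L (- a) a"
    using L_rel[OF g] unfolding L_relation_def sc_def[symmetric] f s by (simp add: sc_zero)
  then have "app (sc (- 1) * L (- a) a * L (- b) b) v = app (sc 1 * L (- b) b * L (- a) a) v" by simp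
  then have "- app (L (- a) a) (app (L (- b) b) v) = app (L (- b) b) (app (L (- a) a) v)" by simp
  then show ?thesis by (metis minus_minus)
qed

text \<open>Replacing \<open>p\<close> by \<open>(p + g\<inverse> p g) / 2\<close> makes it commute with \<open>g\<close> and keeps it commuting with the operators
  treated before, because these commute with \<open>g\<close> up to a sign.\<close>

lemma averaged_projection:
  assumes E: "subspace E" and X: "subspace X" "X \<subseteq> E"
    and "\<And>g c v. g \<in> set gs \<Longrightarrow> app g (c *s v) = c *s app g v"
    and "\<And>g v. g \<in> set gs \<Longrightarrow> v \<in> E \<Longrightarrow> app g v \<in> E" "\<And>g v. g \<in> set gs \<Longrightarrow> v \<in> X \<Longrightarrow> app g v \<in> X"
    and "\<And>g. g \<in> set gs \<Longrightarrow> \<exists>c. c \<noteq> 0 \<and> (\<forall>v\<in>E. app g (app g v) = c *s v)"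
    and "\<And>g h. g \<in> set gs \<Longrightarrow> h \<in> set gs \<Longrightarrow> \<exists>e. e * e = 1 \<and> (\<forall>v\<in>E. app g (app h v) = e *s app h (app g v))"
  shows "\<exists>p. (\<forall>x\<in>E. \<forall>y\<in>E. p (x + y) = p x + p y) \<and> (\<forall>c. \<forall>x\<in>E. p (c *s x) = c *s p x) \<and>
    (\<forall>x\<in>E. p x \<in> X) \<and> (\<forall>x\<in>X. p x = x) \<and> (\<forall>g\<in>set gs. \<forall>x\<in>E. p (app g x) = app g (p x))"
  using assms(4-8)
proof (induction gs)
  case Nil
  interpret vp: vector_space_pair scale scale ..
  obtain p where p: "range p \<subseteq> X" "Vector_Spaces.linear scale scale p" "\<forall>v\<in>X. p v = v"
    using vp.linear_exists_left_inverse_on[OF linear_id X(1)] by auto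
  interpret p: Vector_Spaces.linear scale scale p by (rule p(2))
  show ?case
    using p by (intro exI[of _ p]) (auto simp: p.add p.scale)
next
  case (Cons g gs)
  obtain p where p: "\<And>x y. x \<in> E \<Longrightarrow> y \<in> E \<Longrightarrow> p (x + y) = p x + p y" "\<And>c x. x \<in> E \<Longrightarrow> p (c *s x) = c *s p x"
    "\<And>x. x \<in> E \<Longrightarrow> p x \<in> X" "\<And>x. x \<in> X \<Longrightarrow> p x = x" "\<And>h x. h \<in> set gs \<Longrightarrow> x \<in> E \<Longrightarrow> p (app h x) = app h (p x)"
    using Cons.IH[OF Cons.prems(1)[OF list.set_intros(2)] Cons.prems(2)[OF list.set_intros(2)]
        Cons.prems(3)[OF list.set_intros(2)] Cons.prems(4)[OF list.set_intros(2)]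
        Cons.prems(5)[OF list.set_intros(2) list.set_intros(2)]] by blast
  obtain c where c: "c \<noteq> 0" "\<And>v. v \<in> E \<Longrightarrow> app g (app g v) = c *s v"
    using Cons.prems(4)[of g] by auto
  have gs: "app g (a *s v) = a *s app g v" for a v using Cons.prems(1) by simp
  have gE: "v \<in> E \<Longrightarrow> app g v \<in> E" and gX: "v \<in> X \<Longrightarrow> app g v \<in> X" for v
    using Cons.prems(2,3) by simp_all
  have XE: "x \<in> X \<Longrightarrow> x \<in> E" for x using X(2) by blast
  define p' where "p' v = inverse 2 *s (p v + inverse c *s app g (p (app g v)))" for v
  have half: "inverse 2 *s (x + x) = x" for x
  proof -
    have "x + x = 2 *s x" using scale_left_distrib[of 1 1 x] by simp
    then show ?thesis using two_nonzero by simp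
  qed
  show ?case
  proof (intro exI[of _ p'] conjI ballI allI)
    fix x y assume "x \<in> E" "y \<in> E"
    then show "p' (x + y) = p' x + p' y"
      using gE p(1) by (simp add: p'_def app_add_right scale_right_distrib algebra_simps)
  next
    fix a x assume "x \<in> E"
    then show "p' (a *s x) = a *s p' x"
      using gE p(2) by (simp add: p'_def gs scale_right_distrib algebra_simps)
  next
    fix x assume "x \<in> E"
    then show "p' x \<in> X"
      unfolding p'_def using gE gX p(3) X(1) by (intro subspace_scale subspace_add) auto
  next
    fix x assume x: "x \<in> X"
    then have "inverse c *s app g (p (app g x)) = x"
      using gX p(4) c XE by simp
    then show "p' x = x" using p(4)[OF x] half by (simp add: p'_def)
  next
    fix h x assume h: "h \<in> set (g # gs)" and x: "x \<in> E"
    have hl: "app h (a *s v) = a *s app h v" for a v using Cons.prems(1) h by blast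
    obtain e where e: "e * e = 1" "\<And>v. v \<in> E \<Longrightarrow> app g (app h v) = e *s app h (app g v)"
      using Cons.prems(5)[of g h] h by auto
    have hE: "app h x \<in> E" using Cons.prems(2) h x by blast
    show "p' (app h x) = app h (p' x)"
    proof (cases "h \<in> set gs")
      case True
      have "app g (p (app g (app h x))) = app g (p (e *s app h (app g x)))" using e(2)[OF x] by simp
      also have "\<dots> = e *s app g (app h (p (app g x)))"
        using p(2,5) True gE[OF x] Cons.prems(2)[OF h, of "app g x"] by (simp add: gs)
      also have "\<dots> = e *s e *s app h (app g (p (app g x)))"
        using e(2) p(3)[OF gE[OF x]] XE by simp
      finally show ?thesis
        using p(5)[OF True x] e(1) by (simp add: p'_def hl app_add_right)
    next
      case False
      then have hg: "h = g" using h by simp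
      have "inverse c *s app g (p (app g (app g x))) = app g (p x)"
        using c x p(2) by (simp add: gs)
      moreover have "app g (inverse c *s app g (p (app g x))) = p (app g x)"
        using c p(3)[OF gE[OF x]] XE by (simp add: gs)
      ultimately show ?thesis
        unfolding hg p'_def by (simp add: gs app_add_right add.commute)
    qed
  qed
qed

end

context queer_module
begin

definition submod :: "'v set \<Rightarrow> bool" where
  "submod W \<longleftrightarrow> stable W \<and> (\<forall>v\<in>W. app sg v \<in> W)"

lemma qq2_neq_1: "qq ^ 2 \<noteq> 1"
  using qq_powi_inj[of 2 0] by auto

text \<open>The averaging runs over \<open>sg\<close>, which makes the complement graded, and over
  the odd Cartan generators with \<open>\<kappa> i \<noteq> 0\<close>, whose squares are invertible
  scalars. The remaining odd ones act as zero by \<open>odd_zero\<close> and the even ones as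
  scalars, so both respect every subspace of \<open>hw \<kappa>\<close>. The complement is the
  kernel of the averaged projection onto \<open>M \<inter> hw \<kappa>\<close>.\<close>

lemma clifford_complement:
  assumes M: "submod M" and \<kappa>: "\<kappa> \<in> \<Omega>"
  shows "\<exists>Y. subspace Y \<and> Y \<subseteq> hw \<kappa> \<and> (\<forall>v\<in>Y. app sg v \<in> Y) \<and>
    (\<forall>k\<in>I. \<forall>l\<in>I. \<bar>k\<bar> = \<bar>l\<bar> \<longrightarrow> (\<forall>v\<in>Y. app (L k l) v \<in> Y)) \<and> M \<inter> Y = {0} \<and>
    (\<forall>v\<in>hw \<kappa>. \<exists>x\<in>M \<inter> hw \<kappa>. \<exists>y\<in>Y. v = x + y)"
proof -
  define X where "X = M \<inter> hw \<kappa>"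
  define gs where "gs = sg # map (\<lambda>i. L (- i) i) (filter (\<lambda>i. \<kappa> i \<noteq> 0) [1..int n])"
  have gs: "g = sg \<or> (\<exists>i. 1 \<le> i \<and> i \<le> int n \<and> \<kappa> i \<noteq> 0 \<and> g = L (- i) i)" if "g \<in> set gs" for g
    using that by (auto simp: gs_def)
  have stM: "stable M" and sgM: "v \<in> M \<Longrightarrow> app sg v \<in> M" for v using M by (auto simp: submod_def)
  have odd: "app (L (- i) i) v \<in> hw \<kappa>" if "1 \<le> i" "i \<le> int n" "v \<in> hw \<kappa>" for i v
    using hw_cartan[OF that(3), of "- i" i] that by (simp add: I_iff)
  have sq: "\<exists>c. c \<noteq> 0 \<and> (\<forall>v\<in>hw \<kappa>. app g (app g v) = c *s v)" if gg: "g \<in> set gs" for g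
  proof -
    consider "g = sg" | i where "1 \<le> i" "i \<le> int n" "\<kappa> i \<noteq> 0" "g = L (- i) i" using gs[OF gg] by blast
    then show ?thesis
    proof cases
      case 1
      then show ?thesis by (intro exI[of _ 1]) (simp add: sg_sg)
    next
      case (2 i)
      have "qq powi (2 * \<kappa> i) \<noteq> qq powi (- 2 * \<kappa> i)"
        using qq_powi_inj[of "2 * \<kappa> i" "- 2 * \<kappa> i"] 2(3) by auto
      then have "(qq ^ 2 - 1) / (1 + qq ^ 2) * Dq \<kappa> i \<noteq> 0"
        using qq2_neq_1 one_plus_qq2_nonzero by (simp add: Dq_def)
      then show ?thesis
        using odd_square[OF 2(1,2)] hw_wsp[of \<kappa>] unfolding 2(4) by blast
    qed
  qed
  have comm: "\<exists>e. e * e = 1 \<and> (\<forall>v\<in>hw \<kappa>. app g (app h v) = e *s app h (app g v))" if g: "g \<in> set gs" and h: "h \<in> set gs" for g h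
  proof -
    have sgL: "app sg (app (L (- i) i) v) = - app (L (- i) i) (app sg v)" if "1 \<le> i" "i \<le> int n" for i v
      using sg_L[of "- i" i v] that by (simp add: I_iff odd_pair_def)
    consider "g = h" | i where "g = sg" "h = L (- i) i" "1 \<le> i" "i \<le> int n" | i where "h = sg" "g = L (- i) i" "1 \<le> i" "i \<le> int n"
      | i j where "g = L (- i) i" "h = L (- j) j" "1 \<le> i" "i \<le> int n" "1 \<le> j" "j \<le> int n" "i \<noteq> j"
      using gs[OF g] gs[OF h] by metis
    then show ?thesis
    proof cases
      case 1
      then show ?thesis by (intro exI[of _ 1]) simp
    next
      case (2 i)
      then show ?thesis by (intro exI[of _ "- 1"]) (simp add: sgL)
    next
      case (3 i)
      then show ?thesis by (intro exI[of _ "- 1"]) (simp add: sgL)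
    next
      case (4 i j)
      then have "app g (app h v) = - app h (app g v)" for v
        using odd_anticommute[of i j v] odd_anticommute[of j i v] by (cases "i < j") auto
      then show ?thesis by (intro exI[of _ "- 1"]) simp
    qed
  qed
  have "\<exists>p. (\<forall>x\<in>hw \<kappa>. \<forall>y\<in>hw \<kappa>. p (x + y) = p x + p y) \<and> (\<forall>c. \<forall>x\<in>hw \<kappa>. p (c *s x) = c *s p x) \<and>
    (\<forall>x\<in>hw \<kappa>. p x \<in> X) \<and> (\<forall>x\<in>X. p x = x) \<and> (\<forall>g\<in>set gs. \<forall>x\<in>hw \<kappa>. p (app g x) = app g (p x))"
  proof (rule averaged_projection[OF subspace_hw])
    show "subspace X" unfolding X_def by (intro subspace_inter stable_subspace stM subspace_hw)
    show "X \<subseteq> hw \<kappa>" by (simp add: X_def)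
    show "app g (c *s v) = c *s app g v" if "g \<in> set gs" for g c v
      using gs[OF that] by (auto simp: sg_scale L_scale)
    show "app g v \<in> hw \<kappa>" if "g \<in> set gs" "v \<in> hw \<kappa>" for g v
      using gs[OF that(1)] that(2) odd sg_hw by auto
    show "app g v \<in> X" if "g \<in> set gs" "v \<in> X" for g v
      using gs[OF that(1)] that(2) odd sg_hw sgM stable_L[OF stM] by (auto simp: X_def)
  qed (use sq comm in blast)+
  then obtain p where p: "\<And>x y. x \<in> hw \<kappa> \<Longrightarrow> y \<in> hw \<kappa> \<Longrightarrow> p (x + y) = p x + p y"
    "\<And>c x. x \<in> hw \<kappa> \<Longrightarrow> p (c *s x) = c *s p x" "\<And>x. x \<in> hw \<kappa> \<Longrightarrow> p x \<in> X" "\<And>x. x \<in> X \<Longrightarrow> p x = x"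
    "\<And>g x. g \<in> set gs \<Longrightarrow> x \<in> hw \<kappa> \<Longrightarrow> p (app g x) = app g (p x)"
    by blast
  define Y where "Y = {v \<in> hw \<kappa>. p v = 0}"
  have p0: "p 0 = 0" using p(4)[of 0] subspace_0[OF stable_subspace[OF stM]] subspace_0[OF subspace_hw] by (simp add: X_def)
  have subY: "subspace Y"
    using subspace_0[OF subspace_hw[of \<kappa>]] subspace_add[OF subspace_hw[of \<kappa>]] subspace_scale[OF subspace_hw[of \<kappa>]]
    unfolding subspace_def Y_def by (auto simp: p p0)
  have oddY: "app (L (- i) i) v \<in> Y" if i: "1 \<le> i" "i \<le> int n" and v: "v \<in> Y" for i v
  proof (cases "\<kappa> i = 0")
    case True
    then have "app (L (- i) i) v = 0"
      using odd_zero[OF \<kappa> i] v hw_wsp by (auto simp: Y_def)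
    then show ?thesis using subspace_0[OF subY] by simp
  next
    case False
    then have "L (- i) i \<in> set gs" using i by (auto simp: gs_def)
    then have "p (app (L (- i) i) v) = 0" using p(5) v by (simp add: Y_def)
    then show ?thesis using odd[OF i] v by (simp add: Y_def)
  qed
  have cartanY: "app (L k l) v \<in> Y" if kl: "k \<in> I" "l \<in> I" "\<bar>k\<bar> = \<bar>l\<bar>" and v: "v \<in> Y" for k l v
  proof -
    have vw: "v \<in> wsp \<kappa>" using v hw_wsp by (auto simp: Y_def)
    consider "l < k" | "k = l" "0 < k" | "k = l" "k < 0" | "k = - l" "0 < l" using kl by (force simp: I_iff)
    then show ?thesis
    proof cases
      case 1
      then show ?thesis using subspace_0[OF subY] by (simp add: R.L_upper)
    next
      case 2
      then show ?thesis using wspD[OF vw, of k] kl subspace_scale[OF subY v] by (simp add: I_iff)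
    next
      case 3
      then show ?thesis using wspD_neg[OF vw, of "- k"] kl subspace_scale[OF subY v] by (simp add: I_iff)
    next
      case 4
      then show ?thesis using oddY[of l v] v kl by (simp add: I_iff)
    qed
  qed
  have sgY: "app sg v \<in> Y" if "v \<in> Y" for v
    using that p(5)[of sg v] sg_hw by (simp add: Y_def gs_def)
  have inter: "M \<inter> Y = {0}"
  proof -
    have "v = 0" if "v \<in> M" "v \<in> Y" for v
      using that p(4)[of v] by (simp add: Y_def X_def)
    then show ?thesis using subspace_0[OF subY] subspace_0[OF stable_subspace[OF stM]] by auto
  qed
  have sum: "\<exists>x\<in>M \<inter> hw \<kappa>. \<exists>y\<in>Y. v = x + y" if v: "v \<in> hw \<kappa>" for v
  proof -
    have px: "p v \<in> M \<inter> hw \<kappa>" using p(3)[OF v] by (simp add: X_def)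
    have "p (v + (- 1) *s p v) = p v + (- 1) *s p (p v)"
      using p(1)[OF v, of "(- 1) *s p v"] p(2)[of "p v" "- 1"] px subspace_neg[OF subspace_hw] by simp
    also have "p (p v) = p v" using p(4)[OF p(3)[OF v]] .
    finally have "p (v - p v) = 0" by simp
    then have "v - p v \<in> Y" using v px subspace_diff[OF subspace_hw] by (simp add: Y_def)
    then show ?thesis using px by (intro bexI[of _ "p v"] bexI[of _ "v - p v"]) auto
  qed
  show ?thesis
    by (rule exI[of _ Y]) (use subY oddY cartanY sgY inter sum in \<open>auto simp: Y_def\<close>)
qed

section \<open>Sums of submodules generated by highest weight vectors\<close>

definition hw_weights :: "(int \<Rightarrow> int) set" where
  "hw_weights = {\<kappa> \<in> \<Omega>. hw \<kappa> \<noteq> {0}}"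

definition hw_sum :: "((int \<Rightarrow> int) \<Rightarrow> 'v set) \<Rightarrow> 'v set" where
  "hw_sum Y = {v. \<exists>g. (\<forall>\<kappa>\<in>hw_weights. g \<kappa> \<in> generated (Y \<kappa>)) \<and> v = sum g hw_weights}"

lemma finite_hw_weights: "finite hw_weights"
  using finite_\<Omega> by (simp add: hw_weights_def)

lemma hw_weights_dominant:
  assumes "\<kappa> \<in> hw_weights" shows "dominant \<kappa>"
proof -
  obtain v where "v \<in> hw \<kappa>" "v \<noteq> 0"
    using assms subspace_0[OF subspace_hw[of \<kappa>]] by (auto simp: hw_weights_def)
  then show ?thesis
    using dominant_top[OF top_weight_gen[of "hw \<kappa>" \<kappa>], of v] gen_superset hw_wsp by blast
qed

text \<open>Weights in \<open>hw_weights\<close> are dominant and so have distinct values of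
  \<open>C\<close>; the single operator \<open>C\<close> separates them.\<close>

lemma C_sum_mem:
  assumes U: "subspace U" "\<And>x. x \<in> U \<Longrightarrow> app R.C x \<in> U"
    and g: "\<And>\<kappa>. \<kappa> \<in> hw_weights \<Longrightarrow> app R.C (g \<kappa>) = C_value \<kappa> *s g \<kappa>" "sum g hw_weights \<in> U" "\<kappa> \<in> hw_weights"
  shows "g \<kappa> \<in> U"
proof (rule eigen_sum_mem[where f = g and a = \<kappa> and F = hw_weights and T = "\<lambda>_. app R.C" and J = "{()}" and ev = "\<lambda>_. C_value"])
  show "\<exists>t\<in>{()}. C_value a \<noteq> C_value b" if "a \<in> hw_weights" "b \<in> hw_weights" "a \<noteq> b" for a b
    using cc_inj[of a b] that hw_weights_dominant by (auto simp: hw_weights_def)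
qed (use finite_hw_weights assms in \<open>auto simp: app_add_right C_scale\<close>)

lemma stable_big:
  assumes Y: "\<And>\<kappa>. \<kappa> \<in> hw_weights \<Longrightarrow> Y \<kappa> \<subseteq> hw \<kappa>"
  shows "stable (hw_sum Y)"
  unfolding stable_def subspace_def
proof (intro conjI ballI allI)
  have st: "\<kappa> \<in> hw_weights \<Longrightarrow> stable (generated (Y \<kappa>))" for \<kappa> using stable_gen Y by blast
  note sub = stable_subspace[OF st]
  show "0 \<in> hw_sum Y"
    unfolding hw_sum_def using subspace_0[OF sub] by (auto intro!: exI[of _ "\<lambda>_. 0"])
  show "x + y \<in> hw_sum Y" if x: "x \<in> hw_sum Y" and y: "y \<in> hw_sum Y" for x y
  proof -
    obtain f g where "\<forall>\<kappa>\<in>hw_weights. f \<kappa> \<in> generated (Y \<kappa>)" "x = sum f hw_weights" "\<forall>\<kappa>\<in>hw_weights. g \<kappa> \<in> generated (Y \<kappa>)" "y = sum g hw_weights"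
      using x y unfolding hw_sum_def by blast
    then show ?thesis
      unfolding hw_sum_def using subspace_add[OF sub]
      by (intro CollectI exI[of _ "\<lambda>\<kappa>. f \<kappa> + g \<kappa>"]) (simp add: sum.distrib)
  qed
  show "c *s x \<in> hw_sum Y" if x: "x \<in> hw_sum Y" for c x
  proof -
    obtain f where "\<forall>\<kappa>\<in>hw_weights. f \<kappa> \<in> generated (Y \<kappa>)" "x = sum f hw_weights" using x unfolding hw_sum_def by blast
    then show ?thesis
      unfolding hw_sum_def using subspace_scale[OF sub]
      by (intro CollectI exI[of _ "\<lambda>\<kappa>. c *s f \<kappa>"]) (simp add: scale_sum_right)
  qed
  show "app (L i j) x \<in> hw_sum Y" if x: "x \<in> hw_sum Y" for i j x
  proof -
    obtain f where "\<forall>\<kappa>\<in>hw_weights. f \<kappa> \<in> generated (Y \<kappa>)" "x = sum f hw_weights" using x unfolding hw_sum_def by blast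
    then show ?thesis
      unfolding hw_sum_def using stable_L[OF st]
      by (intro CollectI exI[of _ "\<lambda>\<kappa>. app (L i j) (f \<kappa>)"]) (simp add: app_sum_right)
  qed
qed

lemma gen_big:
  assumes "\<And>\<kappa>. \<kappa> \<in> hw_weights \<Longrightarrow> Y \<kappa> \<subseteq> hw \<kappa>" "\<kappa> \<in> hw_weights"
  shows "generated (Y \<kappa>) \<subseteq> hw_sum Y"
proof
  fix v assume v: "v \<in> generated (Y \<kappa>)"
  have "subspace (generated (Y \<kappa>'))" if "\<kappa>' \<in> hw_weights" for \<kappa>' using stable_gen[OF assms(1)[OF that]] stable_subspace by blast
  then show "v \<in> hw_sum Y"
    unfolding hw_sum_def using v finite_hw_weights assms(2) subspace_0
    by (intro CollectI exI[of _ "\<lambda>\<kappa>'. if \<kappa>' = \<kappa> then v else 0"]) auto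
qed

text \<open>A vector that is highest modulo the span of all highest weight vectors can be corrected
  to an honest highest weight vector, because \<open>C\<close> separates the dominant weights.\<close>

theorem generated_by_hw: "hw_sum hw = UNIV"
proof (rule ccontr)
  assume ne: "hw_sum hw \<noteq> UNIV"
  let ?W = "hw_sum hw"
  have st: "stable ?W" by (rule stable_big) simp
  note sub = stable_subspace[OF st]
  obtain v0 where v0: "v0 \<notin> ?W" using ne by blast
  obtain f where f: "\<forall>\<mu>\<in>\<Omega>. f \<mu> \<in> wsp \<mu>" "v0 = sum f \<Omega>" using weight_decomp by blast
  \<comment> \<open>A weight of maximal height whose weight space is not contained in
    \<open>?W\<close> makes \<open>v\<close> a top vector of the quotient by
    \<open>?W\<close>.\<close>
  define P where "P = {\<mu>\<in>\<Omega>. \<not> wsp \<mu> \<subseteq> ?W}"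
  have "P \<noteq> {}"
  proof
    assume "P = {}"
    then have "\<forall>\<mu>\<in>\<Omega>. f \<mu> \<in> ?W" using f(1) by (auto simp: P_def)
    then show False using v0 f(2) subspace_sum[OF sub, of \<Omega> f] by simp
  qed
  moreover have "finite P" using finite_\<Omega> by (simp add: P_def)
  ultimately obtain \<mu> where \<mu>: "\<mu> \<in> P" "\<And>\<nu>. \<nu> \<in> P \<Longrightarrow> ht \<nu> \<le> ht \<mu>"
    using arg_min_if_finite[of P "\<lambda>\<mu>. - ht \<mu>"] by (metis linorder_not_le neg_less_iff_less)
  then obtain v where v: "v \<in> wsp \<mu>" "v \<notin> ?W" and \<mu>\<Omega>: "\<mu> \<in> \<Omega>" by (auto simp: P_def)
  have above: "wsp \<nu> \<subseteq> ?W" if "ht \<mu> < ht \<nu>" for \<nu>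
  proof
    fix x assume x: "x \<in> wsp \<nu>"
    show "x \<in> ?W"
    proof (cases "x = 0")
      case False
      then obtain \<nu>' where n: "\<nu>' \<in> \<Omega>" "\<forall>i\<in>{1..int n}. \<nu>' i = \<nu> i" using wsp_nonzero x by blast
      then have e: "wsp \<nu>' = wsp \<nu>" "ht \<nu>' = ht \<nu>" using wsp_cong[of \<nu>' \<nu>] ht_cong[of \<nu>' \<nu>] by auto
      then have "\<nu>' \<notin> P" using \<mu>(2)[of \<nu>'] that by auto
      then show ?thesis using n(1) e x by (auto simp: P_def)
    qed (use subspace_0[OF sub] in simp)
  qed
  interpret top_weight scale n L UNIV ?W \<mu>
    by (intro top_weight.intro top_weight_axioms.intro queer_ops_axioms) (use st above in \<open>auto simp: stable_def\<close>)
  have dom: "dominant \<mu>"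
    by (rule dominant_top[OF top_weight_axioms UNIV_I v])
  have Cv: "app R.C v - C_value \<mu> *s v \<in> ?W"
    using C_eigenvalue[of v] v(1) by (simp add: C_value_def)
  then obtain w where w: "\<And>\<kappa>. \<kappa> \<in> hw_weights \<Longrightarrow> w \<kappa> \<in> generated (hw \<kappa>)" "app R.C v - C_value \<mu> *s v = sum w hw_weights"
    unfolding hw_sum_def by blast
  have wC: "app R.C (w \<kappa>) = C_value \<kappa> *s w \<kappa>" if "\<kappa> \<in> hw_weights" for \<kappa>
    using C_gen[OF order.refl w(1)[OF that]] .
  have w_wt: "w \<kappa> \<in> wsp \<mu>" if "\<kappa> \<in> hw_weights" for \<kappa>
  proof (rule C_sum_mem[of "wsp \<mu>" w])
    show "sum w hw_weights \<in> wsp \<mu>"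
      unfolding w(2)[symmetric] using C_wsp v(1) by (intro subspace_diff subspace_scale subspace_wsp)
  qed (use that wC C_wsp subspace_wsp in auto)
  \<comment> \<open>The scalar \<open>c \<kappa>\<close> inverts \<open>C - C_value \<mu>\<close> on
    the component at \<open>\<kappa>\<close>. At \<open>\<kappa> = \<mu>\<close> there is nothing to
    invert; the default 0 leaves this component untouched, and it reappears as
    \<open>r\<close>.\<close>
  define c where "c \<kappa> = (if \<kappa> = \<mu> then 0 else inverse (C_value \<kappa> - C_value \<mu>))" for \<kappa>
  have cc_ne: "C_value \<kappa> - C_value \<mu> \<noteq> 0" if "\<kappa> \<in> hw_weights" "\<kappa> \<noteq> \<mu>" for \<kappa>
    using cc_inj[of \<kappa> \<mu>] that hw_weights_dominant dom \<mu>\<Omega> by (auto simp: hw_weights_def)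
  define s where "s = (\<Sum>\<kappa>\<in>hw_weights. c \<kappa> *s w \<kappa>)"
  define v' where "v' = v - s"
  have sW: "s \<in> ?W"
    unfolding s_def using gen_big[of hw] w(1) by (intro subspace_sum[OF sub] subspace_scale[OF sub]) blast
  have v'W: "v' \<notin> ?W"
    using v(2) subspace_add[OF sub _ sW, of v'] by (auto simp: v'_def)
  have v'_wt: "v' \<in> wsp \<mu>"
    unfolding v'_def s_def using v(1) w_wt by (intro subspace_diff subspace_sum subspace_scale subspace_wsp)
  define r where "r = (if \<mu> \<in> hw_weights then w \<mu> else 0)"
  have r: "app R.C v' - C_value \<mu> *s v' = r"
  proof -
    have "app R.C s - C_value \<mu> *s s = (\<Sum>\<kappa>\<in>hw_weights. (c \<kappa> * (C_value \<kappa> - C_value \<mu>)) *s w \<kappa>)"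
      unfolding s_def app_sum_right scale_sum_right sum_subtractf[symmetric]
      by (intro sum.cong refl) (simp add: C_scale wC right_diff_distrib scale_left_diff_distrib mult.commute)
    also have "\<dots> = (\<Sum>\<kappa>\<in>hw_weights. if \<kappa> = \<mu> then 0 else w \<kappa>)"
      using cc_ne by (intro sum.cong refl) (simp add: c_def)
    finally have "app R.C v' - C_value \<mu> *s v' = (\<Sum>\<kappa>\<in>hw_weights. w \<kappa>) - (\<Sum>\<kappa>\<in>hw_weights. if \<kappa> = \<mu> then 0 else w \<kappa>)"
      using w(2) by (simp add: v'_def scale_right_diff_distrib algebra_simps)
    also have "\<dots> = (\<Sum>\<kappa>\<in>hw_weights. if \<kappa> = \<mu> then w \<kappa> else 0)"
      unfolding sum_subtractf[symmetric] by (intro sum.cong) auto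
    finally show ?thesis using finite_hw_weights by (simp add: r_def)
  qed
  \<comment> \<open>The remainder has weight \<open>\<mu>\<close> inside
    \<open>generated (hw \<mu>)\<close>, so \<open>gen_top\<close> makes it a highest weight vector.
    Raising operators kill it, and therefore take \<open>v'\<close> to vectors on which
    \<open>C\<close> acts exactly by \<open>C_value \<mu>\<close> (\<open>Cu\<close>).\<close>
  have r_hw: "r \<in> hw \<mu>"
  proof (cases "\<mu> \<in> hw_weights")
    case True
    have "w \<mu> \<in> hw \<mu>"
      by (rule gen_top[OF order.refl subspace_hw]) (use hw_cartan w(1) w_wt True in auto)
    then show ?thesis by (simp add: r_def True)
  qed (simp add: r_def subspace_0[OF subspace_hw])
  have "app (L i j) v' = 0" if ij: "i \<in> I" "j \<in> I" "\<bar>j\<bar> < \<bar>i\<bar>" for i j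
  proof -
    let ?u = "app (L i j) v'"
    have hts: "ht \<mu> < ht (shift \<mu> i j)" using ij by (simp add: ht_shift)
    have u_wt: "?u \<in> wsp (shift \<mu> i j)" by (rule wsp_L[OF v'_wt])
    then have "?u \<in> ?W" using above[OF hts] by blast
    then obtain a where a: "\<And>\<kappa>. \<kappa> \<in> hw_weights \<Longrightarrow> a \<kappa> \<in> generated (hw \<kappa>)" "?u = sum a hw_weights"
      unfolding hw_sum_def by blast
    have aC: "app R.C (a \<kappa>) = C_value \<kappa> *s a \<kappa>" if "\<kappa> \<in> hw_weights" for \<kappa>
      using C_gen[OF order.refl a(1)[OF that]] .
    have Cu: "app R.C ?u = C_value \<mu> *s ?u"
    proof -
      have "app R.C ?u - C_value \<mu> *s ?u = app (L i j) (app R.C v' - C_value \<mu> *s v')" by (simp add: C_L L_scale)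
      also have "\<dots> = 0" unfolding r using r_hw ij by (simp add: hw_def)
      finally show ?thesis by simp
    qed
    \<comment> \<open>For \<open>\<kappa> \<noteq> \<mu>\<close> the component has the wrong
      eigenvalue of \<open>C\<close>. For \<open>\<kappa> = \<mu>\<close> its weight is higher than
      anything in \<open>generated (hw \<mu>)\<close>.\<close>
    have "a \<kappa> = 0" if k: "\<kappa> \<in> hw_weights" for \<kappa>
    proof (cases "\<kappa> = \<mu>")
      case False
      have "(C_value \<kappa> - C_value \<mu>) *s a \<kappa> \<in> {0}"
      proof (rule C_sum_mem[of "{0}" "\<lambda>\<kappa>. (C_value \<kappa> - C_value \<mu>) *s a \<kappa>"])
        have "(\<Sum>\<kappa>\<in>hw_weights. (C_value \<kappa> - C_value \<mu>) *s a \<kappa>) = app R.C ?u - C_value \<mu> *s ?u"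
          unfolding a(2) app_sum_right scale_sum_right sum_subtractf[symmetric]
          by (intro sum.cong refl) (simp add: aC scale_left_diff_distrib)
        then show "(\<Sum>\<kappa>\<in>hw_weights. (C_value \<kappa> - C_value \<mu>) *s a \<kappa>) \<in> {0}" using Cu by simp
      qed (use k aC in \<open>auto simp: C_scale scale_left_commute\<close>)
      then show ?thesis using cc_ne[OF k False] by simp
    next
      case True
      have "a \<mu> \<in> wsp (shift \<mu> i j)"
        by (rule C_sum_mem[of _ a]) (use aC a(2) u_wt C_wsp subspace_wsp k True in auto)
      moreover have "a \<mu> \<in> low (ht \<mu> + 1)" using gen_low[of "hw \<mu>" \<mu>] a(1) k True by blast
      ultimately show ?thesis using low_wsp hts True by fastforce
    qed
    then show ?thesis using a(2) by simp
  qed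
  then have v'_hw: "v' \<in> hw \<mu>" using v'_wt by (simp add: hw_def)
  have "v' \<noteq> 0" using v'W subspace_0[OF sub] by auto
  then have "\<mu> \<in> hw_weights" using v'_hw \<mu>\<Omega> by (auto simp: hw_weights_def)
  then have "v' \<in> ?W" using gen_big[of hw \<mu>] gen_superset v'_hw by blast
  then show False using v'W by simp
qed

text \<open>A nonzero intersection of \<open>M\<close> with the candidate \<open>hw_sum Y\<close>
  would contain a highest weight vector. \<open>C\<close> places it in a single
  \<open>generated (Y \<nu>)\<close>, and \<open>gen_top\<close> in \<open>Y \<nu>\<close> itself,
  which meets \<open>M\<close> only in 0. The sum is everything since it contains every
  \<open>hw \<kappa>\<close>.\<close>

theorem complement:
  assumes M: "submod M"
  shows "\<exists>N. submod N \<and> M \<inter> N = {0} \<and> (\<forall>v. \<exists>x\<in>M. \<exists>y\<in>N. v = x + y)"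
proof -
  have stM: "stable M" using M by (simp add: submod_def)
  note subM = stable_subspace[OF stM]
  obtain Y where Y: "\<And>\<kappa>. \<kappa> \<in> \<Omega> \<Longrightarrow> subspace (Y \<kappa>) \<and> Y \<kappa> \<subseteq> hw \<kappa> \<and> (\<forall>v\<in>Y \<kappa>. app sg v \<in> Y \<kappa>) \<and>
    (\<forall>k\<in>I. \<forall>l\<in>I. \<bar>k\<bar> = \<bar>l\<bar> \<longrightarrow> (\<forall>v\<in>Y \<kappa>. app (L k l) v \<in> Y \<kappa>)) \<and> M \<inter> Y \<kappa> = {0} \<and>
    (\<forall>v\<in>hw \<kappa>. \<exists>x\<in>M \<inter> hw \<kappa>. \<exists>y\<in>Y \<kappa>. v = x + y)"
    using clifford_complement[OF M] by metis
  have hw_weights\<Omega>: "\<kappa> \<in> hw_weights \<Longrightarrow> \<kappa> \<in> \<Omega>" for \<kappa> by (simp add: hw_weights_def)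
  have Yhw: "\<kappa> \<in> hw_weights \<Longrightarrow> Y \<kappa> \<subseteq> hw \<kappa>" for \<kappa> using Y hw_weights\<Omega> by blast
  let ?N = "hw_sum Y"
  have stN: "stable ?N" by (rule stable_big[OF Yhw])
  note subN = stable_subspace[OF stN]
  have sgN: "app sg x \<in> ?N" if x: "x \<in> ?N" for x
  proof -
    obtain f where "\<forall>\<kappa>\<in>hw_weights. f \<kappa> \<in> generated (Y \<kappa>)" "x = sum f hw_weights" using x unfolding hw_sum_def by blast
    then show ?thesis
      unfolding hw_sum_def using sg_gen[OF Yhw] Y hw_weights\<Omega>
      by (intro CollectI exI[of _ "\<lambda>\<kappa>. app sg (f \<kappa>)"]) (simp add: app_sum_right)
  qed
  have inter: "M \<inter> ?N = {0}"
  proof (rule ccontr)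
    assume ne: "M \<inter> ?N \<noteq> {0}"
    have "stable (M \<inter> ?N)"
      using stM stN by (auto simp: stable_def intro: subspace_inter)
    then obtain \<nu> v where v: "\<nu> \<in> \<Omega>" "v \<in> M" "v \<in> ?N" "v \<in> hw \<nu>" "v \<noteq> 0"
      using exists_hw ne by blast
    then have \<nu>: "\<nu> \<in> hw_weights" by (auto simp: hw_weights_def)
    obtain w where w: "\<And>\<kappa>. \<kappa> \<in> hw_weights \<Longrightarrow> w \<kappa> \<in> generated (Y \<kappa>)" "v = sum w hw_weights"
      using v(3) unfolding hw_sum_def by blast
    define u where "u \<kappa> = (if \<kappa> = \<nu> then w \<kappa> - v else w \<kappa>)" for \<kappa>
    have Cv: "app R.C v = C_value \<nu> *s v" using C_gen[OF order.refl, of v \<nu>] v(4) gen_superset by blast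
    have "sum u hw_weights = 0"
    proof -
      have "sum u hw_weights = (\<Sum>\<kappa>\<in>hw_weights. w \<kappa> - (if \<kappa> = \<nu> then v else 0))" by (rule sum.cong) (auto simp: u_def)
      then show ?thesis using w(2) finite_hw_weights \<nu> by (simp add: sum_subtractf)
    qed
    then have "u \<nu> \<in> {0}"
      using C_gen[OF Yhw w(1)] Cv \<nu>
      by (intro C_sum_mem[of "{0}" u]) (auto simp: u_def scale_right_diff_distrib)
    then have "v = w \<nu>" by (simp add: u_def)
    then have "v \<in> generated (Y \<nu>)" using w(1)[OF \<nu>] by simp
    moreover have "Y \<nu> \<subseteq> hw \<nu>" "subspace (Y \<nu>)" "M \<inter> Y \<nu> = {0}" using Y[OF v(1)] by blast+
    moreover have "app (L k l) x \<in> Y \<nu>" if "x \<in> Y \<nu>" "k \<in> I" "l \<in> I" "\<bar>k\<bar> = \<bar>l\<bar>" for k l x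
      using Y[OF v(1)] that by blast
    moreover have "v \<in> wsp \<nu>" using v(4) hw_wsp by blast
    ultimately have "v \<in> Y \<nu>" using gen_top[of "Y \<nu>" \<nu> v] by blast
    then show False using \<open>M \<inter> Y \<nu> = {0}\<close> v(2,5) by blast
  qed
  have sum: "\<exists>x\<in>M. \<exists>y\<in>?N. v = x + y" for v
  proof -
    let ?S = "{x + y |x y. x \<in> M \<and> y \<in> ?N}"
    have subS: "subspace ?S" by (rule subspace_sums[OF subM subN])
    have "app (L i j) (x + y) \<in> ?S" if "x \<in> M" "y \<in> ?N" for i j x y
      using stable_L[OF stM that(1), of i j] stable_L[OF stN that(2), of i j] app_add_right[of "L i j" x y] by blast
    then have stS: "stable ?S" using subS by (auto simp: stable_def)
    have hwS: "hw \<kappa> \<subseteq> ?S" if k: "\<kappa> \<in> hw_weights" for \<kappa>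
    proof
      fix u assume "u \<in> hw \<kappa>"
      then obtain x y where "x \<in> M" "y \<in> Y \<kappa>" "u = x + y" using Y[OF hw_weights\<Omega>[OF k]] by blast
      moreover have "Y \<kappa> \<subseteq> ?N" using gen_big[OF Yhw k] gen_superset[of "Y \<kappa>"] by (rule order.trans[rotated])
      ultimately show "u \<in> ?S" by blast
    qed
    have "v \<in> hw_sum hw" using generated_by_hw by simp
    then obtain g where g: "\<forall>\<kappa>\<in>hw_weights. g \<kappa> \<in> generated (hw \<kappa>)" "v = sum g hw_weights"
      unfolding hw_sum_def by blast
    have "g \<kappa> \<in> ?S" if "\<kappa> \<in> hw_weights" for \<kappa>
      by (rule subsetD[OF gen_least[OF stS hwS[OF that]]]) (use g(1) that in simp)
    then have "sum g hw_weights \<in> ?S" by (rule subspace_sum[OF subS])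
    then show ?thesis unfolding g(2) by blast
  qed
  have "submod ?N" using stN sgN by (simp add: submod_def)
  then show ?thesis using inter sum by blast
qed

end

section \<open>Direct sums of irreducible submodules\<close>

text \<open>Finiteness, existence and independence are listed separately; this form is easier to
  extend by one summand than the unique existence in \<open>internal_direct_sum\<close>.\<close>

definition direct_family :: "'v::comm_monoid_add set set \<Rightarrow> 'v set \<Rightarrow> bool" where
  "direct_family S M \<longleftrightarrow> finite S \<and> (\<forall>W\<in>S. W \<subseteq> M) \<and>
    (\<forall>v\<in>M. \<exists>f. (\<forall>W\<in>S. f W \<in> W) \<and> v = sum f S) \<and>
    (\<forall>f. (\<forall>W\<in>S. f W \<in> W) \<longrightarrow> sum f S = 0 \<longrightarrow> (\<forall>W\<in>S. f W = 0))"

context vector_space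
begin

lemma direct_family_internal_direct_sum:
  fixes S :: "'b set set" and M :: "'b set"
  assumes d: "direct_family S M" and sub: "\<And>W :: 'b set. W \<in> S \<Longrightarrow> subspace W"
  shows "internal_direct_sum S (\<lambda>W. W) M"
  unfolding internal_direct_sum_def
proof (intro conjI ballI)
  have fin: "finite S" using d by (simp add: direct_family_def)
  show "W \<subseteq> M" if "W \<in> S" for W using d that by (simp add: direct_family_def)
  fix v assume "v \<in> M"
  then obtain f where f: "\<forall>W\<in>S. f W \<in> W" "v = sum f S" using d unfolding direct_family_def by blast
  have nz: "(\<Sum>i | g i \<noteq> 0. g i) = sum g S" "finite {i. g i \<noteq> 0}" if "\<forall>i. i \<notin> S \<longrightarrow> g i = 0" for g :: "'b set \<Rightarrow> 'b"
  proof -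
    have "{i. g i \<noteq> 0} \<subseteq> S" using that by blast
    then show "(\<Sum>i | g i \<noteq> 0. g i) = sum g S" "finite {i. g i \<noteq> 0}"
      using fin by (auto intro: sum.mono_neutral_left finite_subset)
  qed
  define g where "g W = (if W \<in> S then f W else 0)" for W
  have gS: "sum g S = v" using f(2) by (simp add: g_def)
  show "\<exists>!f. (\<forall>i\<in>S. f i \<in> i) \<and> (\<forall>i. i \<notin> S \<longrightarrow> f i = 0) \<and> finite {i. f i \<noteq> 0} \<and> v = (\<Sum>i | f i \<noteq> 0. f i)"
  proof (intro ex1I[of _ g] conjI)
    have g0: "\<forall>i. i \<notin> S \<longrightarrow> g i = 0" by (simp add: g_def)
    then show "\<forall>i. i \<notin> S \<longrightarrow> g i = 0" .
    show "finite {i. g i \<noteq> 0}" by (rule nz(2)[OF g0])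
    show "v = (\<Sum>i | g i \<noteq> 0. g i)" unfolding nz(1)[OF g0] gS ..
    show "\<forall>i\<in>S. g i \<in> i" using f(1) by (simp add: g_def)
    fix h assume h: "(\<forall>i\<in>S. h i \<in> i) \<and> (\<forall>i. i \<notin> S \<longrightarrow> h i = 0) \<and> finite {i. h i \<noteq> 0} \<and> v = (\<Sum>i | h i \<noteq> 0. h i)"
    then have "v = sum h S" using nz(1)[of h] by simp
    then have "(\<Sum>W\<in>S. h W - g W) = 0" by (simp add: sum_subtractf gS)
    moreover have "\<forall>W\<in>S. h W - g W \<in> W"
    proof
      fix W assume W: "W \<in> S"
      show "h W - g W \<in> W"
        by (rule subspace_diff[OF sub[OF W]]) (use h f(1) W in \<open>auto simp: g_def\<close>)
    qed
    ultimately have "\<forall>W\<in>S. h W - g W = 0"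
      using d[unfolded direct_family_def, THEN conjunct2, THEN conjunct2, THEN conjunct2, THEN spec, of "\<lambda>W. h W - g W"]
      by simp
    then have "h W = g W" for W using h by (cases "W \<in> S") (auto simp: g_def)
    then show "h = g" by (rule ext)
  qed
qed

text \<open>A nonzero \<open>A\<close> of least dimension inside \<open>M\<close> is irreducible. If
  \<open>N\<close> complements \<open>A\<close> in the whole space, then \<open>M \<inter> N\<close>
  complements it in \<open>M\<close> by the modular law, and induction on the dimension applies to
  \<open>M \<inter> N\<close>.\<close>

lemma semisimple_decomposition:
  fixes P :: "'b set \<Rightarrow> bool"
  assumes fin: "\<exists>B. finite B \<and> span B = UNIV"
    and sub: "\<And>M. P M \<Longrightarrow> subspace M" and "P UNIV"
    and inter: "\<And>M N. P M \<Longrightarrow> P N \<Longrightarrow> P (M \<inter> N)"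
    and compl: "\<And>M. P M \<Longrightarrow> \<exists>N. P N \<and> M \<inter> N = {0} \<and> (\<forall>v. \<exists>x\<in>M. \<exists>y\<in>N. v = x + y)"
  shows "\<exists>S. (\<forall>W\<in>S. P W \<and> W \<noteq> {0} \<and> (\<forall>W'. P W' \<and> W' \<subseteq> W \<longrightarrow> W' = {0} \<or> W' = W)) \<and>
    internal_direct_sum S (\<lambda>W. W) UNIV"
proof -
  obtain B where B: "finite B" "span B = UNIV" using fin by blast
  obtain Bs where Bs: "independent Bs" "UNIV \<subseteq> span Bs" using basis_exists[of UNIV] by blast
  have "finite Bs" using independent_span_bound[OF B(1) Bs(1)] B(2) by simp
  interpret fd: finite_dimensional_vector_space scale Bs
    by unfold_locales (use Bs \<open>finite Bs\<close> in auto)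
  define irr where "irr W \<longleftrightarrow> P W \<and> W \<noteq> {0} \<and> (\<forall>W'. P W' \<and> W' \<subseteq> W \<longrightarrow> W' = {0} \<or> W' = W)" for W
  have "\<exists>S. (\<forall>W\<in>S. irr W) \<and> direct_family S M" if "P M" for M
    using that
  proof (induction "dim M" arbitrary: M rule: less_induct)
    case less
    note M = \<open>P M\<close>
    show ?case
    proof (cases "M = {0}")
      case True
      then show ?thesis by (intro exI[of _ "{}"]) (simp add: direct_family_def)
    next
      case False
      obtain A where A: "P A" "A \<noteq> {0}" "A \<subseteq> M" and least: "\<And>A'. P A' \<Longrightarrow> A' \<noteq> {0} \<Longrightarrow> A' \<subseteq> M \<Longrightarrow> dim A \<le> dim A'"
        using ex_has_least_nat[of "\<lambda>A. P A \<and> A \<noteq> {0} \<and> A \<subseteq> M" M dim] M False by blast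
      have irrA: "irr A"
        unfolding irr_def
      proof (intro conjI allI impI)
        fix W' assume W': "P W' \<and> W' \<subseteq> A"
        show "W' = {0} \<or> W' = A"
        proof (cases "W' = {0}")
          case False
          then have "dim A \<le> dim W'" using least[of W'] W' A(3) by blast
          then show ?thesis using fd.subspace_dim_equal[of W' A] W' A(1) sub by blast
        qed simp
      qed (use A in auto)
      obtain N where N: "P N" "A \<inter> N = {0}" "\<And>v. \<exists>x\<in>A. \<exists>y\<in>N. v = x + y" using compl[OF A(1)] by blast
      define K where "K = M \<inter> N"
      have K: "P K" using inter M N(1) by (simp add: K_def)
      have A0: "0 \<in> A" using subspace_0[OF sub[OF A(1)]] .
      have AK: "A \<inter> K = {0}" using N(2) A0 subspace_0[OF sub[OF K]] by (auto simp: K_def)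
      have "K \<noteq> M" using AK A(2,3) by blast
      then have "dim K < dim M"
        using fd.subspace_dim_equal[of K M] fd.dim_subset[of K M] sub[OF K] sub[OF M] by (metis K_def inf_le1 not_le_imp_less)
      then obtain S where S: "\<forall>W\<in>S. irr W" "direct_family S K" using less.hyps K by blast
      have finS: "finite S" and SK: "\<And>W. W \<in> S \<Longrightarrow> W \<subseteq> K" using S(2) by (auto simp: direct_family_def)
      have AS: "A \<notin> S" using SK AK A(2) A0 by blast
      have sumK: "sum f S \<in> K" if "\<forall>W\<in>S. f W \<in> W" for f
        using that SK by (intro subspace_sum[OF sub[OF K]]) blast
      have "direct_family (insert A S) M"
        unfolding direct_family_def
      proof (intro conjI ballI allI impI)
        show "finite (insert A S)" using finS by simp
        show "W \<subseteq> M" if "W \<in> insert A S" for W using that A(3) SK by (auto simp: K_def)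
        show "\<exists>f. (\<forall>W\<in>insert A S. f W \<in> W) \<and> v = sum f (insert A S)" if v: "v \<in> M" for v
        proof -
          obtain x y where xy: "x \<in> A" "y \<in> N" "v = x + y" using N(3) by blast
          have "v - x \<in> M" by (rule subspace_diff[OF sub[OF M] v]) (use xy(1) A(3) in blast)
          then have "y \<in> K" using xy(2,3) by (simp add: K_def)
          then obtain f where f: "\<forall>W\<in>S. f W \<in> W" "y = sum f S" using S(2) unfolding direct_family_def by blast
          have "sum (f(A := x)) S = sum f S" using AS by (intro sum.cong) auto
          then show ?thesis
            using xy f AS finS by (intro exI[of _ "f(A := x)"]) auto
        qed
        fix f W assume f: "\<forall>W\<in>insert A S. f W \<in> W" "sum f (insert A S) = 0" "W \<in> insert A S"
        have 1: "f A + sum f S = 0" using f(2) AS finS by simp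
        then have "f A = - sum f S" by (simp add: eq_neg_iff_add_eq_0)
        then have "f A \<in> K" using sumK f(1) subspace_neg[OF sub[OF K]] by simp
        then have fA: "f A = 0" using f(1) AK by blast
        then have "sum f S = 0" using 1 by simp
        then have "\<forall>W\<in>S. f W = 0"
          using S(2)[unfolded direct_family_def, THEN conjunct2, THEN conjunct2, THEN conjunct2, THEN spec, of f] f(1) by simp
        then show "f W = 0" using fA f(3) by blast
      qed
      then show ?thesis using S(1) irrA by (intro exI[of _ "insert A S"]) simp
    qed
  qed
  then obtain S where "\<forall>W\<in>S. irr W" "direct_family S UNIV" using \<open>P UNIV\<close> by blast
  then show ?thesis
    using direct_family_internal_direct_sum[of S UNIV] sub unfolding irr_def by blast
qed

end

section \<open>Modules over the quantum queer superalgebra\<close>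

lemma proj_ring_hom: "proj n \<in> ring_hom (free_algebra n) (Uq n)"
  using ideal.rcos_ring_hom[OF ideal_rel_ideal] unfolding proj_def[abs_def] Uq_def .

lemma carrier_Uq: "carrier (Uq n) = proj n ` carrier (free_algebra n)"
  by (auto simp: Uq_def FactRing_def A_RCOSETS_def' proj_def)

lemma proj_relator:
  assumes "r \<in> relators n" shows "proj n r = \<zero>\<^bsub>Uq n\<^esub>"
proof -
  have "r \<in> rel_ideal n"
    using ring.genideal_self[OF ring_free_algebra relators_subset] assms unfolding rel_ideal_def by blast
  then show ?thesis
    using ring.a_rcos_zero[OF ring_free_algebra ideal_rel_ideal] by (simp add: proj_def Uq_def FactRing_def)
qed

lemma sum_single: "(x :: 'a \<Rightarrow>\<^sub>0 'b::comm_monoid_add) = (\<Sum>w\<in>Poly_Mapping.keys x. Poly_Mapping.single w (Poly_Mapping.lookup x w))"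
  by (rule poly_mapping_eqI)
    (simp add: lookup_sum lookup_single when_def sum.delta in_keys_iff)

lemma scalar_central: "scalar c * x = x * scalar c"
proof -
  let ?s = "\<lambda>w. Poly_Mapping.single w (Poly_Mapping.lookup x w)"
  have "scalar c * ?s w = ?s w * scalar c" for w
    unfolding scalar_def mult_single by (simp add: mult.commute)
  then have "scalar c * (\<Sum>w\<in>Poly_Mapping.keys x. ?s w) = (\<Sum>w\<in>Poly_Mapping.keys x. ?s w) * scalar c"
    by (simp add: sum_distrib_left sum_distrib_right)
  then show ?thesis by (simp flip: sum_single)
qed

lemma single_word_Cons: "Poly_Mapping.single (Word ((i, j) # ls)) (1 :: Cq) = gen i j * Poly_Mapping.single (Word ls) 1"
  by (simp add: gen_def mult_single plus_word_def)

lemma single_scalar: "Poly_Mapping.single w c = scalar c * Poly_Mapping.single w (1 :: Cq)"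
  by (simp add: scalar_def mult_single)

lemma scalar_0: "scalar 0 = 0"
  by (simp add: scalar_def)

context Uq_module
begin

text \<open>Pulling the action back to the free algebra allows computing with representatives
  instead of cosets.\<close>

definition act_free :: "free \<Rightarrow> 'v \<Rightarrow> 'v" where
  "act_free x = act (proj n x)"

lemma proj_closed: "x \<in> carrier (free_algebra n) \<Longrightarrow> proj n x \<in> carrier (Uq n)"
  by (simp add: carrier_Uq)

lemma act_free_add_right: "x \<in> carrier (free_algebra n) \<Longrightarrow> act_free x (v + w) = act_free x v + act_free x w"
  by (simp add: act_free_def act_add_right proj_closed)

lemma act_free_add: "x \<in> carrier (free_algebra n) \<Longrightarrow> y \<in> carrier (free_algebra n) \<Longrightarrow> act_free (x + y) v = act_free x v + act_free y v"
  using ring_hom_add[OF proj_ring_hom, of x n y] act_add_left[of "proj n x" "proj n y" v] proj_closed[of x] proj_closed[of y]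
  by (simp add: act_free_def free_algebra_sel)

lemma act_free_mult: "x \<in> carrier (free_algebra n) \<Longrightarrow> y \<in> carrier (free_algebra n) \<Longrightarrow> act_free (x * y) v = act_free x (act_free y v)"
  using ring_hom_mult[OF proj_ring_hom, of x n y] act_mult[of "proj n x" "proj n y" v] proj_closed[of x] proj_closed[of y]
  by (simp add: act_free_def free_algebra_sel)

lemma act_free_scalar: "act_free (scalar c) v = c *s v"
  by (simp add: act_free_def act_scalar)

lemma act_free_one: "act_free 1 v = v"
  using act_free_scalar[of 1 v] by (simp add: scalar_def)

lemma act_free_zero: "act_free 0 v = 0"
  using act_free_scalar[of 0 v] by (simp add: scalar_0)

lemma act_free_diff: "x \<in> carrier (free_algebra n) \<Longrightarrow> y \<in> carrier (free_algebra n) \<Longrightarrow> act_free (x - y) v = act_free x v - act_free y v"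
  using act_free_add[of "x - y" y v] free_algebra_closed(5)[of x n y] by simp

lemma act_free_sum: "(\<And>w. w \<in> S \<Longrightarrow> f w \<in> carrier (free_algebra n)) \<Longrightarrow> act_free (sum f S) v = (\<Sum>w\<in>S. act_free (f w) v) \<and> sum f S \<in> carrier (free_algebra n)"
  by (induction S rule: infinite_finite_induct) (simp_all add: act_free_zero act_free_add free_algebra_closed)

lemma act_free_scale: "x \<in> carrier (free_algebra n) \<Longrightarrow> act_free x (c *s v) = c *s act_free x v"
  using act_free_mult[of x "scalar c" v] act_free_mult[of "scalar c" x v] free_algebra_closed(2)[of c n]
  by (simp add: scalar_central act_free_scalar)

lemma act_free_relator:
  assumes "r \<in> relators n" shows "act_free r v = 0"
proof -
  have "act \<zero>\<^bsub>Uq n\<^esub> v = act_free 0 v"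
    using ring_hom_zero[OF proj_ring_hom ring_free_algebra ring_Uq] by (simp add: act_free_def free_algebra_sel)
  then show ?thesis using proj_relator[OF assms] act_free_zero[of v] by (simp add: act_free_def)
qed

definition gen_op :: "int \<Rightarrow> int \<Rightarrow> 'v endo" where
  "gen_op i j = (if (i, j) \<in> generators n then Endo (act_free (gen i j)) else 0)"

lemma app_Lop: "(i, j) \<in> generators n \<Longrightarrow> app (gen_op i j) v = act_free (gen i j) v"
  unfolding gen_op_def by (simp add: Endo_inverse act_free_add_right free_algebra_closed)

text \<open>The premise is conditional because relators contain letters outside
  \<open>generators\<close>, but only in terms with coefficient 0.\<close>

lemma act_free_term:
  assumes "c \<noteq> 0 \<Longrightarrow> (a, b) \<in> generators n \<and> (d, e) \<in> generators n"
  shows "act_free (scalar c * gen a b * gen d e) v = c *s app (gen_op a b) (app (gen_op d e) v) \<and>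
    scalar c * gen a b * gen d e \<in> carrier (free_algebra n)"
proof (cases "c = 0")
  case True
  then show ?thesis by (simp add: scalar_0 act_free_zero free_algebra_closed)
next
  case False
  then have g: "gen a b \<in> carrier (free_algebra n)" "gen d e \<in> carrier (free_algebra n)"
    using assms free_algebra_closed(7) by blast+
  then show ?thesis
    using False assms free_algebra_closed(2)[of c n]
    by (simp add: act_free_mult act_free_scalar app_Lop free_algebra_closed(6))
qed

lemma act_free_bool_term:
  assumes "P \<longrightarrow> (a, b) \<in> generators n \<and> (d, e) \<in> generators n"
  shows "act_free (scalar (of_bool P * c * c') * gen a b * gen d e) v = (of_bool P * c * c') *s app (gen_op a b) (app (gen_op d e) v) \<and>
    scalar (of_bool P * c * c') * gen a b * gen d e \<in> carrier (free_algebra n)"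
  by (rule act_free_term) (use assms in \<open>cases P; simp\<close>)

sublocale Q: queer_ops scale n gen_op
proof (intro queer_ops.intro queer_ops_axioms.intro vector_space_axioms)
  show "app (gen_op i j) (c *s v) = c *s app (gen_op i j) v" for i j c v
    by (cases "(i, j) \<in> generators n") (simp_all add: app_Lop act_free_scale free_algebra_closed, simp add: gen_op_def)
  show "gen_op i j = 0" if "(i, j) \<notin> generators n" for i j
    using that by (simp add: gen_op_def)
  show "gen_op i i * gen_op (- i) (- i) = 1" if i: "i \<in> indices n" for i
  proof (rule endo_eqI)
    fix v
    have g: "(i, i) \<in> generators n" "(- i, - i) \<in> generators n" using i by (auto simp: generators_def indices_def)
    then have c: "gen i i \<in> carrier (free_algebra n)" "gen (- i) (- i) \<in> carrier (free_algebra n)"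
      using free_algebra_closed(7) by blast+
    have "act_free (gen i i * gen (- i) (- i) - 1) v = 0"
      by (rule act_free_relator) (use i in \<open>auto simp: relators_def\<close>)
    then show "app (gen_op i i * gen_op (- i) (- i)) v = app 1 v"
      using g c by (simp add: act_free_diff act_free_mult act_free_one app_Lop free_algebra_closed(6) one_free_algebra_closed)
  qed
  show "L_relation (\<lambda>c. Endo (scale c)) gen_op i j k l" if g: "(i, j) \<in> generators n" "(k, l) \<in> generators n" for i j k l
    unfolding L_relation_def
  proof (rule endo_eqI)
    fix v
    have sc: "app (Endo (scale c)) w = c *s w" for c w
      by (subst Endo_inverse) (simp_all add: scale_right_distrib)
    have "relator i j k l \<in> relators n" using g by (auto simp: relators_def)
    then have r0: "act_free (relator i j k l) v = 0" by (rule act_free_relator)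
    have G: "(a, b) \<in> generators n \<longleftrightarrow> a \<noteq> 0 \<and> b \<noteq> 0 \<and> \<bar>a\<bar> \<le> int n \<and> \<bar>b\<bar> \<le> int n \<and> a \<le> b" for a b
      by (auto simp: generators_def indices_def)
    note g' = g[unfolded G]
    have g2: "k \<le> j \<and> j < l \<longrightarrow> (i, l) \<in> generators n \<and> (k, j) \<in> generators n" using g'  by (auto simp: G)
    have g3: "i \<le> - l \<and> - l < j \<and> j \<le> - k \<longrightarrow> (i, - l) \<in> generators n \<and> (k, - j) \<in> generators n" using g'  by (auto simp: G)
    have g5: "k < i \<and> i \<le> l \<longrightarrow> (i, l) \<in> generators n \<and> (k, j) \<in> generators n" using g'  by (auto simp: G)
    have g6: "- l \<le> i \<and> i < - k \<and> - k \<le> j \<longrightarrow> (- i, l) \<in> generators n \<and> (- k, j) \<in> generators n" using g'  by (auto simp: G)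
    note t1 = act_free_term[OF conjI[OF g], of "(- 1) ^ (par i j * par k l) * qq powi \<phi> j l" v]
      and t4 = act_free_term[OF conjI[OF g(2,1)], of "qq powi \<phi> i k" v]
    note t2 = act_free_bool_term[OF g2, of "of_int (\<theta> i j k)" "qq - inverse qq" v]
      and t3 = act_free_bool_term[OF g3, of "of_int (\<theta> (- i) (- j) k)" "qq - inverse qq" v]
      and t5 = act_free_bool_term[OF g5, of "of_int (\<theta> i j k)" "qq - inverse qq" v]
      and t6 = act_free_bool_term[OF g6, of "of_int (\<theta> (- i) (- j) k)" "qq - inverse qq" v]
    note cl = t1[THEN conjunct2] t2[THEN conjunct2] t3[THEN conjunct2] t4[THEN conjunct2] t5[THEN conjunct2] t6[THEN conjunct2]
    note va = t1[THEN conjunct1] t2[THEN conjunct1] t3[THEN conjunct1] t4[THEN conjunct1] t5[THEN conjunct1] t6[THEN conjunct1]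
    note cl2 = free_algebra_closed(4)[OF cl(1,2)] free_algebra_closed(4)[OF cl(4,5)]
    note cl3 = free_algebra_closed(4)[OF cl2(1) cl(3)] free_algebra_closed(4)[OF cl2(2) cl(6)]
    note r1 = r0[unfolded relator_def act_free_diff[OF cl3] act_free_add[OF cl2(1) cl(3)] act_free_add[OF cl2(2) cl(6)]
        act_free_add[OF cl(1,2)] act_free_add[OF cl(4,5)] va right_minus_eq]
    show "app (Endo (scale ((- 1) ^ (par i j * par k l) * qq powi \<phi> j l)) * gen_op i j * gen_op k l
     + Endo (scale (of_bool (k \<le> j \<and> j < l) * of_int (\<theta> i j k) * (qq - inverse qq))) * gen_op i l * gen_op k j
     + Endo (scale (of_bool (i \<le> - l \<and> - l < j \<and> j \<le> - k) * of_int (\<theta> (- i) (- j) k) * (qq - inverse qq)))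
         * gen_op i (- l) * gen_op k (- j)) v
    = app (Endo (scale (qq powi \<phi> i k)) * gen_op k l * gen_op i j
       + Endo (scale (of_bool (k < i \<and> i \<le> l) * of_int (\<theta> i j k) * (qq - inverse qq))) * gen_op i l * gen_op k j
       + Endo (scale (of_bool (- l \<le> i \<and> i < - k \<and> - k \<le> j) * of_int (\<theta> (- i) (- j) k) * (qq - inverse qq)))
           * gen_op (- i) l * gen_op (- k) j) v"
      unfolding app_simps sc by (rule r1)
  qed
qed

end

lemma bit_family_eq: "(\<Sum>i | (f :: bit \<Rightarrow> 'a::comm_monoid_add) i \<noteq> 0. f i) = f 0 + f 1"
proof -
  have U: "(UNIV :: bit set) = {0, 1}" using bit_not_zero_iff by auto
  have "(\<Sum>i | f i \<noteq> 0. f i) = sum f UNIV"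
    by (rule sum.mono_neutral_left) (auto simp: U)
  then show ?thesis by (simp add: U)
qed

lemma finite_bit: "finite (S :: bit set)"
  by (rule finite_subset[of _ "{0, 1}"]) (use bit_not_zero_iff in auto)

lemma internal_direct_sumD:
  assumes "internal_direct_sum J F X" "v \<in> X"
  obtains f where "\<And>i. i \<in> J \<Longrightarrow> f i \<in> F i" "\<And>i. i \<notin> J \<Longrightarrow> f i = 0" "finite {i. f i \<noteq> 0}" "v = (\<Sum>i | f i \<noteq> 0. f i)"
proof -
  have "\<exists>!f. (\<forall>i\<in>J. f i \<in> F i) \<and> (\<forall>i. i \<notin> J \<longrightarrow> f i = 0) \<and> finite {i. f i \<noteq> 0} \<and> v = (\<Sum>i | f i \<noteq> 0. f i)"
    by (rule assms(1)[unfolded internal_direct_sum_def, THEN conjunct2, THEN bspec, OF assms(2)])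
  from ex1_implies_ex[OF this] obtain f where
    "(\<forall>i\<in>J. f i \<in> F i) \<and> (\<forall>i. i \<notin> J \<longrightarrow> f i = 0) \<and> finite {i. f i \<noteq> 0} \<and> v = (\<Sum>i | f i \<noteq> 0. f i)" ..
  then show thesis by (intro that[of f]) auto
qed

section \<open>The parity involution and graded submodules\<close>

context Uq_module
begin

lemma part_ex: "\<exists>x\<in>part 0. \<exists>y\<in>part 1. v = x + y"
proof -
  obtain f where "\<And>i. f i \<in> part i" "v = (\<Sum>i | f i \<noteq> 0. f i)"
    by (rule internal_direct_sumD[OF direct_sum_part, of v]) auto
  then show ?thesis unfolding bit_family_eq by blast
qed

lemma part_unique:
  assumes "x \<in> part 0" "y \<in> part 1" "x' \<in> part 0" "y' \<in> part 1" "x + y = x' + y'"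
  shows "x = x' \<and> y = y'"
proof -
  define F where "F f \<longleftrightarrow> (\<forall>i\<in>UNIV. f i \<in> part i) \<and> (\<forall>i. i \<notin> UNIV \<longrightarrow> f i = 0) \<and>
       finite {i. f i \<noteq> 0} \<and> x + y = (\<Sum>i | f i \<noteq> 0. f i)" for f
  define g where "g a b = (\<lambda>i :: bit. if i = 0 then a else (b :: 'v))" for a b
  have "\<exists>!f. F f" using direct_sum_part unfolding internal_direct_sum_def F_def by blast
  moreover have "F (g x y)" "F (g x' y')"
    using assms bit_not_zero_iff by (auto simp: F_def bit_family_eq finite_bit g_def)
  ultimately have "g x y = g x' y'" by blast
  then have "g x y 0 = g x' y' 0" "g x y 1 = g x' y' 1" by simp_all
  then show ?thesis by (simp add: g_def)
qed

definition flip_odd :: "'v \<Rightarrow> 'v" where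
  "flip_odd v = (THE w. \<exists>x\<in>part 0. \<exists>y\<in>part 1. v = x + y \<and> w = x - y)"

lemma sgf_sum:
  assumes "x \<in> part 0" "y \<in> part 1"
  shows "flip_odd (x + y) = x - y"
  unfolding flip_odd_def
proof (rule the_equality)
  show "\<exists>x'\<in>part 0. \<exists>y'\<in>part 1. x + y = x' + y' \<and> x - y = x' - y'" using assms by blast
  show "w = x - y" if "\<exists>x'\<in>part 0. \<exists>y'\<in>part 1. x + y = x' + y' \<and> w = x' - y'" for w
    using that part_unique[OF assms] by auto
qed

definition sg :: "'v endo" where
  "sg = Endo flip_odd"

lemmas part_add = subspace_add[OF subspace_part]
lemmas part_scale = subspace_scale[OF subspace_part]
lemmas part_0 = subspace_0[OF subspace_part]

lemma app_sg:
  assumes "x \<in> part 0" "y \<in> part 1"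
  shows "app sg (x + y) = x - y"
proof -
  have "flip_odd (v + w) = flip_odd v + flip_odd w" for v w
  proof -
    obtain x y x' y' where d: "x \<in> part 0" "y \<in> part 1" "v = x + y" "x' \<in> part 0" "y' \<in> part 1" "w = x' + y'"
      using part_ex[of v] part_ex[of w] by blast
    have "v + w = (x + x') + (y + y')" by (simp add: d(3,6) algebra_simps)
    then have "flip_odd (v + w) = (x + x') - (y + y')" using d by (simp only: sgf_sum part_add)
    then show ?thesis using d by (simp add: sgf_sum)
  qed
  then show ?thesis unfolding sg_def using sgf_sum[OF assms] by (simp add: Endo_inverse)
qed

lemma sg_even: "x \<in> part 0 \<Longrightarrow> app sg x = x" and sg_odd: "y \<in> part 1 \<Longrightarrow> app sg y = - y"
  using app_sg[of x 0] app_sg[of 0 y] part_0 by simp_all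

lemma sg_sg: "app sg (app sg v) = v"
proof -
  obtain x y where d: "x \<in> part 0" "y \<in> part 1" "v = x + y" using part_ex by blast
  then show ?thesis by (simp add: sg_even sg_odd app_add_right)
qed

lemma sg_scale: "app sg (c *s v) = c *s app sg v"
proof -
  obtain x y where d: "x \<in> part 0" "y \<in> part 1" "v = x + y" using part_ex by blast
  then show ?thesis
    by (simp add: scale_right_distrib scale_right_diff_distrib app_add_right sg_even sg_odd part_scale)
qed

lemma Lop_part:
  assumes g: "(i, j) \<in> generators n" and v: "v \<in> part b"
  shows "app (gen_op i j) v \<in> part (of_nat (par i j) + b)"
proof -
  have "proj n (gen i j) \<in> Uq_part n (of_nat (par i j))"
    unfolding Uq_part_def
    by (rule imageI) (simp add: free_algebra_closed(7)[OF g], simp add: gen_def word_parity_def)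
  then show ?thesis using act_part v app_Lop[OF g, of v] by (simp add: act_free_def)
qed

lemma sg_Lop: "i \<in> indices n \<Longrightarrow> j \<in> indices n \<Longrightarrow> app sg (app (gen_op i j) v) = app (pm (odd_pair i j)) (app (gen_op i j) (app sg v))"
proof -
  assume ij: "i \<in> indices n" "j \<in> indices n"
  obtain x y where d: "x \<in> part 0" "y \<in> part 1" "v = x + y" using part_ex by blast
  show ?thesis
  proof (cases "(i, j) \<in> generators n")
    case False
    then show ?thesis by (simp add: gen_op_def)
  next
    case True
    have nz: "i \<noteq> 0" "j \<noteq> 0" using ij by (auto simp: indices_def)
    note p = Lop_part[OF True d(1)] Lop_part[OF True d(2)]
    show ?thesis
    proof (cases "i * j > 0")
      case 1: True
      then have "\<not> odd_pair i j" by (auto simp: odd_pair_def zero_less_mult_iff)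
      moreover have "app (gen_op i j) x \<in> part 0" "app (gen_op i j) y \<in> part 1" using p 1 by (simp_all add: par_def)
      ultimately show ?thesis by (simp add: d(3) app_add_right sg_even sg_odd d(1,2))
    next
      case 1: False
      then have "odd_pair i j" using nz by (auto simp: odd_pair_def zero_less_mult_iff)
      moreover have "app (gen_op i j) x \<in> part 1" "app (gen_op i j) y \<in> part 0" using p 1 by (simp_all add: par_def)
      ultimately show ?thesis by (simp add: d(3) app_add_right sg_even sg_odd d(1,2))
    qed
  qed
qed

text \<open>Every element of \<open>Uq n\<close> is the class of a linear combination of words in
  the generators.\<close>

lemma act_stable:
  assumes W: "Q.stable W" and x: "x \<in> carrier (Uq n)" and v: "v \<in> W"
  shows "act x v \<in> W"
proof -
  note sub = Q.stable_subspace[OF W]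
  obtain y where y: "y \<in> carrier (free_algebra n)" "x = proj n y" using x by (auto simp: carrier_Uq)
  have word: "Poly_Mapping.single (Word ls) 1 \<in> carrier (free_algebra n) \<and> act_free (Poly_Mapping.single (Word ls) 1) v \<in> W"
    if "set ls \<subseteq> generators n" for ls
    using that
  proof (induction ls)
    case Nil
    show ?case
      using v act_free_one[of v] one_free_algebra_closed[of n] by (simp flip: single_one zero_word_def)
  next
    case (Cons p ls)
    obtain i j where p: "p = (i, j)" "(i, j) \<in> generators n" using Cons.prems by (cases p) auto
    have "act_free (gen i j * Poly_Mapping.single (Word ls) 1) v = app (gen_op i j) (act_free (Poly_Mapping.single (Word ls) 1) v)"
      using Cons p by (simp add: act_free_mult free_algebra_closed(7) app_Lop)
    then show ?case
      unfolding p single_word_Cons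
      using Cons W p by (auto simp: Q.stable_def free_algebra_closed(6,7))
  qed
  have single: "Poly_Mapping.single w c \<in> carrier (free_algebra n) \<and> act_free (Poly_Mapping.single w c) v \<in> W"
    if "set (letters w) \<subseteq> generators n" for w c
    unfolding single_scalar[of w c]
    using word[OF that] subspace_scale[OF sub] free_algebra_closed(2)[of c n]
    by (simp add: act_free_mult act_free_scalar free_algebra_closed(6))
  have keys: "set (letters w) \<subseteq> generators n" if "w \<in> Poly_Mapping.keys y" for w
    using y(1) that by (simp add: free_algebra_def)
  have "act_free y v = (\<Sum>w\<in>Poly_Mapping.keys y. act_free (Poly_Mapping.single w (Poly_Mapping.lookup y w)) v)"
    by (subst sum_single[of y], subst act_free_sum[THEN conjunct1]) (simp_all add: single keys)
  also have "\<dots> \<in> W" by (rule subspace_sum[OF sub]) (simp add: single keys)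
  finally show ?thesis using y(2) by (simp add: act_free_def)
qed

text \<open>The even and odd components of \<open>v\<close> are \<open>(v + sg v) / 2\<close> and
  \<open>(v - sg v) / 2\<close>, so a subspace contains them as soon as it is closed under
  \<open>sg\<close>; here 2 has to be invertible.\<close>

lemma submodule_iff: "submodule W \<longleftrightarrow> Q.stable W \<and> (\<forall>v\<in>W. app sg v \<in> W)"
proof
  assume W: "submodule W"
  then have sub: "subspace W" by (simp add: submodule_def)
  have "app (gen_op i j) v \<in> W" if "v \<in> W" for i j v
  proof (cases "(i, j) \<in> generators n")
    case True
    have "act (proj n (gen i j)) v \<in> W"
      using W that proj_closed[OF free_algebra_closed(7)[OF True]] by (simp add: submodule_def)
    then show ?thesis by (simp add: app_Lop True act_free_def)
  next
    case False
    then show ?thesis using subspace_0[OF sub] by (simp add: gen_op_def)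
  qed
  moreover have "app sg v \<in> W" if v: "v \<in> W" for v
  proof -
    have "internal_direct_sum UNIV (\<lambda>a. W \<inter> part a) W" using W by (simp add: submodule_def)
    then obtain f where f: "\<And>i. f i \<in> W \<inter> part i" "v = (\<Sum>i | f i \<noteq> 0. f i)"
      by (rule internal_direct_sumD[OF _ v]) auto
    have "app sg v = f 0 - f 1" unfolding f(2) bit_family_eq by (rule app_sg) (use f(1)[of 0] f(1)[of 1] in simp_all)
    moreover have "f 0 - f 1 \<in> W" by (rule subspace_diff[OF sub]) (use f(1)[of 0] f(1)[of 1] in simp_all)
    ultimately show ?thesis by simp
  qed
  ultimately show "Q.stable W \<and> (\<forall>v\<in>W. app sg v \<in> W)" using sub by (simp add: Q.stable_def)
next
  assume W: "Q.stable W \<and> (\<forall>v\<in>W. app sg v \<in> W)"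
  note sub = Q.stable_subspace[OF W[THEN conjunct1]]
  have "internal_direct_sum UNIV (\<lambda>a. W \<inter> part a) W"
    unfolding internal_direct_sum_def
  proof (intro conjI ballI)
    fix v assume v: "v \<in> W"
    obtain x y where d: "x \<in> part 0" "y \<in> part 1" "v = x + y" using part_ex by blast
    have half: "inverse 2 *s (w + w) = w" for w :: 'v
    proof -
      have "w + w = (2 :: Cq) *s w" by (simp only: one_add_one[symmetric] scale_left_distrib scale_one)
      then show ?thesis using two_nonzero by simp
    qed
    have s: "app sg v = x - y" using app_sg[OF d(1,2)] d(3) by simp
    have "inverse 2 *s (v + app sg v) = x" "inverse 2 *s (v - app sg v) = y"
      using half[of x] half[of y] by (simp_all add: s, simp_all add: d(3))
    moreover have "inverse 2 *s (v + app sg v) \<in> W" "inverse 2 *s (v - app sg v) \<in> W"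
      using v W by (auto intro!: subspace_scale[OF sub] subspace_add[OF sub] subspace_diff[OF sub])
    ultimately have xy: "x \<in> W" "y \<in> W" by simp_all
    define f where "f i = (if i = (0::bit) then x else y)" for i
    show "\<exists>!f. (\<forall>i\<in>UNIV. f i \<in> W \<inter> part i) \<and> (\<forall>i. i \<notin> UNIV \<longrightarrow> f i = 0) \<and> finite {i. f i \<noteq> 0} \<and> v = (\<Sum>i | f i \<noteq> 0. f i)"
      unfolding bit_family_eq
    proof (rule ex1I[of _ f])
      show "(\<forall>i\<in>UNIV. f i \<in> W \<inter> part i) \<and> (\<forall>i. i \<notin> UNIV \<longrightarrow> f i = 0) \<and> finite {i. f i \<noteq> 0} \<and> v = f 0 + f 1"
        using xy d by (simp add: f_def finite_bit)
      fix g assume g: "(\<forall>i\<in>UNIV. g i \<in> W \<inter> part i) \<and> (\<forall>i. i \<notin> UNIV \<longrightarrow> g i = 0) \<and> finite {i. g i \<noteq> 0} \<and> v = g 0 + g 1"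
      then have "g 0 = x \<and> g 1 = y" by (intro part_unique) (use g[THEN conjunct1, rule_format, of 0] g[THEN conjunct1, rule_format, of 1] g d in simp_all)
      then have "g i = f i" for i using bit_not_zero_iff[of i] by (auto simp: f_def)
      then show "g = f" by (rule ext)
    qed
  qed auto
  then show "submodule W" unfolding submodule_def using act_stable[OF conjunct1[OF W]] sub by simp
qed

section \<open>Weight spaces and condition (ii) in terms of the generators\<close>

lemma act_scale: "x \<in> carrier (Uq n) \<Longrightarrow> act x (c *s v) = c *s act x v"
  using act_free_scale[of _ c v] by (auto simp: carrier_Uq act_free_def)

lemma L_gen_closed: "(i, j) \<in> generators n \<Longrightarrow> L_gen n i j \<in> carrier (Uq n)"
  by (simp add: L_gen_def proj_closed free_algebra_closed(7))

lemma act_L_gen: "(i, j) \<in> generators n \<Longrightarrow> act (L_gen n i j) v = app (gen_op i j) v"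
  by (simp add: L_gen_def app_Lop act_free_def)

interpretation U: ring "Uq n" by (rule ring_Uq)

lemma act_pow:
  assumes x: "x \<in> carrier (Uq n)" and v: "act x v = c *s v"
  shows "act (x [^]\<^bsub>Uq n\<^esub> (m :: nat)) v = (c ^ m) *s v"
proof (induction m)
  case (Suc m)
  then show ?case
    using x v by (simp add: act_mult act_scale mult.commute)
qed (simp add: act_one)

lemma diag_generators: "i \<in> {1..int n} \<Longrightarrow> (i, i) \<in> generators n \<and> (- i, - i) \<in> generators n"
  by (auto simp: generators_def indices_def)

lemma q_ki_pow_closed: "i \<in> {1..int n} \<Longrightarrow> q_ki_pow n i a \<in> carrier (Uq n)"
  using diag_generators[of i] L_gen_closed by (simp add: q_ki_pow_def del: pow_nat)

lemma act_q_ki_pow: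
  assumes v: "v \<in> Q.wsp \<mu>" and i: "i \<in> {1..int n}"
  shows "act (q_ki_pow n i a) v = (qq powi (a * \<mu> i)) *s v"
proof -
  note g = diag_generators[OF i]
  have e: "act (L_gen n i i) v = (qq powi \<mu> i) *s v" "act (L_gen n (- i) (- i)) v = (qq powi (- \<mu> i)) *s v"
    using g Q.wspD[OF v, of i] Q.wspD_neg[OF v, of i] i by (simp_all add: act_L_gen)
  have p: "(qq powi b) ^ m = qq powi (int m * b)" for b :: int and m
    using power_int_power'[of qq b m] by (simp only: mult.commute[of b])
  show ?thesis
    using act_pow[OF _ e(1), of "nat a"] act_pow[OF _ e(2), of "nat (- a)"] g L_gen_closed
    by (simp add: q_ki_pow_def p del: pow_nat)
qed

lemma foldr_q_ki_pow:
  assumes v: "v \<in> Q.wsp \<mu>" and xs: "set xs \<subseteq> {1..int n}"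
  shows "foldr (\<lambda>i x. q_ki_pow n i (h i) \<otimes>\<^bsub>Uq n\<^esub> x) xs \<one>\<^bsub>Uq n\<^esub> \<in> carrier (Uq n) \<and>
    act (foldr (\<lambda>i x. q_ki_pow n i (h i) \<otimes>\<^bsub>Uq n\<^esub> x) xs \<one>\<^bsub>Uq n\<^esub>) v = (qq powi (\<Sum>i\<leftarrow>xs. h i * \<mu> i)) *s v"
  using xs
proof (induction xs)
  case Nil
  then show ?case by (simp add: act_one)
next
  case (Cons i xs)
  then show ?case
    using q_ki_pow_closed[of i "h i"] act_q_ki_pow[OF v, of i "h i"]
    by (simp add: act_mult act_scale power_int_add qq_nonzero mult.commute)
qed

lemma foldr_k_basis:
  assumes "set xs \<subseteq> {1..int n}" "distinct xs" "i \<in> {1..int n}"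
  shows "foldr (\<lambda>j x. q_ki_pow n j (k_basis i j) \<otimes>\<^bsub>Uq n\<^esub> x) xs \<one>\<^bsub>Uq n\<^esub> = (if i \<in> set xs then L_gen n i i else \<one>\<^bsub>Uq n\<^esub>)"
  using assms(1,2)
proof (induction xs)
  case (Cons j xs)
  have "q_ki_pow n j (k_basis i j) = (if j = i then L_gen n i i else \<one>\<^bsub>Uq n\<^esub>)"
    using L_gen_closed diag_generators[OF assms(3)] by (simp add: q_ki_pow_def k_basis_def del: pow_nat)
  then show ?case
    using Cons L_gen_closed diag_generators[OF assms(3)] by auto
qed simp

lemma pairing_k_basis: "i \<in> {1..int n} \<Longrightarrow> pairing n (k_basis i) \<mu> = \<mu> i"
  by (simp add: pairing_def k_basis_def if_distrib[of "\<lambda>x. x * _"] cong: if_cong)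

text \<open>Taking \<open>h\<close> to be a basis vector recovers the eigenvalue of
  \<open>L i i\<close>; conversely these eigenvalues determine the action of every
  \<open>q_pow n h\<close>.\<close>

lemma weight_space_eq: "weight_space \<mu> = Q.wsp \<mu>"
proof (intro equalityI subsetI)
  fix v assume v: "v \<in> weight_space \<mu>"
  show "v \<in> Q.wsp \<mu>"
    unfolding Q.wsp_def
  proof (intro CollectI ballI)
    fix i assume i: "i \<in> {1..int n}"
    have "k_basis i \<in> colattice_P n" using i by (auto simp: colattice_P_def k_basis_def)
    moreover have "q_pow n (k_basis i) = L_gen n i i"
      unfolding q_pow_def by (subst foldr_k_basis) (use i in auto)
    ultimately have "act (L_gen n i i) v = (qq powi pairing n (k_basis i) \<mu>) *s v"
      using v by (auto simp: weight_space_def)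
    then show "app (gen_op i i) v = (qq powi \<mu> i) *s v"
      using diag_generators[OF i] by (simp add: act_L_gen pairing_k_basis[OF i])
  qed
next
  fix v assume v: "v \<in> Q.wsp \<mu>"
  have "(\<Sum>i\<leftarrow>[1..int n]. h i * \<mu> i) = pairing n h \<mu>" for h
    by (simp add: pairing_def sum_list_distinct_conv_sum_set)
  then show "v \<in> weight_space \<mu>"
    using foldr_q_ki_pow[OF v, of "[1..int n]"] by (simp add: weight_space_def q_pow_def)
qed

lemma k_bar_zero:
  assumes i: "i \<in> {1..int n}" and v: "act (k_bar n i) v = 0"
  shows "app (gen_op (- i) i) v = 0"
proof -
  have g: "(- i, i) \<in> generators n" using i by (auto simp: generators_def indices_def)
  have "qq \<noteq> inverse qq" using qq_powi_inj[of 1 "- 1"] by (auto simp: power_int_minus)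
  then have "- (1 / (qq - inverse qq)) \<noteq> 0" by simp
  moreover have "act (k_bar n i) v = (- (1 / (qq - inverse qq))) *s app (gen_op (- i) i) v"
    unfolding k_bar_def
    by (simp only: act_mult proj_closed free_algebra_closed(2) L_gen_closed[OF g] act_scalar act_L_gen[OF g])
  ultimately show ?thesis using v by simp
qed

text \<open>Take the weights occurring in the decompositions of the finitely many vectors of
  \<open>B\<close>: the vectors that decompose over this set form a subspace containing
  \<open>B\<close>.\<close>

lemma finite_weight_decomposition:
  assumes fin: "finite B" "span B = UNIV" and dec: "internal_direct_sum (lattice_P n) weight_space UNIV"
  shows "\<exists>\<Omega>. finite \<Omega> \<and> \<Omega> \<subseteq> wt \<and> (\<forall>v. \<exists>f. (\<forall>\<mu>\<in>\<Omega>. f \<mu> \<in> weight_space \<mu>) \<and> v = sum f \<Omega>)"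
proof -
  have "\<exists>f. (\<forall>\<mu>. f \<mu> \<noteq> 0 \<longrightarrow> \<mu> \<in> lattice_P n \<and> f \<mu> \<in> weight_space \<mu>) \<and> finite {\<mu>. f \<mu> \<noteq> 0} \<and> v = (\<Sum>\<mu> | f \<mu> \<noteq> 0. f \<mu>)" for v
    by (rule internal_direct_sumD[OF dec, of v]) blast+
  then obtain f where f: "\<And>v \<mu>. f v \<mu> \<noteq> 0 \<Longrightarrow> \<mu> \<in> lattice_P n \<and> f v \<mu> \<in> weight_space \<mu>"
    "\<And>v. finite {\<mu>. f v \<mu> \<noteq> 0}" "\<And>v. v = (\<Sum>\<mu> | f v \<mu> \<noteq> 0. f v \<mu>)" by metis
  define \<Omega> where "\<Omega> = (\<Union>b\<in>B. {\<mu>. f b \<mu> \<noteq> 0})"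
  have \<Omega>: "finite \<Omega>" unfolding \<Omega>_def using fin(1) f(2) by simp
  have zero: "0 \<in> weight_space \<mu>" for \<mu> using subspace_0[OF Q.subspace_wsp] by (simp add: weight_space_eq)
  define D where "D = {v. \<exists>f. (\<forall>\<mu>\<in>\<Omega>. f \<mu> \<in> weight_space \<mu>) \<and> v = sum f \<Omega>}"
  have "subspace D"
    unfolding subspace_def
  proof (intro conjI ballI allI)
    show "0 \<in> D" unfolding D_def using zero by (intro CollectI exI[of _ "\<lambda>_. 0"]) simp
    fix x y assume "x \<in> D" "y \<in> D"
    then obtain f g where "\<forall>\<mu>\<in>\<Omega>. f \<mu> \<in> weight_space \<mu>" "x = sum f \<Omega>" "\<forall>\<mu>\<in>\<Omega>. g \<mu> \<in> weight_space \<mu>" "y = sum g \<Omega>"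
      by (auto simp: D_def)
    then show "x + y \<in> D"
      unfolding D_def using subspace_add[OF Q.subspace_wsp]
      by (intro CollectI exI[of _ "\<lambda>\<mu>. f \<mu> + g \<mu>"]) (simp add: sum.distrib weight_space_eq)
  next
    fix c x assume "x \<in> D"
    then obtain f where "\<forall>\<mu>\<in>\<Omega>. f \<mu> \<in> weight_space \<mu>" "x = sum f \<Omega>" by (auto simp: D_def)
    then show "c *s x \<in> D"
      unfolding D_def using subspace_scale[OF Q.subspace_wsp]
      by (intro CollectI exI[of _ "\<lambda>\<mu>. c *s f \<mu>"]) (simp add: scale_sum_right weight_space_eq)
  qed
  moreover have "B \<subseteq> D"
  proof
    fix b assume b: "b \<in> B"
    have "f b \<mu> \<in> weight_space \<mu>" for \<mu> using f(1)[of b \<mu>] zero by (cases "f b \<mu> = 0") auto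
    moreover have "sum (f b) \<Omega> = b"
      by (subst (2) f(3)[of b], rule sum.mono_neutral_right[OF \<Omega>]) (use b in \<open>auto simp: \<Omega>_def\<close>)
    ultimately show "b \<in> D" unfolding D_def by (intro CollectI exI[of _ "f b"]) simp
  qed
  ultimately have "span B \<subseteq> D" by (rule span_minimal[rotated])
  then have "\<forall>v. v \<in> D" using fin(2) by blast
  moreover have "\<Omega> \<subseteq> wt"
  proof
    fix \<mu> assume "\<mu> \<in> \<Omega>"
    then obtain b where "f b \<mu> \<noteq> 0" by (auto simp: \<Omega>_def)
    then show "\<mu> \<in> wt" using f(1)[of b \<mu>] by (auto simp: wt_def)
  qed
  ultimately show ?thesis using \<Omega> unfolding D_def by (intro exI[of _ \<Omega>]) simp
qed

theorem category_O_ge0_completely_reducible: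
  assumes "category_O_ge0"
  shows "completely_reducible"
proof -
  obtain B where B: "finite B" "span B = UNIV" and dec: "internal_direct_sum (lattice_P n) weight_space UNIV"
    and ge0: "wt \<subseteq> lattice_P_ge0 n"
    and bar: "\<And>\<mu> i v. \<mu> \<in> lattice_P_ge0 n \<Longrightarrow> i \<in> {1..int n} \<Longrightarrow> pairing n (k_basis i) \<mu> = 0 \<Longrightarrow>
       v \<in> weight_space \<mu> \<Longrightarrow> act (k_bar n i) v = 0"
    using assms unfolding category_O_ge0_def by metis
  obtain \<Omega> where \<Omega>: "finite \<Omega>" "\<Omega> \<subseteq> wt" "\<And>v. \<exists>f. (\<forall>\<mu>\<in>\<Omega>. f \<mu> \<in> weight_space \<mu>) \<and> v = sum f \<Omega>"
    using finite_weight_decomposition[OF B dec] by auto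
  interpret queer_module scale n gen_op sg \<Omega>
  proof (intro queer_module.intro Q.queer_ops_axioms queer_module_axioms.intro)
    show "\<Omega> \<subseteq> lattice_P_ge0 n" using \<Omega>(2) ge0 by (rule subset_trans)
    show "\<exists>f. (\<forall>\<mu>\<in>\<Omega>. f \<mu> \<in> Q.wsp \<mu>) \<and> v = sum f \<Omega>" for v using \<Omega>(3) by (simp add: weight_space_eq)
    fix \<mu> i v assume a: "\<mu> \<in> \<Omega>" "1 \<le> i" "i \<le> int n" "\<mu> i = 0" "v \<in> Q.wsp \<mu>"
    show "app (gen_op (- i) i) v = 0"
    proof (rule k_bar_zero)
      have "\<mu> \<in> lattice_P_ge0 n" using \<Omega>(2) ge0 a(1) by (meson subsetD)
      then show "act (k_bar n i) v = 0"
        by (rule bar) (use a in \<open>simp_all add: pairing_k_basis weight_space_eq\<close>)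
    qed (use a in simp)
  qed (use B in \<open>auto simp: sg_scale sg_sg sg_Lop \<Omega>(1)\<close>)
  have eq: "submodule = submod" by (rule ext) (simp add: submodule_iff submod_def)
  have inter: "submod (M \<inter> N)" if "submod M" "submod N" for M N
    using that by (auto simp: submod_def Q.stable_def intro: subspace_inter)
  have "\<exists>S. (\<forall>W\<in>S. submod W \<and> W \<noteq> {0} \<and> (\<forall>W'. submod W' \<and> W' \<subseteq> W \<longrightarrow> W' = {0} \<or> W' = W)) \<and>
    internal_direct_sum S (\<lambda>W. W) UNIV"
  proof (rule semisimple_decomposition[OF _ _ _ inter complement])
    show "\<exists>B. finite B \<and> span B = UNIV" using B by blast
    show "subspace M" if "submod M" for M using that by (simp add: submod_def Q.stable_subspace)
    show "submod UNIV" by (simp add: submod_def Q.stable_def)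
  qed
  then show ?thesis unfolding completely_reducible_def irreducible_submodule_def eq .
qed

end

theorem theorem6p5:
  fixes n :: nat
    and scale :: "Cq \<Rightarrow> 'v::ab_group_add \<Rightarrow> 'v"
    and act :: "free set \<Rightarrow> 'v \<Rightarrow> 'v"
    and part :: "bit \<Rightarrow> 'v set"
  assumes "n \<ge> 1"
    and "Uq_module scale n act part"
    and "Uq_module.category_O_ge0 scale n act"
  shows "Uq_module.completely_reducible scale n act part"
  by (rule Uq_module.category_O_ge0_completely_reducible) fact+

end
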